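(* Every non-zero finite dimensional (complex) unitary representation of $\mathrm{SL}_4(\mathbf{Z})$ contains a non-zero $\mathrm{SL}_2(\mathbf{Z})$-invariant vector. That is, for every finite dimensional complex Hilbert space $V \neq 0$ and every group homomorphism $\rho : \mathrm{SL}_4(\mathbf{Z}) \to U(V)$ into the unitary group of $V$, there is a vector $v \in V$, $v \neq 0$, such that $\rho(g)v = v$ for all $g$ in the subgroup $\mathrm{SL}_2(\mathbf{Z}) \leq \mathrm{SL}_4(\mathbf{Z})$.
   Context: $\mathrm{SL}_2(\mathbf{Z})$ is viewed as the subgroup of $\mathrm{SL}_4(\mathbf{Z})$ consisting of all matrices in $\mathrm{SL}_4(\mathbf{Z})$ of the form $\begin{pmatrix} * & * & 0 & 0\\ * & * & 0 & 0\\ 0 & 0 & 1 & 0\\ 0 & 0 & 0 & 1\end{pmatrix}$. *)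

theory Defs
  imports "HOL-Analysis.Analysis" "HOL-Algebra.Group"
begin

text \<open>
  The library has no class of complex inner product spaces, so the structure is given explicitly.
  The inner product is linear in the first argument.  Completeness is not listed, since it is
  automatic in finite dimension.
\<close>

locale fd_complex_hilbert_space = vector_space scl
  for scl :: "complex \<Rightarrow> 'v::ab_group_add \<Rightarrow> 'v" +
  fixes ip :: "'v \<Rightarrow> 'v \<Rightarrow> complex"
  assumes ip_add_left: "ip (x + y) z = ip x z + ip y z"
    and ip_scale_left: "ip (scl c x) y = c * ip x y"
    and ip_commute: "ip x y = cnj (ip y x)"
    and ip_pos: "x \<noteq> 0 \<Longrightarrow> 0 < Re (ip x x)"
    and finite_dim: "\<exists>B. finite B \<and> span B = UNIV"

definition unitary_group ::
    "(complex \<Rightarrow> 'v::ab_group_add \<Rightarrow> 'v) \<Rightarrow> ('v \<Rightarrow> 'v \<Rightarrow> complex) \<Rightarrow> ('v \<Rightarrow> 'v) monoid" where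
  "unitary_group scl ip =
    \<lparr>carrier = {T. Vector_Spaces.linear scl scl T \<and> bij T \<and> (\<forall>x y. ip (T x) (T y) = ip x y)},
     monoid.mult = (\<circ>), one = id\<rparr>"

definition SL_int :: "(int ^ 'n ^ 'n::finite) monoid" where
  "SL_int = \<lparr>carrier = {A. det A = 1}, monoid.mult = (**), one = mat 1\<rparr>"

abbreviation SL4Z :: "(int ^ 4 ^ 4) monoid" where
  "SL4Z \<equiv> SL_int"

text \<open>
  The upper left block has indices 1 and 2; an entry outside it agrees with that of the identity.
\<close>

definition SL2Z_in_SL4Z :: "(int ^ 4 ^ 4) set" where
  "SL2Z_in_SL4Z = {A \<in> carrier SL4Z.
     \<forall>i j. \<not> (i \<in> {1, 2} \<and> j \<in> {1, 2}) \<longrightarrow> A $ i $ j = (if i = j then 1 else 0)}"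

end

theory Submission
  imports Defs
    "HOL-Number_Theory.Number_Theory"
    "HOL-Computational_Algebra.Fundamental_Theorem_Algebra"
begin

text \<open>
  Write \<open>x\<^sub>i\<^sub>j(t)\<close> for the images of the elementary matrices.  On an eigenspace of \<open>x\<^sub>i\<^sub>j(1)\<close> the
  operators \<open>x\<^sub>i\<^sub>k(1)\<close> and \<open>x\<^sub>k\<^sub>j(1)\<close> commute up to the eigenvalue, so the spectrum of \<open>x\<^sub>k\<^sub>j(1)\<close> is stable
  under multiplication by it; being finite, it forces the eigenvalue to be a root of unity.  Hence
  \<open>x\<^sub>i\<^sub>j(N) = 1\<close> for some \<open>N > 0\<close>, and the \<open>x\<^sub>i\<^sub>j\<close> satisfy the Steinberg relations over \<open>\<int>/N\<close>.  The
  idempotents of \<open>\<int>/N\<close> split them into commuting families over the rings \<open>\<int>/p\<^sup>k\<close>, so that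
  invariant vectors can be sought one prime at a time.

  Over \<open>\<int>/p\<^sup>k\<close> the characters of the abelian group generated by
  \<open>x\<^sub>1\<^sub>3, x\<^sub>1\<^sub>4, x\<^sub>2\<^sub>3, x\<^sub>2\<^sub>4\<close> are \<open>2 \<times> 2\<close> matrices, on which \<open>SL\<^sub>2\<close> acts by multiplication.  Among the
  characters with a unit entry that occur, take one whose determinant has the least valuation \<open>b\<close>.
  If \<open>x\<^sub>1\<^sub>2(p\<^sup>k\<^sup>-\<^sup>b)\<close> moved an eigenvector, then a character of the conjugate group generated by
  \<open>x\<^sub>1\<^sub>2, x\<^sub>1\<^sub>3, x\<^sub>4\<^sub>2, x\<^sub>4\<^sub>3\<close> would have a smaller valuation.  So the stabilizer of the character fixes the
  eigenvector \<open>v\<close>, and the sum of the \<open>SL\<^sub>2\<close>-translates of \<open>v\<close> is invariant and not zero.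

  This uses that a word in \<open>x\<^sub>1\<^sub>2\<close> and \<open>x\<^sub>2\<^sub>1\<close> acts trivially as soon as its matrix over \<open>\<int>/p\<^sup>k\<close> is the
  identity, which is the congruence subgroup property in disguise and amounts to the vanishing of
  the Steinberg symbols over \<open>\<int>/p\<^sup>k\<close>.  They vanish for odd \<open>p\<close>, and for \<open>p = 2\<close> all of them vanish if
  \<open>{-1, -1} = w\<^sub>1\<^sub>2(-1)\<^sup>4\<close> does; the latter holds because \<open>w\<^sub>1\<^sub>2(1)\<^sup>4 = 1\<close> already in \<open>SL\<^sub>4(\<int>)\<close>.
\<close>

section \<open>Steinberg relations\<close>

text \<open>The library has a class of noncommutative groups in additive notation only.\<close>

class group_mult = monoid_mult + inverse +
  assumes group_left_inverse: "inverse a * a = 1"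
begin

lemma inverse_mult_cancel_left: "inverse a * (a * b) = b"
  by (simp flip: mult_assoc add: group_left_inverse)

lemma group_mult_left_cancel: "a * b = a * c \<longleftrightarrow> b = c"
  by (metis inverse_mult_cancel_left)

lemma group_right_inverse: "a * inverse a = 1"
  by (metis group_left_inverse inverse_mult_cancel_left mult_1_right)

lemma mult_inverse_cancel_left: "a * (inverse a * b) = b"
  by (simp flip: mult_assoc add: group_right_inverse)

lemma group_mult_right_cancel: "b * a = c * a \<longleftrightarrow> b = c"
  by (metis group_right_inverse mult_1_right mult_assoc)

lemma group_inverse_unique: "a * b = 1 \<Longrightarrow> inverse a = b"
  by (metis group_right_inverse group_mult_left_cancel)

lemma group_inverse_inverse [simp]: "inverse (inverse a) = a"
  by (simp add: group_inverse_unique group_left_inverse)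

lemma group_inverse_one [simp]: "inverse 1 = 1"
  by (simp add: group_inverse_unique)

lemma group_inverse_mult: "inverse (a * b) = inverse b * inverse a"
  by (rule group_inverse_unique) (simp add: mult_assoc mult_inverse_cancel_left group_right_inverse)

lemma commute_mult: "z * x = x * z \<Longrightarrow> z * y = y * z \<Longrightarrow> z * (x * y) = x * y * z"
  by (metis mult_assoc)

lemmas group_simps = mult_assoc group_left_inverse group_right_inverse inverse_mult_cancel_left
  mult_inverse_cancel_left group_inverse_inverse group_inverse_one group_inverse_mult
  group_mult_left_cancel group_mult_right_cancel

end

text \<open>\<open>X_period\<close> makes \<open>X i j\<close> depend only on the parameter modulo
  \<open>q\<close>, so these are the Steinberg relations over Z/q. With at least three indices every
  \<open>X i j\<close> is a commutator through a third index, which is how conjugation formulas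
  reach it.\<close>

locale steinberg =
  fixes X :: "'i \<Rightarrow> 'i \<Rightarrow> int \<Rightarrow> 'g::group_mult" and q :: int
  assumes q_pos: "q > 0"
    and third_index: "\<exists>k. k \<noteq> i \<and> k \<noteq> j"
    and X_add: "i \<noteq> j \<Longrightarrow> X i j (s + t) = X i j s * X i j t"
    and X_comm: "\<lbrakk>i \<noteq> j; j \<noteq> k; i \<noteq> k\<rbrakk> \<Longrightarrow> X i j s * X j k t = X i k (s * t) * X j k t * X i j s"
    and X_commute: "\<lbrakk>i \<noteq> j; k \<noteq> l; j \<noteq> k; i \<noteq> l\<rbrakk> \<Longrightarrow> X i j s * X k l t = X k l t * X i j s"
    and X_period: "i \<noteq> j \<Longrightarrow> X i j q = 1"
begin

lemma X_0 [simp]: "i \<noteq> j \<Longrightarrow> X i j 0 = 1"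
  using X_add[of i j 0 0] by (metis add_0 group_mult_left_cancel mult_1_right)

lemma X_uminus: "i \<noteq> j \<Longrightarrow> X i j (- t) = inverse (X i j t)"
  using X_add[of i j t "-t"] by (simp add: group_inverse_unique)

lemma X_period_mult: assumes "i \<noteq> j" shows "X i j (q * t) = 1"
proof -
  have *: "X i j (q * int n) = 1" for n
    by (induction n) (auto simp: algebra_simps X_add X_period assms)
  show ?thesis
    by (cases t rule: int_cases2) (use * X_uminus[OF assms] in \<open>auto simp: group_inverse_one\<close>)
qed

lemma X_cong: assumes "i \<noteq> j" "[s = t] (mod q)" shows "X i j s = X i j t"
proof -
  obtain k where "t = s + q * k" using assms(2) by (auto simp: cong_iff_lin)
  then show ?thesis by (simp add: X_add X_period_mult assms(1))
qed

abbreviation inv_mod :: "int \<Rightarrow> int" where "inv_mod \<equiv> modular_inverse q"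

lemma inv_mod: "coprime u q \<Longrightarrow> [u * inv_mod u = 1] (mod q)"
  using cong_modular_inverse1 by blast

lemma X_comm_move:
  "\<lbrakk>i \<noteq> j; j \<noteq> k; i \<noteq> k\<rbrakk> \<Longrightarrow> X j k t * X i j s = X i k (- (s * t)) * (X i j s * X j k t)"
  by (simp add: X_comm X_uminus group_simps)

lemma X_commutator:
  "\<lbrakk>i \<noteq> j; j \<noteq> k; i \<noteq> k\<rbrakk> \<Longrightarrow> X i j s * X j k t * inverse (X i j s) * inverse (X j k t) = X i k (s * t)"
  by (simp add: X_comm group_simps)

text \<open>In matrices over Z/q and for a unit \<open>u\<close>, this is the monomial matrix with
  \<open>u\<close> at (i, j) and -1/u at (j, i), and \<open>h i j u\<close> is the diagonal matrix
  with \<open>u\<close> at i and 1/u at j.\<close>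

definition w :: "'i \<Rightarrow> 'i \<Rightarrow> int \<Rightarrow> 'g" where
  "w i j u = X i j u * X j i (- inv_mod u) * X i j u"

definition h :: "'i \<Rightarrow> 'i \<Rightarrow> int \<Rightarrow> 'g" where
  "h i j u = w i j u * w i j (-1)"

definition conjugate :: "'g \<Rightarrow> 'g \<Rightarrow> 'g" where "conjugate g x = g * x * inverse g"

lemma conjugate_mult: "conjugate g (x * y) = conjugate g x * conjugate g y"
  and conjugate_mult_left: "conjugate (g * g') x = conjugate g (conjugate g' x)"
  and conjugate_inverse: "conjugate g (inverse x) = inverse (conjugate g x)"
  by (simp_all add: conjugate_def group_simps)

lemma conjugate_fix: "g * x = x * g \<Longrightarrow> conjugate g x = x"
  by (simp add: conjugate_def group_simps)

lemma conjugate_X_commute: "\<lbrakk>i \<noteq> j; k \<noteq> l; j \<noteq> k; i \<noteq> l\<rbrakk> \<Longrightarrow> conjugate (X i j s) (X k l t) = X k l t"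
  by (simp add: conjugate_fix X_commute)

lemma conjugate_X_right: "\<lbrakk>i \<noteq> j; j \<noteq> k; i \<noteq> k\<rbrakk> \<Longrightarrow> conjugate (X i j s) (X j k t) = X i k (s * t) * X j k t"
  by (simp add: conjugate_def X_comm group_simps)

lemma conjugate_X_left:
  assumes "i \<noteq> j" "j \<noteq> k" "i \<noteq> k" shows "conjugate (X j k t) (X i j s) = X i k (- (s * t)) * X i j s"
  using X_comm_move[OF assms] by (simp add: conjugate_def group_simps)

lemma X_cancel:
  assumes "i \<noteq> j" "g * X i j t = X i j t * g" "[s + t = 0] (mod q)"
  shows "X i j s * (g * X i j t) = g"
  using X_cong[of i j "s + t" 0] assms by (simp flip: mult.assoc X_add)

section \<open>Conjugation by Weyl elements\<close>

context fixes i j k :: 'i and u :: int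
  assumes ij: "i \<noteq> j" and jk: "j \<noteq> k" and ik: "i \<noteq> k" and u: "coprime u q"
begin

lemma inv_cong: "[u * inv_mod u * t = t] (mod q)" "[inv_mod u * u * t = t] (mod q)"
   using inv_mod[OF u] by (metis cong_scalar_right mult.left_neutral, metis cong_scalar_right mult.left_neutral mult.commute)

lemma inv_cong_add: "[- (inv_mod u * (u * t)) + t = 0] (mod q)" "[- (u * (inv_mod u * t)) + t = 0] (mod q)"
   "[- (t * u * inv_mod u) + t = 0] (mod q)" "[- (t * inv_mod u * u) + t = 0] (mod q)"
   "[t - (inv_mod u * (u * t)) = 0] (mod q)" "[t - (u * (inv_mod u * t)) = 0] (mod q)"
   "[t - (t * u * inv_mod u) = 0] (mod q)" "[t - (t * inv_mod u * u) = 0] (mod q)"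
  using inv_cong[of t] by (simp_all add: cong_iff_dvd_diff algebra_simps dvd_diff_commute)

lemmas uneq = ij jk ik ij[symmetric] jk[symmetric] ik[symmetric]

text \<open>The conjugation is carried through the three factors of \<open>w\<close>, the rightmost
  first; the unwanted terms cancel because \<open>u * inv_mod u\<close> is 1 modulo
  \<open>q\<close>. The next three lemmas go the same way.\<close>

lemma conjugate_w_jk: "conjugate (w i j u) (X j k t) = X i k (u * t)"
proof -
  have "conjugate (w i j u) (X j k t) = conjugate (X i j u) (X j k (- (inv_mod u * (u * t))) * (X i k (u * t) * X j k t))"
    by (simp add: w_def conjugate_mult_left conjugate_mult conjugate_X_right conjugate_X_commute uneq mult.assoc)
  also have "\<dots> = X i k (u * t)"
    by (subst X_cancel) (simp_all add: uneq X_commute inv_cong_add conjugate_X_commute)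
  finally show ?thesis .
qed

lemma conjugate_w_ik: "conjugate (w i j u) (X i k t) = X j k (- (inv_mod u * t))"
proof -
  have "conjugate (w i j u) (X i k t) = conjugate (X i j u) (X j k (- (inv_mod u * t)) * X i k t)"
    by (simp add: w_def conjugate_mult_left conjugate_mult conjugate_X_right conjugate_X_commute uneq mult.assoc)
  also have "\<dots> = X i k (- (u * (inv_mod u * t))) * (X j k (- (inv_mod u * t)) * X i k t)"
    by (simp add: conjugate_mult conjugate_X_right conjugate_X_commute uneq mult.assoc)
  also have "\<dots> = X j k (- (inv_mod u * t))"
    by (subst X_cancel) (simp_all add: uneq X_commute inv_cong_add conjugate_X_commute)
  finally show ?thesis .
qed

lemma conjugate_w_ki: "conjugate (w i j u) (X k i t) = X k j (- (t * u))"
proof -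
  have "conjugate (w i j u) (X k i t) = conjugate (X i j u) (X k i (- (t * u * inv_mod u)) * (X k j (- (t * u)) * X k i t))"
    by (simp add: w_def conjugate_mult_left conjugate_mult conjugate_X_left conjugate_X_commute uneq mult.assoc)
  also have "\<dots> = X k j (- (t * u))"
    by (subst X_cancel) (simp_all add: uneq X_commute inv_cong_add conjugate_X_commute)
  finally show ?thesis .
qed

lemma conjugate_w_kj: "conjugate (w i j u) (X k j t) = X k i (t * inv_mod u)"
proof -
  have "conjugate (w i j u) (X k j t) = conjugate (X i j u) (X k i (t * inv_mod u) * X k j t)"
    by (simp add: w_def conjugate_mult_left conjugate_mult conjugate_X_left conjugate_X_commute uneq mult.assoc)
  also have "\<dots> = X k j (- (t * inv_mod u * u)) * (X k i (t * inv_mod u) * X k j t)"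
    by (simp add: conjugate_mult conjugate_X_left conjugate_X_commute uneq mult.assoc)
  also have "\<dots> = X k i (t * inv_mod u)"
    by (subst X_cancel) (simp_all add: uneq X_commute inv_cong_add conjugate_X_commute)
  finally show ?thesis .
qed

text \<open>No relation moves \<open>X i j\<close> past \<open>X j i\<close>. Written as a
  commutator of \<open>X i k\<close> and \<open>X k j\<close>, however, it can be conjugated factor
  by factor.\<close>

lemma conjugate_w_ij: "conjugate (w i j u) (X i j t) = X j i (- (inv_mod u ^ 2 * t))"
proof -
  have "conjugate (w i j u) (X i j t) = conjugate (w i j u) (X i k t * X k j 1 * inverse (X i k t) * inverse (X k j 1))"
    using X_commutator[of i k j t 1] uneq by simp
  also have "\<dots> = X j k (- (inv_mod u * t)) * X k i (inv_mod u) * inverse (X j k (- (inv_mod u * t))) * inverse (X k i (inv_mod u))"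
    by (simp add: conjugate_mult conjugate_inverse conjugate_w_ik conjugate_w_kj)
  also have "\<dots> = X j i (- (inv_mod u ^ 2 * t))"
    by (subst X_commutator) (simp_all add: uneq power2_eq_square mult_ac)
  finally show ?thesis .
qed

lemma conjugate_w_ji: "conjugate (w i j u) (X j i t) = X i j (- (u ^ 2 * t))"
proof -
  have "conjugate (w i j u) (X j i t) = conjugate (w i j u) (X j k t * X k i 1 * inverse (X j k t) * inverse (X k i 1))"
    using X_commutator[of j k i t 1] uneq by simp
  also have "\<dots> = X i k (u * t) * X k j (- u) * inverse (X i k (u * t)) * inverse (X k j (- u))"
    by (simp add: conjugate_mult conjugate_inverse conjugate_w_jk conjugate_w_ki)
  also have "\<dots> = X i j (- (u ^ 2 * t))"
    by (subst X_commutator) (simp_all add: uneq power2_eq_square mult_ac)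
  finally show ?thesis .
qed

lemma conjugate_w_kl: "l \<noteq> k \<Longrightarrow> i \<noteq> l \<Longrightarrow> j \<noteq> l \<Longrightarrow> conjugate (w i j u) (X k l t) = X k l t"
  by (simp add: w_def conjugate_mult_left conjugate_mult conjugate_X_commute uneq)

end
end

section \<open>Weyl, diagonal and central elements\<close>

context steinberg
begin

lemma coprime_inv_mod: "coprime u q \<Longrightarrow> coprime (inv_mod u) q"
  using inv_mod[of u] by (metis coprime_iff_invertible_int mult.commute)

lemma inv_mod_unique: assumes "coprime u q" "[u * t = 1] (mod q)" shows "[inv_mod u = t] (mod q)"
proof -
  have "[u * inv_mod u = u * t] (mod q)"
    using inv_mod[OF assms(1)] assms(2) by (metis cong_sym cong_trans)
  then show ?thesis using assms(1) by (simp add: cong_mult_lcancel)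
qed

lemma inv_mod_cong: assumes "coprime u q" "[u = v] (mod q)" shows "[inv_mod u = inv_mod v] (mod q)"
proof -
  have v: "coprime v q" by (rule cong_imp_coprime[OF assms(2,1)])
  have "[u * inv_mod v = 1] (mod q)"
    by (rule cong_trans[OF cong_scalar_right[OF assms(2)] inv_mod[OF v]])
  then show ?thesis by (rule inv_mod_unique[OF assms(1)])
qed

lemma inv_mod_minus: "coprime u q \<Longrightarrow> [inv_mod (- u) = - inv_mod u] (mod q)"
  by (rule inv_mod_unique) (auto simp: inv_mod)

lemma inv_mod_minus_one: "[inv_mod (- 1) = - 1] (mod q)"
  by (rule inv_mod_unique) auto

lemma w_cong: assumes "i \<noteq> j" "coprime u q" "[u = v] (mod q)" shows "w i j u = w i j v"
proof -
  have "[- inv_mod u = - inv_mod v] (mod q)" using inv_mod_cong[OF assms(2,3)] by (simp add: cong_minus_minus_iff)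
  then show ?thesis using assms X_cong[of i j u v] X_cong[of j i "- inv_mod u" "- inv_mod v"]
    by (simp add: w_def)
qed

lemma w_uminus: assumes "i \<noteq> j" "coprime u q" shows "w i j (- u) = inverse (w i j u)"
proof -
  have "[- inv_mod (- u) = inv_mod u] (mod q)" using inv_mod_minus[OF assms(2)]
    by (metis cong_minus_minus_iff minus_minus)
  then have "X j i (- inv_mod (- u)) = X j i (inv_mod u)"
    by (rule X_cong[OF assms(1)[symmetric]])
  then show ?thesis using assms(1)
    by (simp add: w_def X_uminus group_simps)
qed

text \<open>Inverse scalars on the two opposite root subgroups keep the middle parameter of
  \<open>w\<close> the negative inverse of the outer one.\<close>

lemma conjugate_w:
  assumes "\<And>t. conjugate g (X a b t) = X c d (s * t)" "\<And>t. conjugate g (X b a t) = X d c (s' * t)"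
    and "[s * s' = 1] (mod q)" "c \<noteq> d" "coprime u q"
  shows "conjugate g (w a b u) = w c d (s * u)"
proof -
  have s: "coprime s q" unfolding coprime_iff_invertible_int using assms(3) by blast
  have "[s * u * (s' * inv_mod u) = 1] (mod q)"
    using cong_mult[OF assms(3) inv_mod[OF assms(5)]] by (simp add: mult_ac)
  then have "[inv_mod (s * u) = s' * inv_mod u] (mod q)"
    using s assms(5) by (intro inv_mod_unique) auto
  then have "[- inv_mod (s * u) = s' * (- inv_mod u)] (mod q)"
    by (simp add: cong_minus_minus_iff)
  then have "X d c (s' * (- inv_mod u)) = X d c (- inv_mod (s * u))"
    by (rule X_cong[OF assms(4)[symmetric] cong_sym])
  then show ?thesis by (simp only: w_def conjugate_mult assms(1,2))
qed

text \<open>\<open>w i j u\<close> commutes with itself, but conjugation by it exchanges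
  \<open>X i j\<close> and \<open>X j i\<close>; applied to its own three factors it gives the same
  element read from the other side.\<close>

lemma w_swap: assumes "i \<noteq> j" "coprime u q" shows "w i j u = w j i (- inv_mod u)"
proof -
  obtain k where k: "k \<noteq> i" "k \<noteq> j" using third_index by blast
  have 1: "[- (inv_mod u ^ 2 * u) = - inv_mod u] (mod q)"
    using inv_cong(1)[OF assms(1) k(2)[symmetric] k(1)[symmetric] assms(2), of "inv_mod u"]
    by (simp add: cong_minus_minus_iff power2_eq_square mult_ac)
  have 2: "[- (u\<^sup>2 * - inv_mod u) = u] (mod q)"
    using inv_cong(1)[OF assms(1) k(2)[symmetric] k(1)[symmetric] assms(2), of u]
    by (simp add: power2_eq_square mult_ac)
  have "[inv_mod (- inv_mod u) = - u] (mod q)"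
    using coprime_inv_mod[OF assms(2)] inv_mod[OF assms(2)] by (intro inv_mod_unique) (auto simp: mult.commute)
  then have 3: "[- inv_mod (- inv_mod u) = u] (mod q)"
    using cong_minus_minus_iff[of _ "-u"] by simp
  have "w i j u = conjugate (w i j u) (w i j u)" by (simp add: conjugate_fix)
  also have "\<dots> = X j i (- inv_mod u) * X i j u * X j i (- inv_mod u)"
    using assms k X_cong[OF assms(1) 2] X_cong[OF assms(1)[symmetric] 1]
    by (subst (2) w_def) (simp add: conjugate_mult conjugate_w_ij[of i j k] conjugate_w_ji[of i j k])
  also have "\<dots> = w j i (- inv_mod u)"
    using X_cong[OF assms(1) 3] by (simp add: w_def)
  finally show ?thesis .
qed

context fixes i j k :: 'i and u :: int
  assumes ij: "i \<noteq> j" and jk: "j \<noteq> k" and ik: "i \<noteq> k" and u: "coprime u q"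
begin

lemma
  shows conjugate_h_jk: "conjugate (h i j u) (X j k t) = X j k (inv_mod u * t)"
  and conjugate_h_ik: "conjugate (h i j u) (X i k t) = X i k (u * t)"
  and conjugate_h_ki: "conjugate (h i j u) (X k i t) = X k i (inv_mod u * t)"
  and conjugate_h_kj: "conjugate (h i j u) (X k j t) = X k j (u * t)"
  and conjugate_h_ij: "conjugate (h i j u) (X i j t) = X i j (u\<^sup>2 * t)"
  and conjugate_h_ji: "conjugate (h i j u) (X j i t) = X j i ((inv_mod u)\<^sup>2 * t)"
proof -
  have *: "[- inv_mod (- 1) * t = t] (mod q)" "[t * inv_mod (- 1) = - t] (mod q)"
     "[(inv_mod (- 1))\<^sup>2 * t = t] (mod q)" for t
    using inv_mod_minus_one apply (metis cong_minus_minus_iff cong_scalar_right minus_minus mult_1_left)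
    using inv_mod_minus_one apply (metis cong_scalar_left mult_minus1_right)
    using inv_mod_minus_one by (metis cong_pow cong_scalar_right mult_1_left power2_minus power_one)
  show "conjugate (h i j u) (X j k t) = X j k (inv_mod u * t)"
   "conjugate (h i j u) (X i k t) = X i k (u * t)"
   "conjugate (h i j u) (X k i t) = X k i (inv_mod u * t)"
   "conjugate (h i j u) (X k j t) = X k j (u * t)"
   "conjugate (h i j u) (X i j t) = X i j (u\<^sup>2 * t)"
   "conjugate (h i j u) (X j i t) = X j i ((inv_mod u)\<^sup>2 * t)"
    using ij jk ik u X_cong[OF jk *(1), of t] X_cong[OF ik[symmetric] *(2), of t] X_cong[OF ij[symmetric] *(3), of t]
    by (simp_all add: h_def conjugate_mult_left conjugate_w_jk[of i j k] conjugate_w_ik[of i j k] conjugate_w_ki[of i j k] conjugate_w_kj[of i j k]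
      conjugate_w_ij[of i j k] conjugate_w_ji[of i j k] X_uminus conjugate_inverse mult_ac)
qed

lemma conjugate_h_kl: "l \<noteq> k \<Longrightarrow> i \<noteq> l \<Longrightarrow> j \<noteq> l \<Longrightarrow> conjugate (h i j u) (X k l t) = X k l t"
  using ij jk ik u by (simp add: h_def conjugate_mult_left conjugate_w_kl)

end

lemma h_cong: assumes "i \<noteq> j" "coprime u q" "[u = v] (mod q)" shows "h i j u = h i j v"
  using w_cong[OF assms] by (simp add: h_def)

lemma h_1 [simp]: "i \<noteq> j \<Longrightarrow> h i j 1 = 1"
  by (simp add: h_def w_uminus group_simps)

definition central :: "'g \<Rightarrow> bool" where
  "central z \<longleftrightarrow> (\<forall>a b t. a \<noteq> b \<longrightarrow> z * X a b t = X a b t * z)"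

lemma central_X: "central z \<Longrightarrow> a \<noteq> b \<Longrightarrow> z * X a b t = X a b t * z"
  by (simp add: central_def)

lemma central_mult: "central z \<Longrightarrow> central z' \<Longrightarrow> central (z * z')"
  unfolding central_def by (metis mult.assoc)
lemma central_of_conjugate_eq:
  assumes "\<And>a b t. a \<noteq> b \<Longrightarrow> conjugate g (X a b t) = conjugate g' (X a b t)" shows "central (inverse g * g')"
  unfolding central_def
proof (intro allI impI)
  fix a b t assume "a \<noteq> (b :: 'i)"
  then have "inverse g * conjugate g (X a b t) * g' = inverse g * conjugate g' (X a b t) * g'" using assms by simp
  then show "inverse g * g' * X a b t = X a b t * (inverse g * g')" by (simp add: conjugate_def group_simps)
qed

lemma central_inverse: "central z \<Longrightarrow> central (inverse z)"
  using central_of_conjugate_eq[of z 1] by (simp add: conjugate_fix central_X)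
lemma central_w: "central z \<Longrightarrow> i \<noteq> j \<Longrightarrow> z * w i j u = w i j u * z"
  unfolding w_def by (intro commute_mult central_X) auto
lemma central_h: "central z \<Longrightarrow> i \<noteq> j \<Longrightarrow> z * h i j u = h i j u * z"
  unfolding h_def by (intro commute_mult central_w)

section \<open>Steinberg symbols\<close>

text \<open>The Steinberg symbol {u, v}, the failure of \<open>h\<close> to be multiplicative. For
  units, its matrix over Z/q is the identity.\<close>

definition symbol :: "'i \<Rightarrow> 'i \<Rightarrow> int \<Rightarrow> int \<Rightarrow> 'g" where
  "symbol i j u v = inverse (h i j (u * v)) * (h i j u * h i j v)"

lemma h_mult_h: "h i j u * h i j v = h i j (u * v) * symbol i j u v"
  by (simp add: symbol_def group_simps)

lemma inv_mod_mult: "coprime u q \<Longrightarrow> coprime v q \<Longrightarrow> [inv_mod (u * v) = inv_mod u * inv_mod v] (mod q)"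
proof (rule inv_mod_unique)
  assume "coprime u q" "coprime v q"
  then show "[u * v * (inv_mod u * inv_mod v) = 1] (mod q)"
    using cong_mult[OF inv_mod[of u] inv_mod[of v]] by (simp add: mult_ac)
qed auto

text \<open>Conjugation by \<open>h i j u\<close> multiplies the parameter of each
  \<open>X a b\<close> by an integral power of \<open>u\<close> that depends only on the position.
  Such powers are multiplicative in \<open>u\<close>, so \<open>h i j (u * v)\<close> and
  \<open>h i j u * h i j v\<close> act alike on all generators.\<close>

lemma symbol_central: assumes "i \<noteq> j" "coprime u q" "coprime v q" shows "central (symbol i j u v)"
  unfolding symbol_def
proof (rule central_of_conjugate_eq)
  fix a b :: 'i and t assume ab: "a \<noteq> b"
  have uv: "coprime (u * v) q" using assms by simp
  have c: "[inv_mod (u * v) * t = inv_mod u * (inv_mod v * t)] (mod q)"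
    using inv_mod_mult[OF assms(2,3)] by (metis cong_scalar_right mult.assoc)
  have c2: "[(inv_mod (u * v))\<^sup>2 * t = (inv_mod u)\<^sup>2 * ((inv_mod v)\<^sup>2 * t)] (mod q)"
    using cong_pow[OF inv_mod_mult[OF assms(2,3)], of 2]
    by (metis cong_scalar_right mult.assoc power_mult_distrib)
  obtain k where k: "k \<noteq> i" "k \<noteq> j" using third_index by blast
  note k' = k[symmetric]
  consider "a = i" "b = j" | "a = j" "b = i" | "a = i" "b \<noteq> j" | "a = j" "b \<noteq> i"
    | "b = i" "a \<noteq> j" | "b = j" "a \<noteq> i" | "a \<notin> {i, j}" "b \<notin> {i, j}" by auto
  then show "conjugate (h i j (u * v)) (X a b t) = conjugate (h i j u * h i j v) (X a b t)"
  proof cases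
    case 1 then show ?thesis using assms uv k' by (simp add: conjugate_mult_left conjugate_h_ij[of i j k] power_mult_distrib mult_ac)
  next
    case 2 then show ?thesis using assms uv k' X_cong[OF assms(1)[symmetric] c2] by (simp add: conjugate_mult_left conjugate_h_ji[of i j k])
  next
    case 3 then show ?thesis using assms uv ab by (simp add: conjugate_mult_left conjugate_h_ik[of i j b] mult_ac)
  next
    case 4 then show ?thesis using assms uv ab X_cong[OF ab c] by (simp add: conjugate_mult_left conjugate_h_jk[of i j b])
  next
    case 5 then show ?thesis using assms uv ab X_cong[OF ab c] by (simp add: conjugate_mult_left conjugate_h_ki[of i j a])
  next
    case 6 then show ?thesis using assms uv ab by (simp add: conjugate_mult_left conjugate_h_kj[of i j a] mult_ac)
  next
    case 7
    then have "conjugate (h i j x) (X a b t) = X a b t" if "coprime x q" for x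
      using conjugate_h_kl[of i j a x b t] assms(1) ab that by auto
    then show ?thesis using assms uv by (simp add: conjugate_mult_left)
  qed
qed

end

context steinberg
begin

lemma symbol_cong:
  assumes "i \<noteq> j" "coprime u q" "coprime v q" "[u = u'] (mod q)" "[v = v'] (mod q)"
  shows "symbol i j u v = symbol i j u' v'"
  using h_cong[OF assms(1,2,4)] h_cong[OF assms(1,3,5)] h_cong[of i j "u * v" "u' * v'"] assms
  by (simp add: symbol_def cong_mult)

lemma symbol_1 [simp]: "i \<noteq> j \<Longrightarrow> symbol i j 1 v = 1" "i \<noteq> j \<Longrightarrow> symbol i j u 1 = 1"
  by (simp_all add: symbol_def group_simps)

lemma w_mult_w: "i \<noteq> j \<Longrightarrow> coprime v q \<Longrightarrow> w i j u * w i j (- v) = h i j u * inverse (h i j v)"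
  by (simp add: h_def w_uminus group_simps)

text \<open>In matrices the two diagonal elements commute; here their commutator is a symbol. Indeed
  the conjugation multiplies the parameter of \<open>w i j\<close> by \<open>u\<close> and turns
  \<open>h i j v\<close> into \<open>w i j (u * v) * w i j (- u)\<close>. Bilinearity of the symbol
  follows, since conjugation respects products in both arguments.\<close>

lemma conjugate_h_ik_h_ij:
  assumes "i \<noteq> j" "j \<noteq> k" "i \<noteq> k" "coprime u q" "coprime v q"
  shows "conjugate (h i k u) (h i j v) = h i j v * inverse (symbol i j v u)"
proof -
  have "conjugate (h i k u) (w i j x) = w i j (u * x)" if "coprime x q" for x
    by (rule conjugate_w[where s' = "inv_mod u"])
       (use assms that in \<open>simp_all add: conjugate_h_ik[of i k j] conjugate_h_ki[of i k j] inv_mod\<close>)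
  then have "conjugate (h i k u) (h i j v) = w i j (u * v) * w i j (- u)"
    using assms by (simp add: h_def conjugate_mult)
  also have "\<dots> = h i j (v * u) * inverse (h i j u)"
    using assms by (simp add: w_mult_w mult.commute)
  also have "h i j (v * u) = h i j v * h i j u * inverse (symbol i j v u)"
    by (simp add: h_mult_h group_simps)
  also have "\<dots> * inverse (h i j u) = h i j v * (h i j u * inverse (symbol i j v u) * inverse (h i j u))"
    by (simp add: mult.assoc)
  also have "h i j u * inverse (symbol i j v u) = inverse (symbol i j v u) * h i j u"
    using central_h[OF central_inverse[OF symbol_central]] assms by simp
  finally show ?thesis by (simp add: group_simps)
qed

lemma conjugate_h_central: "central z \<Longrightarrow> i \<noteq> j \<Longrightarrow> conjugate (h i j u) z = z"
  by (rule conjugate_fix) (simp add: central_h)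

lemma conjugate_central_h: "central z \<Longrightarrow> i \<noteq> j \<Longrightarrow> conjugate z (h i j u) = h i j u"
  by (rule conjugate_fix) (simp add: central_h)

lemma central_commute: assumes "central z" "i \<noteq> j" shows "z * symbol i j u v = symbol i j u v * z"
proof -
  have "z * inverse (h i j (u * v)) = inverse (h i j (u * v)) * z"
    using central_h[OF central_inverse[OF assms(1)] assms(2), of "u * v"]
    by (metis group_inverse_inverse group_inverse_mult)
  then show ?thesis unfolding symbol_def using assms by (intro commute_mult central_h)
qed

text \<open>Both sides come from conjugating \<open>h i j u * h i j u'\<close> by
  \<open>h i k v\<close>; the central symbols are then collected.\<close>

lemma symbol_mult_left:
  assumes "i \<noteq> j" "coprime u q" "coprime u' q" "coprime v q"
  shows "symbol i j (u * u') v = symbol i j u v * symbol i j u' v"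
proof -
  obtain k where k: "k \<noteq> i" "k \<noteq> j" using third_index by blast
  let ?g = "h i k v"
  have c [simp]: "central (symbol i j u u')" "central (symbol i j u v)" "central (symbol i j u' v)" "central (symbol i j (u * u') v)"
    using assms by (auto intro!: symbol_central)
  have "h i j (u * u') * inverse (symbol i j (u * u') v) * symbol i j u u' = conjugate ?g (h i j (u * u') * symbol i j u u')"
    using assms k by (simp add: conjugate_mult conjugate_h_ik_h_ij conjugate_h_central)
  also have "\<dots> = conjugate ?g (h i j u * h i j u')" by (simp add: h_mult_h)
  also have "\<dots> = h i j u * (inverse (symbol i j u v) * h i j u') * inverse (symbol i j u' v)"
    using assms k by (simp add: conjugate_mult conjugate_h_ik_h_ij mult.assoc)
  also have "inverse (symbol i j u v) * h i j u' = h i j u' * inverse (symbol i j u v)"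
    using assms by (intro central_h central_inverse c)
  also have "h i j u * (h i j u' * inverse (symbol i j u v)) * inverse (symbol i j u' v) =
     h i j u * h i j u' * (inverse (symbol i j u v) * inverse (symbol i j u' v))"
    by (simp add: mult.assoc)
  also have "\<dots> = h i j (u * u') * (symbol i j u u' * (inverse (symbol i j u v) * inverse (symbol i j u' v)))"
    by (simp add: h_mult_h mult.assoc)
  finally have "inverse (symbol i j (u * u') v) * symbol i j u u' = symbol i j u u' * (inverse (symbol i j u v) * inverse (symbol i j u' v))"
    by (simp add: mult.assoc group_mult_left_cancel)
  also have "\<dots> = (inverse (symbol i j u v) * inverse (symbol i j u' v)) * symbol i j u u'"
    using assms by (intro central_commute[symmetric] central_mult central_inverse c)
  finally have "inverse (symbol i j (u * u') v) = inverse (symbol i j u v) * inverse (symbol i j u' v)"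
    by (simp only: group_mult_right_cancel)
  then have "symbol i j (u * u') v = symbol i j u' v * symbol i j u v"
    by (metis group_inverse_inverse group_inverse_mult)
  then show ?thesis using central_commute[OF c(2), of i j u' v] assms by simp
qed

text \<open>Conjugation by \<open>h i k v * h i k v'\<close> is evaluated in two steps and in one;
  in the latter the central factor \<open>symbol i k v v'\<close> has no effect.\<close>

lemma symbol_mult_right:
  assumes "i \<noteq> j" "coprime u q" "coprime v q" "coprime v' q"
  shows "symbol i j u (v * v') = symbol i j u v * symbol i j u v'"
proof -
  obtain k where k: "k \<noteq> i" "k \<noteq> j" using third_index by blast
  have c [simp]: "central (symbol i k v v')" "central (symbol i j u v)" "central (symbol i j u v')" "central (symbol i j u (v * v'))"
    using assms k by (auto intro!: symbol_central)
  have "h i j u * inverse (symbol i j u (v * v')) = conjugate (h i k (v * v') * symbol i k v v') (h i j u)"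
    using assms k by (simp add: conjugate_mult_left conjugate_h_ik_h_ij conjugate_central_h)
  also have "\<dots> = conjugate (h i k v) (conjugate (h i k v') (h i j u))"
    by (simp add: conjugate_mult_left flip: h_mult_h)
  also have "\<dots> = h i j u * (inverse (symbol i j u v) * inverse (symbol i j u v'))"
    using assms k by (simp add: conjugate_mult conjugate_h_ik_h_ij conjugate_h_central central_inverse mult.assoc)
  finally have "inverse (symbol i j u (v * v')) = inverse (symbol i j u v) * inverse (symbol i j u v')"
    by (simp add: group_mult_left_cancel)
  then have "symbol i j u (v * v') = symbol i j u v' * symbol i j u v"
    by (metis group_inverse_inverse group_inverse_mult)
  then show ?thesis using central_commute[OF c(2), of i j u v'] assms by simp
qed

text \<open>Conjugating \<open>w i j (-1)\<close> by \<open>w i j u\<close> gives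
  \<open>w i j (- (u ^ 2))\<close>, and hence
  \<open>h i j u * h i j (- u) = h i j (- (u ^ 2))\<close>.\<close>

lemma symbol_uminus:
  assumes "i \<noteq> j" "coprime u q"
  shows "symbol i j u (- u) = 1"
proof -
  obtain k where k: "j \<noteq> k" "i \<noteq> k" using third_index by metis
  have inv: "[inv_mod u ^ 2 * u\<^sup>2 = 1] (mod q)"
    using cong_pow[OF inv_mod[OF assms(2)], of 2] by (simp add: power_mult_distrib mult.commute)
  have "conjugate (w i j u) (w i j (-1)) = w j i ((- (inv_mod u ^ 2)) * (- 1))"
    by (rule conjugate_w[where s' = "- (u ^ 2)"])
      (use assms k inv in \<open>simp_all add: conjugate_w_ij[of i j k] conjugate_w_ji[of i j k]\<close>)
  also have "\<dots> = w j i (inv_mod u ^ 2)" by simp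
  also have "\<dots> = w i j (- inv_mod (inv_mod u ^ 2))"
    using assms coprime_inv_mod by (intro w_swap) auto
  also have "\<dots> = w i j (- (u ^ 2))"
    using assms coprime_inv_mod inv by (intro w_cong) (auto simp: cong_minus_minus_iff intro!: inv_mod_unique)
  finally have "w i j u * w i j (-1) = w i j (- (u\<^sup>2)) * w i j u"
    by (metis conjugate_def group_left_inverse mult.assoc mult_1_right)
  then have "h i j u * h i j (- u) = h i j (- (u\<^sup>2))"
    using assms by (simp add: h_def w_uminus group_simps)
  then show ?thesis by (simp add: symbol_def power2_eq_square group_left_inverse)
qed

text \<open>By bilinearity {uv, -uv} = 1 expands into {u, v}{v, u} times symbols of the form {x,
  -x}.\<close>

lemma symbol_anti:
  assumes "i \<noteq> j" "coprime u q" "coprime v q"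
  shows "symbol i j v u = inverse (symbol i j u v)"
proof -
  have "1 = symbol i j (u * v) ((- u) * v)"
    using symbol_uminus[of i j "u * v"] assms by simp
  also have "\<dots> = symbol i j u v * (symbol i j v (- 1) * symbol i j v u) * symbol i j v v"
    using assms symbol_uminus[OF assms(1,2)] symbol_mult_right[of i j v "-1" u] symbol_mult_left[of i j u v "(- u) * v"]
      symbol_mult_right[of i j u "- u" v] symbol_mult_right[of i j v "- u" v]
    by (simp add: mult.assoc)
  also have "\<dots> = symbol i j u v * symbol i j v u * (symbol i j v (- 1) * symbol i j v v)"
  proof -
    have "symbol i j v (-1) * symbol i j v u = symbol i j v u * symbol i j v (-1)"
      using assms by (intro central_commute symbol_central) auto
    then show ?thesis by (simp add: mult.assoc)
  qed
  also have "symbol i j v (- 1) * symbol i j v v = 1"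
    using assms symbol_uminus[of i j v] by (simp flip: symbol_mult_right)
  finally show ?thesis by (metis group_inverse_unique mult_1_right)
qed

end

section \<open>Gauss decompositions and the symbol relations they give\<close>

context steinberg
begin

lemma inv_modE: assumes "coprime u q"
  obtains u' k where "inv_mod u = u'" "u * u' = 1 + q * k" "coprime u' q"
  using cong_sym[OF inv_mod[OF assms]] coprime_inv_mod[OF assms] unfolding cong_iff_lin by blast

lemma cong_dvdI: "q dvd s - t \<Longrightarrow> [s = t] (mod q)"
  by (auto simp: cong_iff_dvd_diff)

lemma X_eq_w:
  assumes "i \<noteq> j" "coprime v q" "[v * v' = 1] (mod q)"
  shows "X i j v = X j i v' * w i j v * X j i v'"
proof -
  have c: "[inv_mod v = v'] (mod q)" by (rule inv_mod_unique[OF assms(2,3)])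
  have c': "coprime (- inv_mod v) q" using assms coprime_inv_mod by auto
  have "[inv_mod (- inv_mod v) = - v] (mod q)"
    using inv_mod[OF assms(2)] by (intro inv_mod_unique c') (simp add: mult.commute)
  then have "[- inv_mod (- inv_mod v) = v] (mod q)"
    using cong_minus_minus_iff[of _ "- v"] by simp
  then have "w j i (- inv_mod v) = X j i (- inv_mod v) * X i j v * X j i (- inv_mod v)"
    using X_cong[OF assms(1)] by (simp add: w_def)
  moreover have "X j i (inv_mod v) = X j i v'" using X_cong assms(1) c by simp
  ultimately show ?thesis using assms(1,2) w_swap[OF assms(1,2)]
    by (simp add: X_uminus group_simps)
qed

text \<open>Gauss decomposition of the matrix with rows (n, a) and (b, 1). For a unit
  \<open>b\<close> one has a = n/b - 1/b modulo \<open>q\<close>, and each of the two summands leads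
  to a Weyl element.\<close>

lemma X_mult_X_right_unit:
  assumes "i \<noteq> j" "coprime b q" "coprime n q" "n = 1 + a * b"
  shows "X i j a * X j i b = X j i (b * inv_mod n) *
    (w i j (n * inv_mod b) * w i j (- inv_mod b)) * X i j (a * inv_mod n)"
proof -
  obtain m where m: "m \<noteq> i" "m \<noteq> j" using third_index by blast
  have c_n: "coprime n q" using assms by simp
  obtain n' k where n': "inv_mod n = n'" "coprime n' q" and k: "n * n' = 1 + q * k" using inv_modE[OF c_n] by metis
  have c_b: "coprime b q" using assms by simp
  obtain b' l where b': "inv_mod b = b'" "coprime b' q" and l: "b * b' = 1 + q * l" using inv_modE[OF c_b] by metis
  obtain c r where c: "inv_mod (- b) = c" and r: "- b * c = 1 + q * r" using inv_modE[of "- b"] c_b coprime_minus_left_iff by metis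
  let ?v = "n * b'" and ?iv = "b * n'"
  have v: "coprime ?v q" using assms b' by simp
  have 1: "[?v * ?iv = 1] (mod q)" by (rule cong_dvdI) (use k l in Groebner_Basis.algebra)
  have 2: "[a = ?v + (- b')] (mod q)" by (rule cong_dvdI) (use k l assms(4) in Groebner_Basis.algebra)
  have 3: "[- (c)\<^sup>2 * (?iv + (- b)) = a * n'] (mod q)"
    by (rule cong_dvdI) (use k r assms(4) in Groebner_Basis.algebra)
  have "X i j a * X j i b = X i j ?v * (X i j (- b') * X j i b)"
    by (simp only: X_cong[OF assms(1) 2] X_add[OF assms(1)] mult.assoc)
  also have "X i j (- b') * X j i b = X j i (- b) * w j i b"
    using assms(1) by (simp add: w_def b' X_uminus group_simps)
  also have "X i j ?v * (X j i (- b) * w j i b) = X j i ?iv * w i j ?v * (X j i (?iv + (- b)) * w j i b)"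
    by (simp only: X_eq_w[OF assms(1) v 1] X_add[OF assms(1)[symmetric]] mult.assoc)
  also have "X j i (?iv + (- b)) * w j i b = w j i b * conjugate (w j i (- b)) (X j i (?iv + (- b)))"
    using assms(1,2) by (simp add: w_uminus conjugate_def group_simps)
  also have "conjugate (w j i (- b)) (X j i (?iv + (- b))) = X i j (- (c)\<^sup>2 * (?iv + (- b)))"
    using assms(1,2) m by (subst conjugate_w_ij[of j i m]) (auto simp: c)
  also have "\<dots> = X i j (a * n')" by (rule X_cong[OF assms(1) 3])
  also have "w j i b = w i j (- b')" using w_swap[of j i b] assms by (simp add: b')
  finally show ?thesis by (simp add: n' b' mult.assoc)
qed

text \<open>Here \<open>a\<close> is the unit: splitting off \<open>w i j a\<close> changes the
  parameter \<open>b\<close> into 1/a + b, which is the unit n/a modulo \<open>q\<close>.\<close>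

lemma X_mult_X_left_unit:
  assumes "i \<noteq> j" "coprime a q" "coprime n q" "n = 1 + a * b"
  shows "X i j a * X j i b = X j i (b * inv_mod n) *
    (w i j a * w i j (- (a * inv_mod n))) * X i j (a * inv_mod n)"
proof -
  obtain m where m: "m \<noteq> i" "m \<noteq> j" using third_index by blast
  have c_n: "coprime n q" using assms by simp
  obtain n' k where n': "inv_mod n = n'" "coprime n' q" and k: "n * n' = 1 + q * k" using inv_modE[OF c_n] by metis
  have c_a: "coprime a q" using assms by simp
  obtain a' l where a': "inv_mod a = a'" "coprime a' q" and l: "a * a' = 1 + q * l" using inv_modE[OF c_a] by metis
  let ?v = "n * a'" and ?iv = "a * n'"
  have v: "coprime ?v q" using assms n' a' by simp
  have 1: "[?v * ?iv = 1] (mod q)" by (rule cong_dvdI) (use k l in Groebner_Basis.algebra)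
  have 2: "[a' + b = ?v] (mod q)" by (rule cong_dvdI) (use k l assms(4) in Groebner_Basis.algebra)
  have 3: "[a' + (- ((a')\<^sup>2 * ?iv)) = b * n'] (mod q)"
    by (rule cong_dvdI) (use k l assms(4) in Groebner_Basis.algebra)
  have "X i j a * X j i b = X j i (a') * (w i j a * X j i (a' + b))"
    using X_eq_w[OF assms(1,2) inv_mod[OF assms(2)]] a' assms(1) by (simp add: X_add mult.assoc)
  also have "X j i (a' + b) = X i j ?iv * w j i ?v * X i j ?iv"
    using X_cong[OF _ 2] X_eq_w[OF _ v 1] assms(1) by simp
  also have "w i j a * (X i j ?iv * w j i ?v * X i j ?iv) =
    conjugate (w i j a) (X i j ?iv) * (w i j a * w j i ?v * X i j ?iv)"
    by (simp add: conjugate_def group_simps)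
  also have "conjugate (w i j a) (X i j ?iv) = X j i (- ((a')\<^sup>2 * ?iv))"
    using assms(1,2) m by (subst conjugate_w_ij[of i j m]) (auto simp: a')
  also have "w j i ?v = w i j (- inv_mod ?v)" using assms v by (intro w_swap) auto
  also have "\<dots> = w i j (- ?iv)" using v 1 assms
    by (intro w_cong) (auto simp: cong_minus_minus_iff intro!: inv_mod_unique)
  also have "X j i (a') * (X j i (- ((a')\<^sup>2 * ?iv)) * (w i j a * w i j (- ?iv) * X i j ?iv)) =
     X j i (b * n') * (w i j a * w i j (- ?iv) * X i j ?iv)"
    using X_cong[OF _ 3, of j i] assms(1) X_add[of j i "a'" "- ((a')\<^sup>2 * ?iv)"] by (simp flip: mult.assoc)
  finally show ?thesis by (simp add: n' a' mult.assoc)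
qed

lemma h_mult_inverse_h:
  assumes "i \<noteq> j" "coprime u q" "coprime v q"
  shows "h i j (u * v) * inverse (h i j v) = h i j u * inverse (symbol i j u v)"
proof -
  have "h i j (u * v) * inverse (h i j v) = h i j u * (h i j v * inverse (symbol i j u v) * inverse (h i j v))"
    by (simp add: symbol_def group_simps)
  also have "h i j v * inverse (symbol i j u v) = inverse (symbol i j u v) * h i j v"
    using assms by (intro central_h[symmetric] central_inverse symbol_central)
  finally show ?thesis by (simp add: group_simps)
qed

lemma X_mult_X_symbol:
  assumes "i \<noteq> j" "coprime b q" "coprime n q" "n = 1 + a * b"
  shows "X i j a * X j i b = X j i (b * inv_mod n) * (h i j n * symbol i j n b) * X i j (a * inv_mod n)"
proof -
  have b: "coprime (inv_mod b) q" using assms coprime_inv_mod by simp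
  have "1 = symbol i j n (b * inv_mod b)"
    using assms b symbol_cong[of i j n "b * inv_mod b" n 1] inv_mod[OF assms(2)] by simp
  then have "inverse (symbol i j n (inv_mod b)) = symbol i j n b"
    using assms b symbol_mult_right[of i j n "inv_mod b" b] by (intro group_inverse_unique) (simp add: mult.commute)
  then show ?thesis
    using X_mult_X_right_unit[OF assms] w_mult_w[of i j "inv_mod b"] h_mult_inverse_h[of i j n "inv_mod b"] assms b
    by simp
qed

text \<open>When \<open>a\<close> and \<open>b\<close> are both units, the two Gauss decompositions
  describe the same product. Comparing their middle factors gives the relation {x, 1 - x} = 1 for x
  = 1 + ab.\<close>

lemma symbol_steinberg:
  assumes "i \<noteq> j" "coprime a q" "coprime b q" "coprime (1 + a * b) q"
  shows "symbol i j (1 + a * b) (- a * b) = 1"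
proof -
  define n where "n = 1 + a * b"
  have n: "coprime n q" using assms by (simp add: n_def)
  obtain n' k where N: "inv_mod n = n'" "coprime n' q" and k: "n * n' = 1 + q * k" using inv_modE[OF n] by metis
  have n': "coprime n' q" "coprime (a * n') q" using N assms by auto
  have c: "[n * (a * n') = a] (mod q)" by (rule cong_dvdI) (use k in Groebner_Basis.algebra)
  note c1 = symbol_central[OF assms(1)]
  have "h i j n * symbol i j n b = w i j a * w i j (- (a * n'))"
    using X_mult_X_symbol[OF assms(1,3) n n_def] X_mult_X_left_unit[OF assms(1,2) n n_def]
    by (simp add: N group_mult_left_cancel group_mult_right_cancel)
  also have "\<dots> = h i j (n * (a * n')) * inverse (h i j (a * n'))"
    using w_mult_w[of i j "a * n'" a] h_cong[OF assms(1) _ c] n n' assms by simp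
  also have "\<dots> = h i j n * inverse (symbol i j n (a * n'))"
    using assms n n' by (intro h_mult_inverse_h) auto
  finally have "symbol i j n b = inverse (symbol i j n (a * n'))"
    by (simp add: group_simps)
  then have "1 = symbol i j n (a * n') * symbol i j n b" by (simp add: group_simps)
  also have "\<dots> = symbol i j n (a * n') * symbol i j n b * symbol i j n (- n)"
    using symbol_uminus[OF assms(1) n] by simp
  also have "\<dots> = symbol i j n (a * n' * b * (- n))"
    using assms n n' symbol_mult_right[of i j n "a * n'" b] symbol_mult_right[of i j n "a * n' * b" "- n"] by simp
  also have "\<dots> = symbol i j n (- a * b)"
    by (rule symbol_cong[OF assms(1) n _ cong_refl cong_dvdI])
      (use assms n n' in simp, use k in Groebner_Basis.algebra)
  finally show ?thesis by (simp add: n_def)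
qed

text \<open>For a sum of two units the decomposition is applied twice, first to \<open>b\<close> and
  then to \<open>c\<close> with a/n in place of \<open>a\<close>. The second diagonal entry is 1 +
  ac/n = t. Each application contributes a symbol, and a third one comes from
  \<open>h i j n * h i j t\<close>.\<close>

lemma X_two_step:
  assumes "i \<noteq> j" "coprime b q" "coprime c q" "coprime n q" "coprime s q" "n = 1 + a * b" "s = 1 + a * (b + c)"
  defines "t \<equiv> s * inv_mod n"
  shows "X i j a * X j i (b + c) = X j i ((b + c) * inv_mod s) *
    (h i j s * (symbol i j n t * symbol i j n b * symbol i j t c)) * X i j (a * inv_mod s)"
proof -
  note ij = assms(1)
  note ji = assms(1)[symmetric]
  obtain m where m: "m \<noteq> i" "m \<noteq> j" using third_index by blast
  have c_n: "coprime n q" using assms by simp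
  obtain n' k where n': "inv_mod n = n'" "coprime n' q" and k: "n * n' = 1 + q * k" using inv_modE[OF c_n] by metis
  have c_s: "coprime s q" using assms by simp
  obtain s' l where s': "inv_mod s = s'" and l: "s * s' = 1 + q * l" using inv_modE[OF c_s] by metis
  have t': "t = s * n'" by (simp add: t_def n')
  \<comment> \<open>\<open>r\<close> agrees with \<open>t\<close> modulo \<open>q\<close>, but it
    has literally the form that \<open>X_mult_X_symbol\<close> requires.\<close>
  define r where "r = 1 + (a * n') * c"
  have r: "r = t - q * k" using k assms(6,7) unfolding r_def t' by Groebner_Basis.algebra
  have rt: "[r = t] (mod q)" by (simp add: r cong_iff_dvd_diff)
  have t: "coprime t q" using assms n' by (auto simp: t')
  have rq: "coprime r q" by (rule cong_imp_coprime[OF cong_sym[OF rt] t])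
  have "[inv_mod r = n * s'] (mod q)"
    by (rule inv_mod_unique[OF rq], rule cong_dvdI)
      (use k l r t' in Groebner_Basis.algebra)
  from cong_sym[OF this] obtain r' z where r': "inv_mod r = r'" and z: "r' = n * s' + q * z" unfolding cong_iff_lin by metis
  have 1: "[b * n' + n' ^ 2 * (c * r')  = (b + c) * s'] (mod q)"
    by (rule cong_dvdI)
      (use k l z assms(6,7) in Groebner_Basis.algebra)
  have 2: "[a * n' * r' = a * s'] (mod q)"
    by (rule cong_dvdI) (use k z in Groebner_Basis.algebra)
  have 3: "[n * t = s] (mod q)"
    by (rule cong_dvdI) (use k t' in Groebner_Basis.algebra)
  have c [simp]: "central (symbol i j n b)" "central (symbol i j n t)" "central (symbol i j t c)"
    using assms t by (auto intro!: symbol_central)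
  let ?b = "symbol i j n b" and ?c = "symbol i j r c" and ?Y = "X j i (c * r')"
  have e1: "?b * (?Y * g) = ?Y * (?b * g)" for g
    using central_X[OF c(1) ji] by (simp flip: mult.assoc)
  have "h i j n * ?Y = conjugate (h i j n) ?Y * h i j n" by (simp add: conjugate_def group_simps)
  also have "conjugate (h i j n) ?Y = X j i (n' ^ 2 * (c * r'))"
    using assms(1,4) m by (subst conjugate_h_ji[of i j m]) (auto simp: n')
  finally have e2: "h i j n * (?Y * g) = X j i (n' ^ 2 * (c * r')) * (h i j n * g)" for g
    by (simp flip: mult.assoc)
  have e3: "?b * (h i j r * g) = h i j r * (?b * g)" for g
    using central_h[OF c(1) ij] by (simp flip: mult.assoc)
  have e4: "X j i (b * n') * (X j i (n' ^ 2 * (c * r')) * g) = X j i ((b + c) * s') * g" for g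
    by (simp add: X_cong[OF ji 1, symmetric] X_add[OF ji] mult.assoc)
  have "X i j a * X j i (b + c) = X i j a * X j i b * X j i c"
    by (simp add: X_add[OF ji] mult.assoc)
  also have "\<dots> = X j i (b * n') * (h i j n * (?b * (X i j (a * n') * X j i c)))"
    by (simp add: X_mult_X_symbol[OF assms(1,2,4,6)] n' mult.assoc)
  also have "X i j (a * n') * X j i c = ?Y * (h i j r * (?c * X i j (a * n' * r')))"
    using X_mult_X_symbol[OF assms(1,3) rq r_def] by (simp add: r' mult.assoc)
  also have "X j i (b * n') * (h i j n * (?b * (?Y * (h i j r * (?c * X i j (a * n' * r')))))) =
    X j i ((b + c) * s') * (h i j n * (h i j r * (?b * (?c * X i j (a * n' * r')))))"
    by (simp only: e1 e2 e3 e4)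
  also have "h i j r = h i j t" by (rule h_cong[OF ij rq rt])
  also have "?c = symbol i j t c" by (rule symbol_cong[OF ij rq assms(3) rt cong_refl])
  also have "X i j (a * n' * r') = X i j (a * s')" by (rule X_cong[OF ij 2])
  also have "h i j n * (h i j t * (?b * (symbol i j t c * X i j (a * s')))) =
      h i j (n * t) * (symbol i j n t * ?b * symbol i j t c) * X i j (a * s')"
    by (simp flip: mult.assoc add: h_mult_h)
  also have "h i j (n * t) = h i j s" using assms(4) t by (intro h_cong[OF ij _ 3]) auto
  finally show ?thesis by (simp add: s' mult.assoc)
qed

text \<open>
  Both sides come from \<open>X i j a * X j i (b + c)\<close>, adding \<open>b\<close> and \<open>c\<close> in either order.  When 2 is not a
  unit, the relation \<open>{u, 1 - u} = 1\<close> is void and this one replaces it.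
\<close>

lemma symbol_two_step:
  assumes "i \<noteq> j" "coprime b q" "coprime c q" "coprime (1 + a * b) q" "coprime (1 + a * c) q" "coprime s q"
    "s = 1 + a * (b + c)"
  shows "symbol i j (1 + a * b) (s * inv_mod (1 + a * b)) * symbol i j (1 + a * b) b * symbol i j (s * inv_mod (1 + a * b)) c =
    symbol i j (1 + a * c) (s * inv_mod (1 + a * c)) * symbol i j (1 + a * c) c * symbol i j (s * inv_mod (1 + a * c)) b"
  using X_two_step[OF assms(1-4,6) refl assms(7)] X_two_step[OF assms(1,3,2,5,6) refl] assms(7)
  by (simp add: add.commute[of b c] group_mult_left_cancel group_mult_right_cancel)

end

section \<open>Units modulo prime powers\<close>

lemma cong_one_power_prime_power:
  fixes x p :: int
  assumes "[x = 1] (mod p)" and "p \<ge> 0"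
  shows "[x ^ (nat p ^ m) = 1] (mod p ^ Suc m)"
proof (induction m)
  case 0 then show ?case using assms by simp
next
  case (Suc m)
  let ?y = "x ^ (nat p ^ m)"
  have y: "p ^ Suc m dvd ?y - 1" using Suc by (simp add: cong_iff_dvd_diff)
  have "[(\<Sum>i<nat p. ?y ^ i) = (\<Sum>i<nat p. 1 ^ i)] (mod p)"
    using assms(1) cong_pow[OF assms(1), of "nat p ^ m"] by (intro cong_sum cong_pow) simp
  \<comment> \<open>The geometric sum is the cofactor of \<open>?y - 1\<close> in
    \<open>?y ^ nat p - 1\<close>; all its \<open>nat p\<close> terms are 1 modulo
    \<open>p\<close>.\<close>
  then have "p dvd (\<Sum>i<nat p. ?y ^ i)" using assms(2) by (simp add: cong_dvd_iff)
  then have "p ^ Suc m * p dvd (?y - 1) * (\<Sum>i<nat p. ?y ^ i)" using y by (rule mult_dvd_mono[rotated])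
  moreover have "(?y - 1) * (\<Sum>i<nat p. ?y ^ i) = ?y ^ nat p - 1" by (simp only: power_diff_1_eq)
  moreover have "?y ^ nat p = x ^ (nat p ^ Suc m)" by (simp add: mult.commute flip: power_mult)
  ultimately show ?case by (simp add: cong_iff_dvd_diff mult.commute)
qed

lemma five_power_two_power: "[5 ^ 2 ^ m = 1 + 2 ^ (m + 2)] (mod (2 ^ (m + 3) :: int))"
proof (induction m)
  case 0 then show ?case by (simp add: cong_def)
next
  case (Suc m)
  then obtain c where c: "(5::int) ^ 2 ^ m = 1 + 2 ^ (m + 2) + 2 ^ (m + 3) * c"
    using cong_iff_lin[of "1 + 2 ^ (m + 2)" "5 ^ 2 ^ m :: int"] cong_sym by blast
  have "(5::int) ^ 2 ^ Suc m = (5 ^ 2 ^ m)\<^sup>2" by (simp add: power_mult mult.commute flip: power_mult)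
  also have "\<dots> = 1 + 2 ^ (Suc m + 2) + 2 ^ (Suc m + 3) * (c + 2 ^ m * (1 + 2 * c) ^ 2)"
    unfolding c by (simp add: power2_eq_square power_add algebra_simps)
  finally show ?case by (simp add: cong_iff_dvd_diff)
qed

text \<open>Lifting from 2^k to 2^(k+1): when the next binary digit is wrong, the factor
  5^(2^(k-2)), which is 1 + 2^k modulo 2^(k+1), corrects it.\<close>

lemma power_five_generates:
  fixes u :: int
  assumes "[u = 1] (mod 4)"
  shows "\<exists>m. [u = 5 ^ m] (mod 2 ^ k)"
proof (induction k)
  case (Suc k)
  then obtain m where m: "[u = 5 ^ m] (mod 2 ^ k)" by blast
  show ?case
  proof (cases "k \<le> 1")
    case True
    then have "(2::int) ^ Suc k dvd 2 ^ 2" by (intro le_imp_power_dvd) simp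
    then show ?thesis using assms by (intro exI[of _ 0]) (auto intro: cong_dvd_modulus)
  next
    case False
    then obtain l where l: "k = l + 2" by (metis add.commute le_Suc_ex not_less_eq_eq numeral_2_eq_2 One_nat_def)
    obtain c where c: "u = 5 ^ m + 2 ^ k * c" using cong_sym[OF m] unfolding cong_iff_lin by blast
    show ?thesis
    proof (cases "even c")
      case True
      then show ?thesis using c by (intro exI[of _ m]) (auto simp: cong_iff_dvd_diff)
    next
      case False
      then obtain d where d: "c = 2 * d + 1" by (metis oddE)
      obtain e where e: "(5::int) ^ 2 ^ l = 1 + 2 ^ k + 2 ^ Suc k * e"
        using cong_sym[OF five_power_two_power[of l]] unfolding cong_iff_lin l by (auto simp: eval_nat_numeral)
      have odd: "odd ((5::int) ^ m)" by simp
      then obtain f where f: "(5::int) ^ m = 2 * f + 1" by (metis oddE)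
      have "u - 5 ^ (m + 2 ^ l) = 2 ^ Suc k * (d - f - 5 ^ m * e)"
        unfolding power_add e c d by (simp add: algebra_simps f)
      then show ?thesis by (intro exI[of _ "m + 2 ^ l"]) (simp add: cong_iff_dvd_diff)
    qed
  qed
qed auto

section \<open>Vanishing of the symbols over prime powers\<close>

context steinberg
begin

lemma symbol_power_left:
  assumes "i \<noteq> j" "coprime u q" "coprime v q" shows "symbol i j (u ^ n) v = symbol i j u v ^ n"
  using assms by (induction n) (simp_all add: symbol_mult_left)

lemma symbol_power_right:
  assumes "i \<noteq> j" "coprime u q" "coprime v q" shows "symbol i j u (v ^ n) = symbol i j u v ^ n"
  using assms by (induction n) (simp_all add: symbol_mult_right)

lemma power_square_one: "s * s = 1 \<Longrightarrow> s ^ n = (if even n then 1 else s)" for s :: 'g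
  by (induction n) auto

text \<open>
  The units form a cyclic group with generator \<open>g\<close>, and \<open>s = {g, g}\<close> satisfies \<open>s\<^sup>2 = 1\<close>.  If \<open>-1\<close> is an even
  power of \<open>g\<close>, then \<open>s = {g, -1} = 1\<close>.  Otherwise let \<open>n\<close> be the least positive integer that is an odd
  power of \<open>g\<close>; then \<open>1 - n = - (n - 1)\<close> is an odd power as well, and \<open>s = {1 - n, n} = 1\<close>.
\<close>

lemma symbol_odd_prime_power:
  fixes p :: nat
  assumes "i \<noteq> j" "coprime u q" "coprime v q" "q = int p ^ k" "prime p" "odd p"
  shows "symbol i j u v = 1"
proof (cases "k = 0")
  case True
  then have "[u = 1] (mod q)" using assms(4) by simp
  then show ?thesis using symbol_cong[OF assms(1-3) _ cong_refl] symbol_1(1)[OF assms(1)] by metis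
next
  case False
  have p: "p > 2" using prime_ge_2_nat[OF assms(5)] assms(6) by (cases "p = 2") auto
  obtain g' where g': "residue_primroot (p ^ k) g'"
    using residue_primroot_odd_prime_power_exists[OF assms(5,6)] False by blast
  define g where "g = int g'"
  have pk: "p ^ k > 1" by (rule one_less_power) (use p False in auto)
  have q1: "q > 1" using pk assms(4) by (metis of_nat_1 of_nat_less_iff of_nat_power)
  have g: "coprime g q"
    using g' unfolding g_def assms(4) residue_primroot_def by (simp add: coprime_commute flip: of_nat_power)
  have gen: "\<exists>e. [x = g ^ e] (mod q)" if x: "coprime x q" for x
  proof -
    have "coprime (x mod q) q" using x q_pos by (simp add: coprime_commute)
    then have "coprime (nat (x mod q)) (p ^ k)"
      using q_pos coprime_int_iff[of "nat (x mod q)" "p ^ k"] by (simp add: assms(4))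
    moreover have "nat (x mod q) < p ^ k" using q_pos assms(4)
      by (simp add: nat_less_iff)
    moreover have "nat (x mod q) > 0" using calculation(1) pk by (intro Nat.gr0I) auto
    ultimately have "nat (x mod q) \<in> totatives (p ^ k)" by (auto simp: totatives_def)
    then obtain e where "nat (x mod q) = g' ^ e mod p ^ k"
      using residue_primroot_is_generator[OF pk g'] by (auto simp: bij_betw_def image_iff)
    then have "x mod q = g ^ e mod q" using q_pos
      by (metis assms(4) g_def int_nat_eq of_nat_mod of_nat_power pos_mod_sign)
    then show ?thesis by (auto simp: cong_def)
  qed
  define s where "s = symbol i j g g"
  have ss: "s * s = 1" using symbol_anti[OF assms(1) g g] by (metis s_def group_right_inverse)
  have gp: "symbol i j x y = s ^ (e * f)" if "[x = g ^ e] (mod q)" "[y = g ^ f] (mod q)" "coprime x q" "coprime y q" for x y e f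
    using symbol_cong[OF assms(1) that(3,4,1,2)] assms(1) g
    by (simp add: symbol_power_left symbol_power_right s_def power_mult[symmetric] mult.commute)
  have "s = 1"
  proof (rule ccontr)
    assume s1: "s \<noteq> 1"
    have odd_neq: "\<not> [1 = g ^ f] (mod q)" if "odd f" for f
    proof
      assume "[1 = g ^ f] (mod q)"
      then have "symbol i j 1 g = s ^ (f * 1)" using g by (intro gp) auto
      then show False using s1 assms(1) that ss by (simp add: power_square_one)
    qed
    obtain e where e: "[- 1 = g ^ e] (mod q)" using gen[of "-1"] by auto
    have "odd e"
    proof
      assume "even e"
      have "symbol i j g (- 1) = s ^ (1 * e)" using g e by (intro gp) auto
      then have "symbol i j g (- 1) = 1" using \<open>even e\<close> ss by (simp add: power_square_one)
      then have "s = 1" using symbol_uminus[OF assms(1) g] symbol_mult_right[OF assms(1) g g, of "-1"] by (simp add: s_def)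
      then show False using s1 by simp
    qed
    define P where "P n \<longleftrightarrow> n > 0 \<and> coprime (int n) q \<and> (\<exists>f. odd f \<and> [int n = g ^ f] (mod q))" for n :: nat
    have "g' > 0" using g q1 by (intro Nat.gr0I) (auto simp: g_def)
    then have "P g'" using g unfolding P_def g_def by (auto intro!: exI[of _ 1])
    define n where "n = (LEAST n. P n)"
    have Pn: "P n" unfolding n_def by (rule LeastI) fact
    have least: "\<not> P m" if "m < n" for m using that not_less_Least n_def by blast
    from Pn obtain f where f: "odd f" "[int n = g ^ f] (mod q)" and n: "n > 0" "coprime (int n) q" by (auto simp: P_def)
    have "n \<noteq> 1" using odd_neq f by auto
    have "\<not> int p dvd int n - 1"
    proof
      assume "int p dvd int n - 1"
      \<comment> \<open>The exponent is odd, so 1 would become an odd power of \<open>g\<close>,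
        against \<open>odd_neq\<close>.\<close>
      then have "[int n ^ (nat (int p) ^ (k - 1)) = 1] (mod int p ^ Suc (k - 1))"
        by (intro cong_one_power_prime_power) (auto simp: cong_iff_dvd_diff)
      then have "[int n ^ (p ^ (k - 1)) = 1] (mod q)" using False assms(4) by simp
      moreover have "[int n ^ (p ^ (k - 1)) = g ^ (f * p ^ (k - 1))] (mod q)"
        using cong_pow[OF f(2)] by (simp add: power_mult)
      ultimately have "[1 = g ^ (f * p ^ (k - 1))] (mod q)" using cong_sym cong_trans by blast
      then show False using odd_neq[of "f * p ^ (k - 1)"] f(1) assms(6) by simp
    qed
    then have cn: "coprime (int n - 1) q"
      unfolding assms(4) using assms(5) by (metis coprime_commute coprime_power_left_iff prime_imp_coprime prime_nat_int_transfer)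
    then obtain f' where f': "[int n - 1 = g ^ f'] (mod q)" using gen by blast
    \<comment> \<open>Otherwise \<open>n - 1\<close> would be a smaller positive integer that is an
      odd power of \<open>g\<close>.\<close>
    have "even f'"
      using least[of "n - 1"] n(1) \<open>n \<noteq> 1\<close> cn f' unfolding P_def by (auto simp: of_nat_diff)
    have "[1 - int n = g ^ (e + f')] (mod q)"
      using cong_mult[OF e f'] by (simp add: power_add)
    moreover have "coprime (1 - int n) q" using cn by (metis coprime_minus_left_iff minus_diff_eq)
    ultimately have "symbol i j (1 - int n) (int n) = s ^ ((e + f') * f)" using f n by (intro gp) auto
    also have "\<dots> = s" using ss \<open>odd e\<close> \<open>even f'\<close> \<open>odd f\<close> by (simp add: power_square_one)
    finally show False using symbol_steinberg[OF assms(1), of "- int n" 1] n cn s1 \<open>coprime (1 - int n) q\<close> by simp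
  qed
  moreover obtain e f where "[u = g ^ e] (mod q)" "[v = g ^ f] (mod q)" using gen assms by blast
  ultimately show ?thesis using gp[of u e v f] assms by simp
qed

text \<open>Since \<open>h i j 1\<close> is trivial, the symbol is the square of
  \<open>h i j (-1)\<close>, which in turn is the square of \<open>w i j (-1)\<close>.\<close>

lemma symbol_minus_one: assumes "i \<noteq> j" shows "symbol i j (-1) (-1) = inverse (w i j 1 ^ 4)"
proof -
  define x where "x = w i j 1"
  have "w i j (- 1) = inverse x" unfolding x_def by (rule w_uminus[OF assms]) simp
  then have "symbol i j (- 1) (- 1) = inverse (x * (x * (x * x)))"
    by (simp add: symbol_def h_def assms group_simps flip: x_def)
  also have "x * (x * (x * x)) = x ^ 4" by (simp add: eval_nat_numeral)
  finally show ?thesis by (simp add: x_def)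
qed

text \<open>
  The units are generated by \<open>-1\<close> and \<open>5\<close>, and everything reduces to \<open>d = {-1, 5}\<close>, where \<open>d\<^sup>2 = 1\<close>.
  The two-step relation with \<open>a = 2, b = 1, c = 3\<close> gives \<open>{7, -27} = 1\<close>, and \<open>{7, -27} = d\<close> because
  \<open>-7\<close> is an even and \<open>-27\<close> an odd power of \<open>5\<close>.
\<close>

lemma symbol_two_power:
  assumes "i \<noteq> j" "coprime u q" "coprime v q" "q = 2 ^ k" "w i j 1 ^ 4 = 1"
  shows "symbol i j u v = 1"
proof -
  note ij = assms(1)
  have cop: "coprime x q" if "odd x" for x using that by (simp add: assms(4))
  have odd4: "[x = 1] (mod 4) \<or> [- x = 1] (mod 4)" if "odd x" for x :: int
  proof -
    from that obtain y where y: "x = 2 * y + 1" by (rule oddE)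
    show ?thesis
    proof (cases "even y")
      case True
      then obtain z where "y = 2 * z" by (rule evenE)
      then have "x - 1 = 4 * z" using y by simp
      then show ?thesis by (simp add: cong_iff_dvd_diff)
    next
      case False
      then obtain z where "y = 2 * z + 1" by (rule oddE)
      then have "- x - 1 = 4 * (- z - 1)" using y by simp
      then have "4 dvd - x - 1" by (metis dvd_triv_left)
      then show ?thesis by (simp add: cong_iff_dvd_diff)
    qed
  qed
  define d where "d = symbol i j (-1) 5"
  have m1: "symbol i j (-1) (-1) = 1"
    using symbol_minus_one[OF ij] assms(5) by simp
  have dd: "d * d = 1"
    using symbol_mult_left[OF ij, of "-1" "-1" 5] ij by (simp add: d_def cop)
  have d1: "symbol i j 5 (-1) = d"
    using symbol_anti[OF ij cop cop, of "-1" 5] group_inverse_unique[OF dd] by (simp add: d_def)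
  have d2: "symbol i j 5 5 = d"
    using symbol_uminus[OF ij, of 5] symbol_mult_right[OF ij, of 5 "-1" 5] d1 dd by (simp add: cop) (metis group_inverse_unique)
  have dpow: "symbol i j (5 ^ m) (5 ^ l) = d ^ (m * l)" for m l
    using ij d2 by (simp add: symbol_power_left symbol_power_right cop power_mult[symmetric] mult.commute)
  have dpow': "symbol i j (- 1) (5 ^ l) = d ^ l" for l
    using ij by (simp add: symbol_power_right cop d_def)
  have dpow'': "symbol i j (5 ^ l) (- 1) = d ^ l" for l
    using ij d1 by (simp add: symbol_power_left cop)
  have "d = 1"
  proof (cases "k \<ge> 3")
    case False
    then have "(2::int) ^ k dvd 2 ^ 2" by (intro le_imp_power_dvd) simp
    then have "[5 = 1] (mod q)" by (simp add: assms(4) cong_iff_dvd_diff)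
    then show ?thesis using symbol_cong[OF ij, of "-1" 5 "-1" 1] ij by (simp add: d_def cop)
  next
    case True
    then have q8: "8 dvd q" using le_imp_power_dvd[of 3 k "2::int"] by (simp add: assms(4))
    let ?a = "inv_mod 7" and ?b = "inv_mod 3"
    have ca: "coprime ?a q" "coprime ?b q" by (rule coprime_inv_mod, rule cop, simp)+
    have e: "1 + 2 * 1 = (3::int)" "1 + 2 * 3 = (7::int)" "9 = 1 + 2 * (1 + 3 :: int)" by simp_all
    have o: "odd (1::int)" "odd (3::int)" "odd (7::int)" "odd (9::int)" by simp_all
    have cb: "coprime (9 * ?b) q" using ca by (simp add: cop)
    have b: "[9 * ?b = 3] (mod q)" using cong_scalar_left[OF inv_mod[of 3], of 3] by (simp add: cop)
    have "symbol i j 3 (9 * ?b) * symbol i j 3 1 * symbol i j (9 * ?b) 3 = symbol i j 7 (9 * ?a) * symbol i j 7 3 * symbol i j (9 * ?a) 1"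
      using symbol_two_step[OF ij cop[OF o(1)] cop[OF o(2)] _ _ cop[OF o(4)] e(3)] unfolding e(1,2)
      by (simp only: cop o HOL.simp_thms)
    moreover have "symbol i j 3 (9 * ?b) = symbol i j 3 3" by (rule symbol_cong[OF ij cop cb cong_refl b]) simp
    moreover have "symbol i j (9 * ?b) 3 = symbol i j 3 3" by (rule symbol_cong[OF ij cb cop b cong_refl]) simp
    moreover have "symbol i j 3 3 * symbol i j 3 3 = 1"
      using symbol_anti[OF ij, of 3 3] by (metis cop group_right_inverse odd_numeral)
    ultimately have "symbol i j 7 (9 * ?a) * symbol i j 7 3 = 1" using ij by simp
    then have "symbol i j 7 (9 * ?a * 3) = 1"
      using symbol_mult_right[OF ij, of 7 "9 * ?a" 3] ca by (simp add: cop)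
    \<comment> \<open>The factor {7, -7} = 1 removes the inverse of 7 from the second entry and
      leaves -27.\<close>
    moreover have "symbol i j 7 (7 * (- 1)) = 1"
      using symbol_uminus[OF ij, of 7] by (simp add: cop)
    ultimately have "symbol i j 7 (9 * ?a * 3 * (7 * (- 1))) = 1"
      using ca symbol_mult_right[OF ij, of 7 "9 * ?a * 3" "7 * (- 1)"] by (simp add: cop)
    moreover have "[9 * ?a * 3 * (7 * (- 1)) = - 27] (mod q)"
      using cong_scalar_left[OF inv_mod[of 7], of "- 27"] by (simp add: cop)
    ultimately have 1: "symbol i j 7 (- 27) = 1"
      using symbol_cong[OF ij, of 7 "9 * ?a * 3 * (7 * (- 1))" 7 "- 27"] ca by (simp add: cop)
    obtain l where l: "[- 27 = 5 ^ l] (mod q)" using power_five_generates[of "- 27" k] by (auto simp: assms(4) cong_def)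
    obtain m where m: "[- 7 = 5 ^ m] (mod q)" using power_five_generates[of "- 7" k] by (auto simp: assms(4) cong_def)
    have "[7 = - 1 * 5 ^ m] (mod q)" using m by (metis cong_minus_minus_iff minus_minus mult_minus1)
    then have "symbol i j 7 (- 27) = symbol i j (- 1 * 5 ^ m) (5 ^ l)" using l by (intro symbol_cong ij cop) auto
    also have "\<dots> = d ^ l * d ^ (m * l)" using symbol_mult_left[OF ij, of "-1" "5 ^ m" "5 ^ l"] by (simp add: cop dpow dpow')
    finally have *: "d ^ (l + m * l) = 1" using 1 by (simp add: power_add)
    \<comment> \<open>Modulo 8 the parity of an exponent of 5 can be read off: -27 is 5 and -7 is 1
      there.\<close>
    have par: "[(5::int) ^ n = (if even n then 1 else 5)] (mod 8)" for n
    proof -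
      have e: "[(5::int) ^ (2 * m) = 1] (mod 8)" for m
        using cong_pow[of "25::int" 1 8 m] by (simp add: power_mult cong_def)
      show ?thesis
      proof (cases "even n")
        case True
        then show ?thesis using e by (metis evenE)
      next
        case False
        then obtain m where "n = 2 * m + 1" by (rule oddE)
        then show ?thesis using cong_scalar_left[OF e[of m], of 5] by simp
      qed
    qed
    have "odd l" using cong_trans[OF cong_dvd_modulus[OF l q8] par] by (auto simp: cong_def split: if_splits)
    moreover have "even m" using cong_trans[OF cong_dvd_modulus[OF m q8] par] by (auto simp: cong_def split: if_splits)
    ultimately show ?thesis using * dd by (simp add: power_square_one)
  qed
  show ?thesis
  proof (cases "k = 0")
    case True
    then have "[u = 1] (mod q)" using assms(4) by simp
    then show ?thesis using symbol_cong[OF assms(1-3) _ cong_refl] symbol_1(1)[OF assms(1)] by metis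
  next
    case False
    then have odd: "odd u" "odd v" using assms by auto
    have *: "\<exists>l. [x = 5 ^ l] (mod q) \<or> [x = - 1 * 5 ^ l] (mod q)" if "odd x" for x
      using odd4[OF that]
    proof
      assume "[x = 1] (mod 4)" then show ?thesis using power_five_generates assms(4) by blast
    next
      assume "[- x = 1] (mod 4)" then obtain l where "[- x = 5 ^ l] (mod q)" using power_five_generates assms(4) by blast
      then have "[x = - 1 * 5 ^ l] (mod q)" by (metis cong_minus_minus_iff minus_minus mult_minus1)
      then show ?thesis by blast
    qed
    have pp: "symbol i j (5 ^ m) (5 ^ l) = 1" "symbol i j (- 1) (5 ^ l) = 1" "symbol i j (5 ^ l) (- 1) = 1" for l m
      unfolding dpow dpow' dpow'' \<open>d = 1\<close> by simp_all
    have p2: "symbol i j (- 1 * 5 ^ m) (5 ^ l) = 1" "symbol i j (- 1 * 5 ^ m) (- 1) = 1" for l m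
      using symbol_mult_left[OF ij, of "-1" "5 ^ m" "5 ^ l"] symbol_mult_left[OF ij, of "-1" "5 ^ m" "-1"] pp m1 by (simp_all add: cop)
    have p3: "symbol i j (- 1 * 5 ^ m) (- 1 * 5 ^ l) = 1" "symbol i j (5 ^ m) (- 1 * 5 ^ l) = 1"  for l m
      using symbol_mult_right[OF ij, of "- 1 * 5 ^ m" "-1" "5 ^ l"] symbol_mult_right[OF ij, of "5 ^ m" "-1" "5 ^ l"] pp p2 by (simp_all add: cop)
    obtain m l where "[u = 5 ^ m] (mod q) \<or> [u = - 1 * 5 ^ m] (mod q)" "[v = 5 ^ l] (mod q) \<or> [v = - 1 * 5 ^ l] (mod q)"
      using *[OF odd(1)] *[OF odd(2)] by blast
    then show ?thesis using symbol_cong[OF ij assms(2,3), of "5 ^ m" "5 ^ l"] symbol_cong[OF ij assms(2,3), of "- 1 * 5 ^ m" "5 ^ l"]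
       symbol_cong[OF ij assms(2,3), of "5 ^ m" "- 1 * 5 ^ l"] symbol_cong[OF ij assms(2,3), of "- 1 * 5 ^ m" "- 1 * 5 ^ l"]
       pp(1)[of m l] p2(1)[of m l] p3[of m l] by argo
  qed
qed

end

section \<open>Normal forms over a local ring\<close>

text \<open>By \<open>nonunit_add\<close>, 1 plus a nonunit is a unit. Together with the trivial
  symbols this lets words in \<open>X i j\<close> and \<open>X j i\<close> be reduced as in SL_2
  over a local ring.\<close>

locale steinberg_local = steinberg X q
  for X :: "'i \<Rightarrow> 'i \<Rightarrow> int \<Rightarrow> 'g::group_mult" and q :: int +
  fixes i j :: 'i
  assumes ij: "i \<noteq> j"
    and symbol_trivial: "\<And>u v. coprime u q \<Longrightarrow> coprime v q \<Longrightarrow> symbol i j u v = 1"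
    and nonunit_add: "\<And>x y. \<not> coprime x q \<Longrightarrow> \<not> coprime y q \<Longrightarrow> \<not> coprime (x + y) q"
begin

lemma coprime_one_add: assumes "\<not> coprime x q" shows "coprime (1 + x) q"
  using nonunit_add[of "1 + x" "- x"] assms by auto

lemma h_hom: "coprime u q \<Longrightarrow> coprime v q \<Longrightarrow> h i j (u * v) = h i j u * h i j v"
  by (simp add: h_mult_h symbol_trivial)

lemma h_inverse: assumes "coprime u q" shows "inverse (h i j u) = h i j (inv_mod u)"
proof (rule group_inverse_unique)
  have "h i j (u * inv_mod u) = h i j 1"
    using assms coprime_inv_mod by (intro h_cong[OF ij] inv_mod) auto
  then show "h i j u * h i j (inv_mod u) = 1"
    using assms coprime_inv_mod ij by (simp add: h_hom)
qed

lemma X_mult_X: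
  assumes "coprime n q" "n = 1 + a * b"
  shows "X i j a * X j i b = X j i (b * inv_mod n) * h i j n * X i j (a * inv_mod n)"
proof -
  consider "coprime b q" | "coprime a q" | "\<not> coprime a q" "\<not> coprime b q" by blast
  then show ?thesis
  proof cases
    case 1
    then show ?thesis using X_mult_X_symbol[OF ij 1 assms] symbol_trivial[OF assms(1) 1] by simp
  next
    case 2
    obtain n' k where n': "inv_mod n = n'" "n * n' = 1 + q * k" "coprime n' q" using inv_modE[OF assms(1)] by metis
    have "[n * (a * n') = a] (mod q)" by (rule cong_dvdI) (use n'(2) in Groebner_Basis.algebra)
    moreover have c: "coprime (a * n') q" using 2 n' by simp
    ultimately have "h i j (n * (a * n')) = h i j a"
      using assms(1) by (intro h_cong[OF ij]) simp
    then have "h i j n * h i j (a * n') = h i j a" using h_hom[OF assms(1) c] by simp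
    then have "h i j a * inverse (h i j (a * n')) = h i j n" by (metis group_right_inverse mult.assoc mult_1_right)
    then have "w i j a * w i j (- (a * n')) = h i j n" using w_mult_w[OF ij c, of a] by simp
    then show ?thesis using X_mult_X_left_unit[OF ij 2 assms] n' by simp
  next
    case 3
    \<comment> \<open>If neither \<open>a\<close> nor \<open>b\<close> is a unit, then
      \<open>b = 1 + (b - 1)\<close> is a sum of two units and the two-step decomposition
      applies.\<close>
    have "coprime (1 + - b) q" using 3 by (intro coprime_one_add) simp
    then have "coprime (b - 1) q" using coprime_minus_left_iff[of "b - 1" q] by simp
    then show ?thesis
      using X_two_step[OF ij _ _ coprime_one_add[OF 3(1)] assms(1), of 1 "b - 1" a] assms(2)
        coprime_inv_mod[OF coprime_one_add[OF 3(1)]] assms(1) coprime_one_add[OF 3(1)]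
      by (simp add: symbol_trivial)
  qed
qed

lemma X_mult_X':
  assumes "coprime n q" "n = 1 + a * b"
  shows "X j i b * X i j a = X i j (a * inv_mod n) * h i j (inv_mod n) * X j i (b * inv_mod n)"
proof -
  have "inverse (X j i b * X i j a) = X i j (- a) * X j i (- b)"
    using ij by (simp add: X_uminus group_simps)
  also have "\<dots> = X j i (- b * inv_mod n) * h i j n * X i j (- a * inv_mod n)"
    using assms by (intro X_mult_X) auto
  also have "\<dots> = inverse (X i j (a * inv_mod n) * inverse (h i j n) * X j i (b * inv_mod n))"
    using ij by (simp add: X_uminus group_simps)
  finally show ?thesis
    using h_inverse[OF assms(1)] by (metis group_inverse_inverse)
qed

text \<open>The factor \<open>X i j r\<close> is there for the matrices whose upper left entry is not a unit.\<close>

definition "normal_forms = {X i j r * X j i s * h i j u * X i j t | r s u t. coprime u q}"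

lemma normal_formsI: "coprime u q \<Longrightarrow> X i j r * X j i s * h i j u * X i j t \<in> normal_forms"
  unfolding normal_forms_def by blast

lemma normal_formsE:
  assumes "y \<in> normal_forms"
  obtains r s u t where "y = X i j r * X j i s * h i j u * X i j t" "coprime u q"
  using assms unfolding normal_forms_def by blast

lemma X_mult_normal_forms: assumes "y \<in> normal_forms" shows "X i j r * y \<in> normal_forms"
proof -
  obtain r' s u t where y: "y = X i j r' * X j i s * h i j u * X i j t" "coprime u q" using assms by (rule normal_formsE)
  have "X i j r * y = X i j (r + r') * X j i s * h i j u * X i j t"
    by (simp add: y X_add[OF ij] mult.assoc)
  then show ?thesis using normal_formsI[OF y(2)] by metis
qed

lemma h_X: assumes "coprime u q"
  shows "h i j u * X i j t = X i j (u\<^sup>2 * t) * h i j u" "h i j u * X j i t = X j i ((inv_mod u)\<^sup>2 * t) * h i j u"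
proof -
  obtain k where k: "k \<noteq> i" "k \<noteq> j" using third_index by blast
  have "h i j u * x = conjugate (h i j u) x * h i j u" for x by (simp add: conjugate_def group_simps)
  then show "h i j u * X i j t = X i j (u\<^sup>2 * t) * h i j u" "h i j u * X j i t = X j i ((inv_mod u)\<^sup>2 * t) * h i j u"
    using conjugate_h_ij[of i j k u t] conjugate_h_ji[of i j k u t] k ij assms by auto
qed

lemma normal_forms_mult_h_X: assumes "y \<in> normal_forms" "coprime v q" shows "y * h i j v * X i j r \<in> normal_forms"
proof -
  obtain r' s u t where y: "y = X i j r' * X j i s * h i j u * X i j t" "coprime u q" using assms(1) by (rule normal_formsE)
  obtain v' k where v': "inv_mod v = v'" "v * v' = 1 + q * k" "coprime v' q" using inv_modE[OF assms(2)] by metis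
  have "[v\<^sup>2 * (v'\<^sup>2 * t) = t] (mod q)" by (rule cong_dvdI) (use v'(2) in Groebner_Basis.algebra)
  then have "X i j t * h i j v = h i j v * X i j (v'\<^sup>2 * t)"
    using h_X(1)[OF assms(2), of "v'\<^sup>2 * t"] X_cong[OF ij] by simp
  then have "y * h i j v * X i j r = X i j r' * X j i s * h i j (u * v) * X i j (v'\<^sup>2 * t + r)"
    using y assms(2) by (simp add: h_hom X_add[OF ij] mult.assoc)
  then show ?thesis using normal_formsI[of "u * v" r' s "v'\<^sup>2 * t + r"] y assms(2) by simp
qed

lemma XXX_normal_forms_unit: assumes "coprime (1 + b * a) q" shows "X j i a * X i j b * X j i c \<in> normal_forms"
proof -
  define n where "n = 1 + b * a"
  have n: "coprime n q" "coprime (inv_mod n) q" using assms coprime_inv_mod by (auto simp: n_def)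
  have "X j i a * X i j b * X j i c = X i j (b * inv_mod n) * h i j (inv_mod n) * X j i (a * inv_mod n) * X j i c"
    by (simp add: X_mult_X'[OF n(1) n_def] mult.assoc)
  also have "\<dots> = X i j (b * inv_mod n) * (h i j (inv_mod n) * X j i (a * inv_mod n + c))"
    using ij by (simp add: X_add mult.assoc)
  also have "\<dots> = X i j (b * inv_mod n) * X j i ((inv_mod (inv_mod n))\<^sup>2 * (a * inv_mod n + c)) * h i j (inv_mod n) * X i j 0"
    using ij n by (simp add: h_X mult.assoc)
  finally show ?thesis using normal_formsI[OF n(2)] by metis
qed

text \<open>One Gauss decomposition suffices if 1 + ba or 1 + bc is a unit. Otherwise
  \<open>b\<close> is a unit, and \<open>a\<close> and \<open>c\<close> are both -1/b up to a
  nonunit. Then \<open>w i j b\<close> can be split off, and moving it to the right turns the last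
  factor into an element of \<open>X i j\<close>.\<close>

lemma XXX_normal_forms: "X j i a * X i j b * X j i c \<in> normal_forms"
proof -
  consider "coprime (1 + b * a) q" | "coprime (1 + b * c) q" | "\<not> coprime (1 + b * a) q" "\<not> coprime (1 + b * c) q" by blast
  then show ?thesis
  proof cases
    case 1 then show ?thesis by (rule XXX_normal_forms_unit)
  next
    case 2
    define n where "n = 1 + b * c"
    have n: "coprime n q" using 2 by (simp add: n_def)
    have "X j i a * X i j b * X j i c = X i j 0 * X j i (a + c * inv_mod n) * h i j n * X i j (b * inv_mod n)"
      using ij by (simp add: X_mult_X[OF n n_def] X_add mult.assoc)
    then show ?thesis using normal_formsI[OF n] by metis
  next
    case 3
    have b: "coprime b q"
      using coprime_one_add[of "b * a"] 3(1) by auto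
    obtain b' k where b': "inv_mod b = b'" "b * b' = 1 + q * k" "coprime b' q" using inv_modE[OF b] by metis
    define a1 c1 where "a1 = a + b'" and "c1 = c + b'"
    obtain m where m: "m \<noteq> i" "m \<noteq> j" using third_index by blast
    have w: "w i j b = X i j b * X j i (- b') * X i j b" by (simp add: w_def b')
    have w': "w i j b = X j i (- b') * X i j b * X j i (- b')"
      using X_eq_w[OF ij b, of b'] b' inv_mod[OF b] ij by (simp add: X_uminus group_simps)
    have "X j i a * X i j b * X j i c = X j i a1 * w i j b * X j i c1"
    proof -
      have "X j i a1 * X j i (- b') = X j i a" "X j i (- b') * X j i c1 = X j i c"
        using X_add[of j i a1 "- b'"] X_add[of j i "- b'" c1] ij by (simp_all add: a1_def c1_def)
      then show ?thesis unfolding w' by (metis mult.assoc)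
    qed
    also have "\<dots> = X j i a1 * (conjugate (w i j b) (X j i c1) * w i j b)"
      by (simp add: conjugate_def group_simps)
    also have "conjugate (w i j b) (X j i c1) = X i j (- (b\<^sup>2 * c1))"
      using conjugate_w_ji[of i j m b c1] m ij b by simp
    also have "X j i a1 * (X i j (- (b\<^sup>2 * c1)) * w i j b) =
       X j i a1 * X i j (- (b\<^sup>2 * c1) + b) * X j i (- b') * h i j 1 * X i j b"
      unfolding w X_add[OF ij] by (simp add: ij mult.assoc)
    finally have eq: "X j i a * X i j b * X j i c = \<dots>" .
    have "\<not> coprime (b * a1) q"
    proof -
      have "[b * a1 = 1 + b * a] (mod q)" unfolding a1_def by (rule cong_dvdI) (use b'(2) in Groebner_Basis.algebra)
      then show ?thesis using 3(1) cong_imp_coprime by blast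
    qed
    then have "\<not> coprime a1 q" using b by simp
    \<comment> \<open>\<open>a1\<close> is the nonunit error, so the word that remains falls under
      \<open>XXX_normal_forms_unit\<close>.\<close>
    then have "coprime (1 + (- (b\<^sup>2 * c1) + b) * a1) q"
      by (intro coprime_one_add) simp
    then show ?thesis unfolding eq by (intro normal_forms_mult_h_X XXX_normal_forms_unit) auto
  qed
qed

lemma X_mult_normal_forms': assumes "y \<in> normal_forms" shows "X j i r * y \<in> normal_forms"
proof -
  obtain r' s u t where y: "y = X i j r' * X j i s * h i j u * X i j t" "coprime u q" using assms by (rule normal_formsE)
  have "X j i r * y = (X j i r * X i j r' * X j i s) * h i j u * X i j t"
    by (simp add: y mult.assoc)
  then show ?thesis using normal_forms_mult_h_X[OF XXX_normal_forms y(2)] by metis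
qed

text \<open>Containing 1 and being stable under left multiplication by the generators, this set is
  the whole subgroup generated by the \<open>X i j\<close> and \<open>X j i\<close>. Its finiteness
  permits summing over it.\<close>

lemma finite_normal_forms: "finite normal_forms"
proof (rule finite_subset)
  let ?f = "\<lambda>(r, s, u, t). X i j r * X j i s * h i j u * X i j t"
  show "normal_forms \<subseteq> ?f ` ({0..<q} \<times> {0..<q} \<times> {0..<q} \<times> {0..<q})"
  proof
    fix y assume "y \<in> normal_forms"
    then obtain r s u t where y: "y = X i j r * X j i s * h i j u * X i j t" "coprime u q" by (rule normal_formsE)
    have "X i j (r mod q) = X i j r" "X j i (s mod q) = X j i s" "X i j (t mod q) = X i j t"
      using ij by (auto intro!: X_cong)
    moreover have "h i j u = h i j (u mod q)" using ij y(2) by (intro h_cong) auto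
    ultimately have "y = ?f (r mod q, s mod q, u mod q, t mod q)" by (simp add: y)
    then show "y \<in> ?f ` ({0..<q} \<times> {0..<q} \<times> {0..<q} \<times> {0..<q})"
      by (rule image_eqI) (use q_pos in auto)
  qed
qed auto

lemma one_normal_forms: "1 \<in> normal_forms"
  using normal_formsI[of 1 0 0 0] ij by simp

end

section \<open>Operators of finite order\<close>

text \<open>The exponent is an integer, so that \<open>b\<close> modulo \<open>n\<close> labels the
  character of Z/n that sends t to \<open>unity_root n (b * t)\<close>.\<close>

definition unity_root :: "nat \<Rightarrow> int \<Rightarrow> complex" where
  "unity_root n b = cis (2 * pi * of_int b / of_nat n)"

lemma unity_root_0 [simp]: "unity_root n 0 = 1"
  by (simp add: unity_root_def)

lemma unity_root_add: "unity_root n (a + b) = unity_root n a * unity_root n b"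
  by (simp add: unity_root_def cis_mult ring_distribs add_divide_distrib)

lemma unity_root_power: "unity_root n (b * int t) = unity_root n b ^ t"
  by (induction t) (simp_all add: ring_distribs unity_root_add)

lemma unity_root_eq_1_iff: assumes "n > 0" shows "unity_root n b = 1 \<longleftrightarrow> int n dvd b"
proof
  assume "unity_root n b = 1"
  then have "cos (2 * pi * of_int b / of_nat n) = 1" by (simp add: unity_root_def complex_eq_iff)
  then obtain k :: int where "2 * pi * of_int b / of_nat n = of_int k * 2 * pi" by (auto simp: cos_one_2pi_int)
  then have "2 * pi * real_of_int b = 2 * pi * (real_of_int k * real n)" using assms by (simp add: field_simps)
  then have "real_of_int b = of_int (k * int n)" by simp
  then have "b = k * int n" by (simp only: of_int_eq_iff)
  then show "int n dvd b" by simp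
next
  assume "int n dvd b"
  then obtain k where "b = int n * k" by auto
  then have "2 * pi * real_of_int b / of_nat n = 2 * pi * of_int k" using assms by simp
  then show "unity_root n b = 1" unfolding unity_root_def by (simp only: cis_multiple_2pi Ints_of_int)
qed

lemma unity_root_cong: assumes "n > 0" "[a = b] (mod int n)" shows "unity_root n a = unity_root n b"
proof -
  have "unity_root n (a - b) = 1" using assms by (simp add: unity_root_eq_1_iff cong_iff_dvd_diff)
  then show ?thesis using unity_root_add[of n "a - b" b] by simp
qed

lemma sum_unity_root: assumes "n > 0"
  shows "(\<Sum>t<n. unity_root n (b * int t)) = (if int n dvd b then of_nat n else 0)"
proof (cases "int n dvd b")
  case True
  then have "unity_root n b = 1" using assms by (simp add: unity_root_eq_1_iff)
  then show ?thesis using True by (simp add: unity_root_power)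
next
  case False
  then have "unity_root n b \<noteq> 1" using assms by (simp add: unity_root_eq_1_iff)
  moreover have "unity_root n b ^ n = 1" using assms by (simp flip: unity_root_power add: unity_root_eq_1_iff)
  ultimately show ?thesis using False by (simp add: unity_root_power geometric_sum)
qed

locale complex_vector_space = vector_space scl for scl :: "complex \<Rightarrow> 'v::ab_group_add \<Rightarrow> 'v"
begin

text \<open>The factor 1/n is left out: for linear \<open>g\<close> and positive \<open>n\<close>,
  on vectors fixed by \<open>g ^^ n\<close>, this is \<open>n\<close> times the projection onto the
  eigenspace of \<open>unity_root n b\<close>.\<close>

definition eig_proj :: "('v \<Rightarrow> 'v) \<Rightarrow> nat \<Rightarrow> int \<Rightarrow> 'v \<Rightarrow> 'v" where
  "eig_proj g n b v = (\<Sum>t<n. scl (unity_root n (- b * int t)) ((g ^^ t) v))"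

lemma linear_funpow:
  assumes "Vector_Spaces.linear scl scl g" shows "Vector_Spaces.linear scl scl (g ^^ t)"
proof -
  interpret g: Vector_Spaces.linear scl scl g by fact
  show ?thesis
    by (induction t) (simp_all add: Vector_Spaces.linear_iff g.add g.scale vector_space_axioms)
qed

lemma linear_eig_proj:
  assumes "Vector_Spaces.linear scl scl g" shows "Vector_Spaces.linear scl scl (eig_proj g n b)"
proof -
  have *: "(g ^^ t) (x + y) = (g ^^ t) x + (g ^^ t) y" "(g ^^ t) (scl c x) = scl c ((g ^^ t) x)" for t x y c
    using linear_funpow[OF assms, of t] by (simp_all add: Vector_Spaces.linear_iff)
  show ?thesis
    unfolding Vector_Spaces.linear_iff using vector_space_axioms
    by (auto simp: eig_proj_def * scale_right_distrib sum.distrib scale_sum_right mult.commute)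
qed

lemma funpow_in: "v \<in> U \<Longrightarrow> (\<And>u. u \<in> U \<Longrightarrow> g u \<in> U) \<Longrightarrow> (g ^^ t) v \<in> U"
  by (induction t) auto

lemma eig_proj_in:
  "subspace U \<Longrightarrow> v \<in> U \<Longrightarrow> (\<And>u. u \<in> U \<Longrightarrow> g u \<in> U) \<Longrightarrow> eig_proj g n b v \<in> U"
  unfolding eig_proj_def by (intro subspace_sum subspace_scale funpow_in)

lemma eig_proj_eigen:
  assumes "Vector_Spaces.linear scl scl g" "n > 0" "(g ^^ n) v = v"
  shows "g (eig_proj g n b v) = scl (unity_root n b) (eig_proj g n b v)"
proof -
  interpret g: Vector_Spaces.linear scl scl g by fact
  let ?f = "\<lambda>t. scl (unity_root n (b - b * int t)) ((g ^^ t) v)"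
  have n: "?f n = ?f 0"
    using assms(2,3) unity_root_cong[OF assms(2), of "b - b * int n" b] by (simp add: cong_iff_dvd_diff)
  have "g (eig_proj g n b v) = (\<Sum>t<n. ?f (Suc t))"
    by (simp add: eig_proj_def g.sum g.scale ring_distribs)
  also have "\<dots> = (\<Sum>t<Suc n. ?f t) - ?f 0" by (subst sum.lessThan_Suc_shift) simp
  also have "\<dots> = (\<Sum>t<n. ?f t)" using n by simp
  also have "\<dots> = scl (unity_root n b) (eig_proj g n b v)"
    by (simp add: eig_proj_def scale_sum_right flip: unity_root_add)
  finally show ?thesis .
qed

lemma sum_eig_proj:
  assumes "n > 0" shows "(\<Sum>b<n. eig_proj g n (int b) v) = scl (of_nat n) v"
proof -
  have "(\<Sum>b<n. eig_proj g n (int b) v) = (\<Sum>t<n. scl (\<Sum>b<n. unity_root n (- int t * int b)) ((g ^^ t) v))"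
    unfolding eig_proj_def scale_sum_left by (subst sum.swap) (simp add: mult.commute)
  also have "\<dots> = (\<Sum>t<n. if t = 0 then scl (of_nat n) v else 0)"
  proof (intro sum.cong refl)
    fix t assume "t \<in> {..<n}"
    then have "int n dvd - int t \<longleftrightarrow> t = 0" using assms by (auto dest: zdvd_imp_le)
    then show "scl (\<Sum>b<n. unity_root n (- int t * int b)) ((g ^^ t) v) = (if t = 0 then scl (of_nat n) v else 0)"
      unfolding sum_unity_root[OF assms] by simp
  qed
  also have "\<dots> = scl (of_nat n) v" using assms by simp
  finally show ?thesis .
qed

lemma eig_proj_of_eigen:
  assumes "Vector_Spaces.linear scl scl g" "n > 0" "g v = scl (unity_root n c) v"
  shows "eig_proj g n b v = (if [c = b] (mod int n) then scl (of_nat n) v else 0)"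
proof -
  interpret g: Vector_Spaces.linear scl scl g by fact
  have "(g ^^ t) v = scl (unity_root n (c * int t)) v" for t
    by (induction t) (simp_all add: g.scale assms(3) ring_distribs unity_root_add mult.commute)
  then have "eig_proj g n b v = scl (\<Sum>t<n. unity_root n ((c - b) * int t)) v"
    by (simp add: eig_proj_def scale_sum_left ring_distribs flip: unity_root_add)
  then show ?thesis using assms(2) by (simp add: sum_unity_root cong_iff_dvd_diff)
qed

text \<open>Up to the factor \<open>n\<close>, the vector \<open>v\<close> is the sum of its
  components in the eigenspaces of \<open>g\<close>. If \<open>g ^^ r\<close> fixed all of them, it
  would fix \<open>v\<close>. The last condition on \<open>b\<close> says that \<open>g ^^ r\<close>
  moves \<open>u\<close>.\<close>

lemma eigenvector_moved:
  assumes "Vector_Spaces.linear scl scl g" "n > 0" "subspace U" "\<And>u. u \<in> U \<Longrightarrow> g u \<in> U"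
    and "\<And>u. u \<in> U \<Longrightarrow> (g ^^ n) u = u" "v \<in> U" "(g ^^ r) v \<noteq> v"
  obtains b u where "u \<in> U" "u \<noteq> 0" "g u = scl (unity_root n b) u" "\<not> int n dvd int r * b"
proof -
  interpret gr: Vector_Spaces.linear scl scl "g ^^ r" using assms(1) by (rule linear_funpow)
  interpret g: Vector_Spaces.linear scl scl g by fact
  define P where "P b = eig_proj g n (int b) v" for b
  have P: "P b \<in> U" "g (P b) = scl (unity_root n b) (P b)" for b
    unfolding P_def using assms by (auto intro!: eig_proj_in eig_proj_eigen)
  have Pr: "(g ^^ t) (P b) = scl (unity_root n (int t * int b)) (P b)" for b t
    by (induction t) (simp_all add: P g.scale ring_distribs unity_root_add mult.commute)
  have "\<exists>b. P b \<noteq> 0 \<and> \<not> int n dvd int r * int b"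
  proof (rule ccontr)
    assume "\<not> ?thesis"
    then have "(g ^^ r) (P b) = P b" for b
      using assms(2) Pr[of r b] by (cases "P b = 0") (auto simp: gr.zero simp flip: unity_root_eq_1_iff)
    then have "(g ^^ r) (scl (of_nat n) v) = scl (of_nat n) v"
      unfolding sum_eig_proj[OF assms(2), of g v, symmetric] by (simp add: P_def gr.sum)
    then have "scl (of_nat n) ((g ^^ r) v) = scl (of_nat n) v" by (simp add: gr.scale)
    then show False using assms(2,7) by simp
  qed
  then show ?thesis using P that by blast
qed

lemma eigenvector_exists:
  assumes "Vector_Spaces.linear scl scl g" "n > 0" "subspace U" "\<And>u. u \<in> U \<Longrightarrow> g u \<in> U"
    and "\<And>u. u \<in> U \<Longrightarrow> (g ^^ n) u = u" "v \<in> U" "v \<noteq> 0"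
  obtains b u where "u \<in> U" "u \<noteq> 0" "g u = scl (unity_root n b) u"
proof -
  define P where "P b = eig_proj g n (int b) v" for b
  have P: "P b \<in> U" "g (P b) = scl (unity_root n b) (P b)" for b
    unfolding P_def using assms by (auto intro!: eig_proj_in eig_proj_eigen)
  have "\<exists>b. P b \<noteq> 0"
  proof (rule ccontr)
    assume "\<not> ?thesis"
    then have "scl (of_nat n) v = 0" using sum_eig_proj[OF assms(2), of g v] by (simp add: P_def)
    then show False using assms(2,7) by simp
  qed
  then show ?thesis using P that by blast
qed

end

section \<open>The group of bijections, in which the operators live\<close>

typedef 'a bijection = "{f :: 'a \<Rightarrow> 'a. bij f}" morphisms app Bijection
  by (rule exI[of _ id]) simp

setup_lifting type_definition_bijection

instantiation bijection :: (type) group_mult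
begin
lift_definition times_bijection :: "'a bijection \<Rightarrow> 'a bijection \<Rightarrow> 'a bijection" is "(\<circ>)" by (rule bij_comp)
lift_definition one_bijection :: "'a bijection" is id by simp
lift_definition inverse_bijection :: "'a bijection \<Rightarrow> 'a bijection" is "inv_into UNIV"
  by (rule bij_imp_bij_inv)
definition divide_bijection :: "'a bijection \<Rightarrow> 'a bijection \<Rightarrow> 'a bijection" where
  "divide_bijection f g = f * inverse g"
instance
  by standard (transfer; simp add: o_assoc bij_is_inj)+
end

lemma app_mult [simp]: "app (f * g) v = app f (app g v)" by transfer simp
lemma app_one [simp]: "app 1 v = v" by transfer simp
lemma app_power: "app (f ^ n) v = (app f ^^ n) v" by (induction n) simp_all
lemma app_inj: "app f u = app f v \<longleftrightarrow> u = v" by transfer (auto simp: bij_def inj_def)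

context steinberg begin

text \<open>The factors with known eigenvalues are collected on the right, in the shape that
  \<open>weight_act2\<close> takes.\<close>

lemma X_right_move:
  assumes "a \<noteq> b" "b \<noteq> c" "a \<noteq> c"
  shows "X b c t * X a b s = X a b s * (X a c (- s * t) * X b c t)"
proof -
  have "X b c t * X a b s = X a c (- (s * t)) * X a b s * X b c t"
    using X_comm_move[OF assms] by (simp add: mult.assoc)
  also have "X a c (- (s * t)) * X a b s = X a b s * X a c (- (s * t))"
    using assms by (intro X_commute) auto
  finally show ?thesis by (simp add: mult.assoc)
qed

lemma X_left_move:
  assumes "a \<noteq> b" "b \<noteq> c" "a \<noteq> c"
  shows "X a b t * X b c s = X b c s * (X a c (s * t) * X a b t)"
proof -
  have "X a b t * X b c s = X a c (t * s) * X b c s * X a b t"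
    using X_comm[OF assms] by simp
  also have "X a c (t * s) * X b c s = X b c s * X a c (t * s)"
    using assms by (intro X_commute) auto
  finally show ?thesis by (simp add: mult.assoc mult.commute)
qed

lemma X_h_move:
  assumes "i \<noteq> j" "j \<noteq> k" "i \<noteq> k" "coprime u q"
  shows "X i k t * h i j u = h i j u * X i k (inv_mod u * t)" "X j k t * h i j u = h i j u * X j k (u * t)"
proof -
  obtain u' z where u': "inv_mod u = u'" "u * u' = 1 + q * z" using inv_modE[OF assms(4)] by metis
  have *: "x * h i j u = h i j u * y" if "conjugate (h i j u) y = x" for x y
    unfolding that[symmetric] by (simp add: conjugate_def group_simps)
  have "[u * (u' * t) = t] (mod q)" "[u' * (u * t) = t] (mod q)"
    by (rule cong_dvdI, use u'(2) in Groebner_Basis.algebra)+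
  then show "X i k t * h i j u = h i j u * X i k (inv_mod u * t)" "X j k t * h i j u = h i j u * X j k (u * t)"
    using assms X_cong[of i k "u * (u' * t)" t] X_cong[of j k "u' * (u * t)" t] u'(1)
    by (auto intro!: * simp: conjugate_h_ik[of i j k] conjugate_h_jk[of i j k])
qed

lemma X_power: "a \<noteq> b \<Longrightarrow> X a b s ^ t = X a b (s * int t)"
  by (induction t) (simp_all add: ring_distribs X_add)

end

section \<open>Invariant vectors for prime powers\<close>

text \<open>The relations hold on the whole space, but vectors are sought in \<open>W\<close>, which
  later shrinks to the invariants of one prime after another.\<close>

locale steinberg_action = steinberg X q + complex_vector_space scl
  for X :: "'i \<Rightarrow> 'i \<Rightarrow> int \<Rightarrow> 'v::ab_group_add bijection" and q :: int and scl :: "complex \<Rightarrow> 'v \<Rightarrow> 'v" +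
  fixes W :: "'v set"
  assumes subspace_W: "subspace W"
    and linear_X: "a \<noteq> b \<Longrightarrow> Vector_Spaces.linear scl scl (app (X a b t))"
    and W_inv: "a \<noteq> b \<Longrightarrow> v \<in> W \<Longrightarrow> app (X a b t) v \<in> W"

text \<open>Two moduli occur: the group relations hold modulo \<open>q\<close>, whereas on
  \<open>W\<close> the operators have a period \<open>n\<close> dividing \<open>q\<close>, and
  weights are taken modulo \<open>n\<close>.\<close>

locale steinberg_action_period = steinberg_action X q scl W
  for X :: "'i \<Rightarrow> 'i \<Rightarrow> int \<Rightarrow> 'v::ab_group_add bijection" and q :: int and scl :: "complex \<Rightarrow> 'v \<Rightarrow> 'v" and W +
  fixes n :: nat
  assumes n_pos: "n > 0" and n_dvd: "int n dvd q"
    and period_W: "a \<noteq> b \<Longrightarrow> v \<in> W \<Longrightarrow> app (X a b (int n)) v = v"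
begin

lemma linear_comp_X:
  assumes "Vector_Spaces.linear scl scl (app g)" "Vector_Spaces.linear scl scl (app g')"
  shows "Vector_Spaces.linear scl scl (app (g * g'))"
  using assms by (simp add: Vector_Spaces.linear_iff)

lemma app_nonzero:
  assumes "Vector_Spaces.linear scl scl (app g)" "v \<noteq> 0"
  shows "app g v \<noteq> 0"
proof -
  interpret g: Vector_Spaces.linear scl scl "app g" by fact
  show ?thesis using assms(2) by (metis app_inj g.zero)
qed

lemma linear_w: "a \<noteq> b \<Longrightarrow> Vector_Spaces.linear scl scl (app (w a b u))"
  unfolding w_def by (intro linear_comp_X linear_X) auto

lemma linear_h: "a \<noteq> b \<Longrightarrow> Vector_Spaces.linear scl scl (app (h a b u))"
  unfolding h_def by (intro linear_comp_X linear_w)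

lemma W_inv_w: "a \<noteq> b \<Longrightarrow> v \<in> W \<Longrightarrow> app (w a b u) v \<in> W"
  unfolding w_def by (simp add: W_inv)

lemma W_inv_h: "a \<noteq> b \<Longrightarrow> v \<in> W \<Longrightarrow> app (h a b u) v \<in> W"
  unfolding h_def by (simp add: W_inv_w)

lemma X_W_dvd: assumes "a \<noteq> b" "v \<in> W" "int n dvd s" shows "app (X a b s) v = v"
proof -
  have nat: "app (X a b (int n * int t)) v = v" for t
    by (induction t) (use assms in \<open>simp_all add: ring_distribs X_add period_W\<close>)
  have "app (X a b (- t)) v = v" if "app (X a b t) v = v" for t
    using that assms(1) X_add[of a b "- t" t] by (metis X_0 add.left_inverse app_mult app_one)
  then have "app (X a b (int n * t)) v = v" for t
    using nat by (cases t rule: int_cases2) auto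
  then show ?thesis using assms(3) by auto
qed

lemma X_W_cong: assumes "a \<noteq> b" "v \<in> W" "[s = t] (mod int n)" shows "app (X a b s) v = app (X a b t) v"
proof -
  have "app (X a b (t + (s - t))) v = app (X a b t) v"
    using X_W_dvd[OF assms(1,2), of "s - t"] assms(3) unfolding X_add[OF assms(1)]
    by (simp add: cong_iff_dvd_diff)
  then show ?thesis by simp
qed

section \<open>Weights and how root elements change them\<close>

definition weight :: "'i \<Rightarrow> 'i \<Rightarrow> int \<Rightarrow> 'v \<Rightarrow> bool" where
  "weight a b c v \<longleftrightarrow> (\<forall>t. app (X a b t) v = scl (unity_root n (c * t)) v)"

lemma weightD: "weight a b c v \<Longrightarrow> app (X a b t) v = scl (unity_root n (c * t)) v"
  by (simp add: weight_def)

lemma weightI: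
  assumes "v \<in> W" "a \<noteq> b" "app (X a b 1) v = scl (unity_root n c) v" shows "weight a b c v"
  unfolding weight_def
proof
  fix t
  interpret l: Vector_Spaces.linear scl scl "app (X a b 1)" by (rule linear_X) fact
  have nat: "app (X a b (int t)) v = scl (unity_root n (c * int t)) v" for t
    by (induction t) (simp_all add: assms X_add l.scale ring_distribs unity_root_add mult.commute)
  have "app (X a b t) v = app (X a b (int (nat (t mod int n)))) v"
    using n_pos assms by (intro X_W_cong) auto
  also have "\<dots> = scl (unity_root n (c * (t mod int n))) v"
    using n_pos by (subst nat) simp
  also have "unity_root n (c * (t mod int n)) = unity_root n (c * t)"
    using n_pos by (intro unity_root_cong cong_mult) auto
  finally show "app (X a b t) v = scl (unity_root n (c * t)) v" .
qed

lemma weight_cong: "weight a b c v \<Longrightarrow> [c = c'] (mod int n) \<Longrightarrow> weight a b c' v"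
  unfolding weight_def using unity_root_cong[OF n_pos] cong_scalar_right by metis

lemma subspace_weight: assumes "a \<noteq> b" shows "subspace {v. weight a b c v}"
proof -
  have l: "app (X a b t) (x + y) = app (X a b t) x + app (X a b t) y" "app (X a b t) (scl r x) = scl r (app (X a b t) x)"
     "app (X a b t) 0 = 0" for t r x y
    using linear_X[OF assms, of t] vector_space_axioms by (auto simp: Vector_Spaces.linear_iff) (metis add_cancel_right_right)
  show ?thesis
    by (auto simp: subspace_def weight_def l scale_right_distrib mult.commute)
qed

lemma weight_act1:
  assumes "\<And>t. X a b t * g = g * X a' b' (s * t)" "weight a' b' c v" "Vector_Spaces.linear scl scl (app g)"
  shows "weight a b (c * s) (app g v)"
  unfolding weight_def
proof
  fix t
  interpret g: Vector_Spaces.linear scl scl "app g" by fact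
  have "app (X a b t) (app g v) = app g (app (X a' b' (s * t)) v)"
    by (simp flip: app_mult add: assms(1))
  then show "app (X a b t) (app g v) = scl (unity_root n (c * s * t)) (app g v)"
    using assms(2) by (simp add: weightD g.scale mult.assoc)
qed

lemma weight_act2:
  assumes "\<And>t. X a b t * g = g * (X a1 b1 (s1 * t) * X a2 b2 (s2 * t))" "weight a1 b1 c1 v" "weight a2 b2 c2 v"
    "Vector_Spaces.linear scl scl (app g)" "a1 \<noteq> b1"
  shows "weight a b (c1 * s1 + c2 * s2) (app g v)"
  unfolding weight_def
proof
  fix t
  interpret g: Vector_Spaces.linear scl scl "app g" by fact
  interpret x: Vector_Spaces.linear scl scl "app (X a1 b1 (s1 * t))" by (rule linear_X) fact
  have "app (X a b t) (app g v) = app g (app (X a1 b1 (s1 * t)) (app (X a2 b2 (s2 * t)) v))"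
    by (simp flip: app_mult add: assms(1))
  then show "app (X a b t) (app g v) = scl (unity_root n ((c1 * s1 + c2 * s2) * t)) (app g v)"
    using assms(2,3) by (simp add: weightD g.scale x.scale ring_distribs unity_root_add mult_ac)
qed

lemma weight_X_commute: "weight a b \<beta> v \<Longrightarrow> \<lbrakk>a \<noteq> b; c \<noteq> d; b \<noteq> c; a \<noteq> d\<rbrakk> \<Longrightarrow> weight a b \<beta> (app (X c d s) v)"
  using weight_act1[of a b "X c d s" a b 1] by (simp add: X_commute linear_X)

text \<open>A row operation on the matrix of weights: row \<open>b\<close> loses \<open>s\<close>
  times row \<open>a\<close>.\<close>

lemma weight_X_right: "weight b c \<beta> v \<Longrightarrow> weight a c \<gamma> v \<Longrightarrow> \<lbrakk>a \<noteq> b; b \<noteq> c; a \<noteq> c\<rbrakk> \<Longrightarrow> weight b c (\<beta> - s * \<gamma>) (app (X a b s) v)"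
  using weight_act2[of b c "X a b s" a c "- s" b c 1 \<gamma> v \<beta>] by (simp add: X_right_move linear_X algebra_simps)

text \<open>A column operation on the matrix of weights: column \<open>b\<close> gains
  \<open>s\<close> times column \<open>c\<close>.\<close>

lemma weight_X_left: "weight a b \<beta> v \<Longrightarrow> weight a c \<gamma> v \<Longrightarrow> \<lbrakk>a \<noteq> b; b \<noteq> c; a \<noteq> c\<rbrakk> \<Longrightarrow> weight a b (\<beta> + s * \<gamma>) (app (X b c s) v)"
  using weight_act2[of a b "X b c s" a c s a b 1 \<gamma> v \<beta>] by (simp add: X_left_move linear_X algebra_simps)

text \<open>Repeated use yields joint eigenvectors: \<open>U\<close> records the weights fixed so
  far, and the next root element has to preserve them.\<close>

lemma weight_refine:
  assumes "subspace U" "U \<subseteq> W" "a \<noteq> b" "\<And>u. u \<in> U \<Longrightarrow> app (X a b 1) u \<in> U" "v \<in> U" "v \<noteq> 0"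
  obtains u c where "u \<in> U" "u \<noteq> 0" "weight a b c u"
proof -
  have per: "(app (X a b 1) ^^ n) u = u" if "u \<in> U" for u
    using that assms(2,3) by (simp add: X_power period_W subset_iff flip: app_power)
  obtain c u where "u \<in> U" "u \<noteq> 0" "app (X a b 1) u = scl (unity_root n c) u"
    by (rule eigenvector_exists[OF linear_X[OF assms(3), of 1] n_pos assms(1,4) per assms(5,6)])
  then show ?thesis using that[of u c] weightI assms by auto
qed

lemma weight_refine_moved:
  assumes "subspace U" "U \<subseteq> W" "a \<noteq> b" "\<And>u. u \<in> U \<Longrightarrow> app (X a b 1) u \<in> U" "v \<in> U" "app (X a b (int r)) v \<noteq> v"
  obtains u c where "u \<in> U" "u \<noteq> 0" "weight a b c u" "\<not> int n dvd int r * c"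
proof -
  have per: "(app (X a b 1) ^^ n) u = u" if "u \<in> U" for u
    using that assms(2,3) by (simp add: X_power period_W subset_iff flip: app_power)
  have mov: "(app (X a b 1) ^^ r) v \<noteq> v"
    using assms(3,6) by (simp add: X_power flip: app_power)
  obtain c u where "u \<in> U" "u \<noteq> 0" "app (X a b 1) u = scl (unity_root n c) u" "\<not> int n dvd int r * c"
    by (rule eigenvector_moved[OF linear_X[OF assms(3), of 1] n_pos assms(1,4) per assms(5) mov])
  then show ?thesis using that[of u c] weightI assms by auto
qed

text \<open>The commutator formula with 1 as the other parameter carries triviality along rows
  (\<open>right\<close>) and along columns (\<open>left\<close>), hence to every position.\<close>

lemma X_trivial_all:
  assumes "j \<noteq> k" "\<And>v. v \<in> W \<Longrightarrow> app (X j k s) v = v"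
  shows "a \<noteq> b \<Longrightarrow> v \<in> W \<Longrightarrow> app (X a b s) v = v"
proof -
  define T where "T a b \<longleftrightarrow> (\<forall>v\<in>W. app (X a b s) v = v)" for a b
  have right: "T a c" if "T a b" "a \<noteq> b" "b \<noteq> c" "a \<noteq> c" for a b c
    unfolding T_def
  proof
    fix v assume v: "v \<in> W"
    have "X a c s * (X b c 1 * X a b s) = X a b s * X b c 1"
      using X_comm[OF that(2,3,4), of s 1] by (simp add: mult.assoc)
    then have "app (X a c s) (app (X b c 1) (app (X a b s) v)) = app (X a b s) (app (X b c 1) v)"
      by (metis app_mult)
    then have "app (X a c s) (app (X b c 1) v) = app (X b c 1) v"
      using that(1) v W_inv[of b c v 1] that(3) unfolding T_def by simp
    moreover have "X a c s * X b c 1 = X b c 1 * X a c s" using that by (intro X_commute) auto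
    ultimately have "app (X b c 1) (app (X a c s) v) = app (X b c 1) v" by (metis app_mult)
    then show "app (X a c s) v = v" by (simp only: app_inj)
  qed
  have left: "T c b" if "T a b" "a \<noteq> b" "c \<noteq> a" "c \<noteq> b" for a b c
    unfolding T_def
  proof
    fix v assume v: "v \<in> W"
    have "X c b s * (X a b s * X c a 1) = X c a 1 * X a b s"
      using X_comm[OF that(3,2,4), of 1 s] by (simp add: mult.assoc)
    then have "app (X c b s) (app (X a b s) (app (X c a 1) v)) = app (X c a 1) (app (X a b s) v)"
      by (metis app_mult)
    then have "app (X c b s) (app (X c a 1) v) = app (X c a 1) v"
      using that(1) v W_inv[of c a v 1] that(3) unfolding T_def by simp
    moreover have "X c b s * X c a 1 = X c a 1 * X c b s" using that by (intro X_commute) auto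
    ultimately have "app (X c a 1) (app (X c b s) v) = app (X c a 1) v" by (metis app_mult)
    then show "app (X c b s) v = v" by (simp only: app_inj)
  qed
  have jk: "T j k" using assms(2) by (simp add: T_def)
  have jb: "T j b" if "b \<noteq> j" for b using right[OF jk assms(1)] jk that by metis
  have ab: "T a b" if "b \<noteq> j" "a \<noteq> b" for a b using left[OF jb[OF that(1)]] jb that by metis
  have "T a b" if "a \<noteq> b" for a b
  proof (cases "b = j")
    case True
    obtain c where c: "c \<noteq> a" "c \<noteq> j" using third_index by blast
    then have "T a c" using ab by simp
    then show ?thesis using right[of a c b] c that True by auto
  qed (use ab that in auto)
  then show "a \<noteq> b \<Longrightarrow> v \<in> W \<Longrightarrow> app (X a b s) v = v" by (simp add: T_def)
qed

lemma w_W_one: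
  assumes "a \<noteq> b" "v \<in> W" "coprime u q" "[u = 1] (mod int n)" shows "app (w a b u) v = app (w a b 1) v"
proof -
  have "[u * inv_mod u = 1] (mod int n)" "[inv_mod 1 = 1] (mod int n)"
    using inv_mod[OF assms(3)] inv_mod[of 1] n_dvd by (auto intro: cong_dvd_modulus)
  moreover have "[u * inv_mod u = inv_mod u] (mod int n)"
    using cong_scalar_right[OF assms(4), of "inv_mod u"] by simp
  ultimately have "[inv_mod u = inv_mod 1] (mod int n)"
    by (meson cong_trans[OF cong_sym cong_trans[OF _ cong_sym]])
  then have "[- inv_mod u = - inv_mod 1] (mod int n)" by (simp add: cong_minus_minus_iff)
  then show ?thesis using assms X_W_cong[of b a] X_W_cong[of a b] by (simp add: w_def W_inv)
qed

lemma h_W_one: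
  assumes "a \<noteq> b" "v \<in> W" "coprime u q" "[u = 1] (mod int n)" shows "app (h a b u) v = v"
proof -
  have "app (h a b u) v = app (h a b 1) v"
    using w_W_one[OF assms(1) _ assms(3,4)] assms W_inv_w by (simp add: h_def)
  then show ?thesis using assms(1) by simp
qed

end

context steinberg_action_period
begin

lemma X_mult_fix: assumes "a \<noteq> b" "app (X a b s) v = v" shows "app (X a b (s * x)) v = v"
proof -
  have nat: "app (X a b (s * int t)) v = v" for t
    by (induction t) (use assms in \<open>simp_all add: ring_distribs X_add\<close>)
  have "app (X a b (- t)) v = v" if "app (X a b t) v = v" for t
    using that assms(1) X_add[of a b "- t" t] by (metis X_0 add.left_inverse app_mult app_one)
  then show ?thesis
    using nat by (cases x rule: int_cases2) auto
qed

definition weight_proj :: "'i \<Rightarrow> 'i \<Rightarrow> int \<Rightarrow> 'v \<Rightarrow> 'v" where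
  "weight_proj a b c = eig_proj (app (X a b 1)) n c"

lemma linear_weight_proj: "a \<noteq> b \<Longrightarrow> Vector_Spaces.linear scl scl (weight_proj a b c)"
  unfolding weight_proj_def by (intro linear_eig_proj linear_X)

lemma weight_proj_weight: "a \<noteq> b \<Longrightarrow> weight a b c' v \<Longrightarrow> weight_proj a b c v = (if [c' = c] (mod int n) then scl (of_nat n) v else 0)"
  unfolding weight_proj_def by (rule eig_proj_of_eigen[OF linear_X n_pos]) (auto simp: weightD)

section \<open>Character matrices at a prime power\<close>

context
  fixes i j k l :: 'i and p m' :: nat
  assumes distinct: "distinct [i, j, k, l]"
    and p: "prime p" and n_eq: "n = p ^ Suc m'"
begin

lemma neq: "i \<noteq> j" "i \<noteq> k" "i \<noteq> l" "j \<noteq> k" "j \<noteq> l" "k \<noteq> l"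
  "j \<noteq> i" "k \<noteq> i" "l \<noteq> i" "k \<noteq> j" "l \<noteq> j" "l \<noteq> k"
  using distinct by auto

text \<open>The parameter \<open>p ^ m'\<close> is one factor \<open>p\<close> short of the period:
  on a nonzero vector of weight \<open>c\<close> it acts nontrivially exactly when \<open>c\<close>
  is prime to \<open>p\<close>.\<close>

lemma dvd_iff: "int n dvd int (p ^ m') * c \<longleftrightarrow> int p dvd c"
  using p prime_gt_0_nat[OF p] unfolding n_eq by (simp add: mult.commute)

lemma unit_n: assumes "\<not> int p dvd c" shows "coprime c (int n)"
proof -
  have "coprime (int p) c" using p assms by (intro prime_imp_coprime) auto
  then show ?thesis by (simp add: n_eq coprime_commute)
qed

text \<open>The character matrix on rows \<open>i, j\<close> and columns \<open>k, l\<close> is antidiagonal with entries \<open>d, c\<close>.\<close>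

definition standard :: "int \<Rightarrow> int \<Rightarrow> 'v \<Rightarrow> bool" where
  "standard c d v \<longleftrightarrow> v \<in> W \<and> weight i k 0 v \<and> weight j k c v \<and> weight j l 0 v \<and> weight i l d v"

text \<open>A column operation clears the (j, l) entry by means of the unit \<open>c\<close>; row
  \<open>i\<close> is unchanged because of its zero at (i, k).\<close>

lemma to_standard:
  assumes "v \<in> W" "v \<noteq> 0" "weight i k 0 v" "weight j k c v" "weight j l \<beta> v" "weight i l d v" "\<not> int p dvd c"
  obtains u where "u \<noteq> 0" "standard c d u"
proof -
  obtain s where s: "[c * s = - \<beta>] (mod int n)" using cong_solve_coprime_int[OF unit_n[OF assms(7)]]
    by (metis cong_scalar_right mult.assoc mult_1_left)
  let ?u = "app (X l k s) v"
  have "weight j l 0 ?u"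
    using weight_X_left[OF assms(5,4), of s] s neq by (auto elim!: weight_cong simp: cong_iff_dvd_diff algebra_simps)
  moreover have "weight i l d ?u" using weight_X_left[OF assms(6,3), of s] neq by simp
  moreover have "weight i k 0 ?u" "weight j k c ?u" using assms neq by (auto intro!: weight_X_commute)
  moreover have "?u \<noteq> 0" by (intro app_nonzero linear_X neq assms)
  ultimately show ?thesis using that[of ?u] W_inv[OF neq(12) assms(1)] by (simp add: standard_def)
qed

text \<open>A row operation with the unit \<open>c\<close> first clears the (i, k) entry.\<close>

lemma to_standard':
  assumes "v \<in> W" "v \<noteq> 0" "weight i k \<alpha> v" "weight j k c v" "weight j l \<beta> v" "weight i l \<gamma> v" "\<not> int p dvd c"
  obtains u d where "u \<noteq> 0" "standard c d u"
proof -
  obtain s where s: "[c * s = \<alpha>] (mod int n)" using cong_solve_coprime_int[OF unit_n[OF assms(7)]]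
    by (metis cong_scalar_right mult.assoc mult_1_left)
  let ?u = "app (X j i s) v"
  have 1: "weight i k 0 ?u"
    using weight_X_right[OF assms(3,4), of s] s neq by (auto elim!: weight_cong simp: cong_iff_dvd_diff algebra_simps dvd_diff_commute)
  have 2: "weight i l (\<gamma> - s * \<beta>) ?u" using weight_X_right[OF assms(6,5), of s] neq by simp
  have 3: "weight j l \<beta> ?u" "weight j k c ?u" using assms neq by (auto intro!: weight_X_commute)
  have "?u \<noteq> 0" by (intro app_nonzero linear_X neq assms)
  then show ?thesis using to_standard[OF W_inv[OF neq(7) assms(1)] _ 1 3(2,1) 2 assms(7)] that by metis
qed

lemma subspace_Int_weight: "a \<noteq> b \<Longrightarrow> subspace U \<Longrightarrow> subspace (U \<inter> {v. weight a b c v})"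
  by (intro subspace_inter subspace_weight)

lemma standard_exists:
  assumes "v0 \<in> W" "app (X j k (int (p ^ m'))) v0 \<noteq> v0"
  obtains v c d where "v \<noteq> 0" "standard c d v" "\<not> int p dvd c"
proof -
  obtain v1 c where v1: "v1 \<in> W" "v1 \<noteq> 0" "weight j k c v1" "\<not> int n dvd int (p ^ m') * c"
    by (rule weight_refine_moved[OF subspace_W order_refl neq(4) _ assms]) (use neq in \<open>auto intro!: W_inv\<close>)
  let ?U1 = "W \<inter> {v. weight j k c v}"
  have U1: "subspace ?U1" using neq by (intro subspace_Int_weight subspace_W)
  obtain v2 \<alpha> where v2: "v2 \<in> ?U1" "v2 \<noteq> 0" "weight i k \<alpha> v2"
    by (rule weight_refine[OF U1 _ neq(2) _ _ v1(2)]) (use v1 neq in \<open>auto intro!: W_inv weight_X_commute\<close>)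
  let ?U2 = "?U1 \<inter> {v. weight i k \<alpha> v}"
  have U2: "subspace ?U2" using neq by (intro subspace_Int_weight U1)
  obtain v3 \<beta> where v3: "v3 \<in> ?U2" "v3 \<noteq> 0" "weight j l \<beta> v3"
    by (rule weight_refine[OF U2 _ neq(5) _ _ v2(2)]) (use v2 neq in \<open>auto intro!: W_inv weight_X_commute\<close>)
  let ?U3 = "?U2 \<inter> {v. weight j l \<beta> v}"
  have U3: "subspace ?U3" using neq by (intro subspace_Int_weight U2)
  obtain v4 \<gamma> where v4: "v4 \<in> ?U3" "v4 \<noteq> 0" "weight i l \<gamma> v4"
    by (rule weight_refine[OF U3 _ neq(3) _ _ v3(2)]) (use v3 neq in \<open>auto intro!: W_inv weight_X_commute\<close>)
  have c: "\<not> int p dvd c" using v1(4) by (simp only: dvd_iff not_False_eq_True)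
  show ?thesis
    by (rule to_standard'[of v4 \<alpha> c \<beta> \<gamma>]) (use v4 c that in auto)
qed

text \<open>The row operation changes the (j, l) entry by a multiple of \<open>n\<close>, so it
  stabilizes the character. Eigenvectors of such an \<open>X i j s\<close> can therefore be sought
  among standard vectors.\<close>

lemma standard_X:
  assumes "standard c d v" "int n dvd s * d" shows "standard c d (app (X i j s) v)"
proof -
  have "weight j k (c - s * 0) (app (X i j s) v)" using assms(1) neq by (intro weight_X_right) (auto simp: standard_def)
  moreover have "weight j l (0 - s * d) (app (X i j s) v)" using assms(1) neq by (intro weight_X_right) (auto simp: standard_def)
  then have "weight j l 0 (app (X i j s) v)" by (rule weight_cong) (use assms(2) in \<open>simp add: cong_iff_dvd_diff\<close>)
  ultimately show ?thesis using assms(1) neq by (auto simp: standard_def intro!: W_inv weight_X_commute)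
qed

lemma standard_subspace: "subspace {v. standard c d v}"
proof -
  have "{v. standard c d v} = W \<inter> {v. weight i k 0 v} \<inter> {v. weight j k c v} \<inter> {v. weight j l 0 v} \<inter> {v. weight i l d v}"
    by (auto simp: standard_def)
  then show ?thesis using neq by (simp only:) (intro subspace_Int_weight subspace_W; simp)
qed

text \<open>
  The new vector is a Weyl translate of a joint eigenvector of \<open>X i j\<close>, \<open>X i k\<close>, \<open>X l k\<close> and \<open>X l j\<close>.
  The weight of \<open>X l k\<close> can be taken to be a unit because \<open>X j k\<close> is the commutator of \<open>X j l\<close>, which
  fixes the vector, and \<open>X l k\<close>.
\<close>

lemma standard_descent:
  assumes "standard c d v" "\<not> int p dvd c" "gcd d (int n) * D' = int n" "app (X i j D') v \<noteq> v"
  obtains u c' d' where "u \<noteq> 0" "standard c' d' u" "\<not> int p dvd c'" "gcd d' (int n) < gcd d (int n)"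
proof -
  \<comment> \<open>\<open>D'\<close> is \<open>n\<close> divided by \<open>D\<close>, so
    \<open>?Y\<close> raised to the power \<open>D\<close> is \<open>X i j (int n)\<close>, which is
    trivial on \<open>W\<close>. The eigenvalues of \<open>?Y\<close> on \<open>W\<close> are thus
    roots of unity of order dividing \<open>D\<close>.\<close>
  define D where "D = nat (gcd d (int n))"
  have D: "D > 0" "int D = gcd d (int n)" using n_pos by (auto simp: D_def)
  have nd: "int n dvd D' * d"
    by (metis assms(3) dvd_refl gcd_dvd1 mult.commute mult_dvd_mono)
  let ?Y = "X i j D'"
  obtain e v2 where v2: "standard c d v2" "v2 \<noteq> 0" "app ?Y v2 = scl (unity_root D e) v2" "\<not> int D dvd e"
  proof -
    have Y: "(app ?Y ^^ D) u = u" if "standard c d u" for u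
    proof -
      have "(app ?Y ^^ D) u = app (X i j (int n)) u"
        using neq assms(3) by (simp add: X_power D(2) mult.commute flip: app_power)
      then show ?thesis using that neq period_W by (simp add: standard_def)
    qed
    show ?thesis
      by (rule eigenvector_moved[OF linear_X[OF neq(1), of D'] D(1) standard_subspace, of c d v 1])
        (use assms(1,4) standard_X[OF _ nd] Y that in auto)
  qed
  \<comment> \<open>Kept are the eigenvalue of \<open>?Y\<close> and the weight at (i, k); the root
    elements \<open>X l k\<close> and \<open>X i j\<close> used next preserve both. The other three
    weights are given up.\<close>
  let ?V = "W \<inter> {v. app ?Y v = scl (unity_root D e) v} \<inter> {v. weight i k 0 v}"
  interpret Y: Vector_Spaces.linear scl scl "app ?Y" using neq by (intro linear_X)
  have V: "subspace ?V"
    using neq by (intro subspace_Int_weight subspace_inter subspace_W)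
      (auto simp: subspace_def Y.add Y.scale Y.zero scale_right_distrib mult.commute)
  have Yc: "app ?Y (app (X a b 1) u) = scl r (app (X a b 1) u)"
    if "app ?Y u = scl r u" "a \<noteq> b" "j \<noteq> a" "b \<noteq> i" for a b u r
  proof -
    interpret x: Vector_Spaces.linear scl scl "app (X a b 1)" using that by (intro linear_X)
    have "app ?Y (app (X a b 1) u) = app (X a b 1) (app ?Y u)"
      using X_commute[of i j a b D' 1] neq that by (metis app_mult)
    then show ?thesis using that by (simp add: x.scale)
  qed
  have "app (X l k (int (p ^ m'))) v2 \<noteq> v2"
  proof
    assume a: "app (X l k (int (p ^ m'))) v2 = v2"
    have b: "app (X j l 1) v2 = v2" using v2(1) weightD[of j l 0 v2 1] by (simp add: standard_def)
    have "X j l 1 * X l k (int (p ^ m')) = X j k (int (p ^ m')) * X l k (int (p ^ m')) * X j l 1"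
      using X_comm[of j l k 1 "int (p ^ m')"] neq by simp
    then have "app (X j k (int (p ^ m'))) v2 = v2" using a b by (metis app_mult)
    then have "scl (unity_root n (c * int (p ^ m'))) v2 = scl 1 v2" using v2(1) weightD[of j k c v2] by (simp add: standard_def)
    then have "unity_root n (c * int (p ^ m')) = 1" using v2(2) by (simp only: scale_right_imp_eq)
    then show False using assms(2) dvd_iff[of c] n_pos by (simp add: unity_root_eq_1_iff mult.commute)
  qed
  then obtain v3 f where v3: "v3 \<in> ?V" "v3 \<noteq> 0" "weight l k f v3" "\<not> int n dvd int (p ^ m') * f"
    by (rule weight_refine_moved[OF V _ neq(12), rotated 3]) (use v2 neq in \<open>auto intro!: W_inv weight_X_commute Yc simp: standard_def\<close>)
  have f: "\<not> int p dvd f" using v3(4) by (simp only: dvd_iff not_False_eq_True)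
  let ?V3 = "?V \<inter> {v. weight l k f v}"
  have V3: "subspace ?V3" using neq by (intro subspace_Int_weight V)
  obtain v4 g where v4: "v4 \<in> ?V3" "v4 \<noteq> 0" "weight i j g v4"
    by (rule weight_refine[OF V3 _ neq(1) _ _ v3(2)]) (use v3 neq in \<open>auto intro!: W_inv weight_X_commute Yc\<close>)
  have "scl (unity_root n (g * D')) v4 = scl (unity_root D e) v4" using v4(1) weightD[OF v4(3), of D'] by simp
  then have "unity_root n (g * D') = unity_root D e" using v4(2) scale_right_imp_eq by blast
  \<comment> \<open>As n = D * D', the character \<open>g\<close> takes a D-th root of unity as its
    value at \<open>D'\<close>. Comparison with \<open>e\<close> shows that \<open>D\<close> does
    not divide \<open>g\<close>.\<close>
  moreover have "unity_root n (g * D') = unity_root D g"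
  proof -
    have "real n = real D * of_int D'" using assms(3) D(2) by (metis of_int_mult of_int_of_nat_eq)
    moreover have "D' \<noteq> 0" using assms(3) n_pos by auto
    ultimately show ?thesis using D(1) by (simp add: unity_root_def field_simps)
  qed
  ultimately have g: "\<not> int D dvd g" using v2(4) D(1) unity_root_eq_1_iff by metis
  let ?V4 = "W \<inter> {v. weight i k 0 v} \<inter> {v. weight l k f v} \<inter> {v. weight i j g v}"
  have V4: "subspace ?V4" using neq by (intro subspace_Int_weight subspace_W) auto
  obtain v5 r where v5: "v5 \<in> ?V4" "v5 \<noteq> 0" "weight l j r v5"
    by (rule weight_refine[OF V4 _ neq(11) _ _ v4(2)]) (use v4 neq in \<open>auto intro!: W_inv weight_X_commute\<close>)
  \<comment> \<open>This Weyl element exchanges \<open>j\<close> and \<open>l\<close>. Up to sign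
    the weights at (i, j), (l, k) and (l, j) move to (i, l), (j, k) and (j, l), so \<open>g\<close>
    takes the place of \<open>d\<close>.\<close>
  let ?u = "app (w j l (-1)) v5"
  have w: "inverse (w j l (-1)) = w j l 1" using w_uminus[of j l 1] neq by simp
  have i1: "[inv_mod 1 = 1] (mod q)" by (rule inv_mod_unique) auto
  have move: "X a b t * w j l (-1) = w j l (-1) * conjugate (w j l 1) (X a b t)" for a b t
    unfolding w[symmetric] by (simp add: conjugate_def group_simps)
  have "conjugate (w j l 1) (X i l t) = X i j t" for t
    using conjugate_w_kj[of j l i 1 t] neq X_cong[of i j "t * inv_mod 1" t] cong_scalar_left[OF i1, of t] by simp
  then have u1: "weight i l (g * 1) ?u"
    using v5 neq by (intro weight_act1[of i l "w j l (-1)" i j 1] linear_w) (simp_all add: move)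
  have "conjugate (w j l 1) (X j k t) = X l k (- t)" for t
    using conjugate_w_ik[of j l k 1 t] neq X_cong[of l k "- (inv_mod 1 * t)" "- t"] cong_scalar_right[OF i1, of t]
    by (simp add: cong_minus_minus_iff)
  then have u2: "weight j k (f * - 1) ?u"
    using v5 neq by (intro weight_act1[of j k "w j l (-1)" l k "-1"] linear_w) (simp_all add: move)
  have "conjugate (w j l 1) (X j l t) = X l j (- t)" for t
    using conjugate_w_ij[of j l k 1 t] neq X_cong[of l j "- ((inv_mod 1)\<^sup>2 * t)" "- t"] cong_scalar_right[OF cong_pow[OF i1, of 2], of t]
    by (simp add: cong_minus_minus_iff)
  then have u3: "weight j l (r * - 1) ?u"
    using v5 neq by (intro weight_act1[of j l "w j l (-1)" l j "-1"] linear_w) (simp_all add: move)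
  have "conjugate (w j l 1) (X i k t) = X i k t" for t
    using conjugate_w_kl[of j l i 1 k t] neq by simp
  then have u4: "weight i k (0 * 1) ?u"
    using v5 neq by (intro weight_act1[of i k "w j l (-1)" i k 1] linear_w) (simp_all add: move)
  have u5: "?u \<noteq> 0" by (intro app_nonzero linear_w neq v5)
  obtain u where u: "u \<noteq> 0" "standard (f * - 1) (g * 1) u"
    by (rule to_standard[OF _ u5 _ u2 u3 u1]) (use u4 v5 f W_inv_w neq in auto)
  \<comment> \<open>Both gcds are powers of \<open>p\<close>, hence comparable by divisibility, and
    \<open>D\<close> does not divide \<open>g\<close>.\<close>
  have "gcd g (int n) < gcd d (int n)"
  proof -
    obtain a where a: "gcd g (int n) = int p ^ a"
      using divides_primepow[of "int p" "gcd g (int n)" "Suc m'"] p by (auto simp: n_eq)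
    obtain b where b: "gcd d (int n) = int p ^ b"
      using divides_primepow[of "int p" "gcd d (int n)" "Suc m'"] p by (auto simp: n_eq)
    have "\<not> int p ^ b dvd int p ^ a" using g unfolding D(2) b[symmetric] a[symmetric] by auto
    then have "a < b" using le_imp_power_dvd[of b a "int p"] by (cases "b \<le> a") auto
    then show ?thesis unfolding a b using prime_gt_1_nat[OF p] by simp
  qed
  then show ?thesis using that[OF u] f by simp
qed

lemma standard_minimal:
  assumes "v0 \<in> W" "app (X j k (int (p ^ m'))) v0 \<noteq> v0"
  obtains v c d D' where "v \<noteq> 0" "standard c d v" "\<not> int p dvd c" "gcd d (int n) * D' = int n" "app (X i j D') v = v"
proof -
  \<comment> \<open>As \<open>c\<close> is a unit, the gcd of \<open>d\<close> and \<open>n\<close>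
    measures the valuation of the determinant \<open>- c * d\<close> of the character
    matrix.\<close>
  define P where "P z \<longleftrightarrow> (\<exists>v c d. v \<noteq> 0 \<and> standard c d v \<and> \<not> int p dvd c \<and> z = nat (gcd d (int n)))" for z
  obtain v1 c1 d1 where "v1 \<noteq> 0" "standard c1 d1 v1" "\<not> int p dvd c1"
    using standard_exists[OF assms] by metis
  then have "P (nat (gcd d1 (int n)))" unfolding P_def by blast
  then have L: "P (LEAST z. P z)" by (rule LeastI)
  then obtain v c d where v: "v \<noteq> 0" "standard c d v" "\<not> int p dvd c" and least: "(LEAST z. P z) = nat (gcd d (int n))"
    unfolding P_def by blast
  obtain D' where D': "gcd d (int n) * D' = int n" by (metis dvdE gcd_dvd2)
  have "app (X i j D') v = v"
  proof (rule ccontr)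
    assume "app (X i j D') v \<noteq> v"
    then obtain u c' d' where "u \<noteq> 0" "standard c' d' u" "\<not> int p dvd c'" "gcd d' (int n) < gcd d (int n)"
      by (rule standard_descent[OF v(2,3) D'])
    moreover then have "(LEAST z. P z) \<le> nat (gcd d' (int n))" unfolding P_def by (intro Least_le) blast
    ultimately show False unfolding least using gcd_ge_0_int[of d' "int n"] by linarith
  qed
  then show ?thesis using v D' that by blast
qed

lemma dvd_add_of_gcd:
  assumes "gcd d (int n) * D' = int n" "int n dvd x * d" shows "D' dvd x"
proof -
  define G where "G = gcd d (int n)"
  have G: "G \<noteq> 0" using n_pos by (simp add: G_def)
  obtain d1 where d1: "d = G * d1" by (metis G_def dvdE gcd_dvd1)
  have n': "int n = G * D'" using assms(1) by (simp add: G_def)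
  have "gcd d (int n) = \<bar>G\<bar> * gcd d1 D'" unfolding d1 n' by (simp add: gcd_mult_distrib_int)
  then have "G * gcd d1 D' = G" by (simp add: G_def)
  then have "coprime d1 D'" using G by (simp add: coprime_iff_gcd_eq_1)
  moreover have "D' dvd x * d1" using assms(2) G unfolding d1 n' by (simp add: mult.left_commute)
  ultimately show ?thesis by (simp add: coprime_commute coprime_dvd_mult_left_iff)
qed

text \<open>The sum of the translates of \<open>v\<close> over \<open>normal_forms\<close> is
  invariant. It is not zero because its component in the character of \<open>v\<close> is a positive
  multiple of \<open>v\<close>. This needs every word that preserves the character to fix
  \<open>v\<close>; the hypothesis on \<open>X i j D'\<close> supplies it for the unipotent
  stabilizer.\<close>

lemma invariant_of_standard:
  assumes v: "v \<noteq> 0" "standard c d v" "\<not> int p dvd c"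
    and D': "gcd d (int n) * D' = int n" "app (X i j D') v = v"
    and symbol: "\<And>u v. coprime u q \<Longrightarrow> coprime v q \<Longrightarrow> symbol i j u v = 1"
    and nonunit_add: "\<And>x y. \<not> coprime x q \<Longrightarrow> \<not> coprime y q \<Longrightarrow> \<not> coprime (x + y) q"
  obtains v' where "v' \<in> W" "v' \<noteq> 0" "\<And>t. app (X i j t) v' = v'" "\<And>t. app (X j i t) v' = v'"
proof -
  interpret L: steinberg_local X q i j
    by unfold_locales (use neq(1) symbol nonunit_add in auto)
  let ?S = "L.normal_forms"
  define v' where "v' = (\<Sum>y\<in>?S. app y v)"
  have vW: "v \<in> W" and chs: "weight i k 0 v" "weight j k c v" "weight j l 0 v" "weight i l d v" using v(2) by (auto simp: standard_def)
  txt \<open>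
    A translate \<open>y v\<close> projects to \<open>0\<close> unless it has the same weights as \<open>v\<close>, in which case \<open>y v = v\<close>.
  \<close>
  define pj where "pj x = weight_proj i k 0 (weight_proj j k c (weight_proj j l 0 (weight_proj i l d x)))" for x
  interpret p1: Vector_Spaces.linear scl scl "weight_proj i k 0" by (intro linear_weight_proj neq)
  interpret p2: Vector_Spaces.linear scl scl "weight_proj j k c" by (intro linear_weight_proj neq)
  interpret p3: Vector_Spaces.linear scl scl "weight_proj j l 0" by (intro linear_weight_proj neq)
  interpret p4: Vector_Spaces.linear scl scl "weight_proj i l d" by (intro linear_weight_proj neq)
  have pj_weight: "pj x = (if [a = 0] (mod int n) \<and> [b = c] (mod int n) \<and> [e = 0] (mod int n) \<and> [f = d] (mod int n)
      then scl (of_nat n ^ 4) x else 0)" if "weight i k a x" "weight j k b x" "weight j l e x" "weight i l f x" for a b e f x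
  proof -
    have "weight_proj i l d x = (if [f = d] (mod int n) then scl (of_nat n) x else 0)"
      "weight_proj j l 0 x = (if [e = 0] (mod int n) then scl (of_nat n) x else 0)"
      "weight_proj j k c x = (if [b = c] (mod int n) then scl (of_nat n) x else 0)"
      "weight_proj i k 0 x = (if [a = 0] (mod int n) then scl (of_nat n) x else 0)"
      by (rule weight_proj_weight[OF neq(3) that(4)] weight_proj_weight[OF neq(5) that(3)] weight_proj_weight[OF neq(4) that(2)] weight_proj_weight[OF neq(2) that(1)])+
    then show ?thesis
      by (simp add: pj_def p1.scale p2.scale p3.scale p1.zero p2.zero p3.zero power4_eq_xxxx)
  qed
  have main: "pj (app y v) = scl (of_nat n ^ 4) v \<or> pj (app y v) = 0" if "y \<in> ?S" for y
  proof -
    from that obtain \<tau> s u t where y: "y = X i j \<tau> * X j i s * h i j u * X i j t" and u: "coprime u q"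
      by (rule L.normal_formsE)
    obtain u' z where u': "inv_mod u = u'" "u * u' = 1 + q * z" using inv_modE[OF u] by metis
    define v1 v2 v3 where "v1 = app (X i j t) v" and "v2 = app (h i j u) v1" and "v3 = app (X j i s) v2"
    have yv: "app y v = app (X i j \<tau>) v3" by (simp add: y v1_def v2_def v3_def)
    \<comment> \<open>The four factors of \<open>y\<close>, taken from the right, act on the rows of
      the character matrix, and the weights are followed through each of them.\<close>
    have 1: "weight i k 0 v1" "weight i l d v1" "weight j k (c - t * 0) v1" "weight j l (0 - t * d) v1"
      unfolding v1_def using neq
      by (intro weight_X_commute[OF chs(1)] weight_X_commute[OF chs(4)] weight_X_right[OF chs(2,1)] weight_X_right[OF chs(3,4)]; simp)+
    have hm: "Vector_Spaces.linear scl scl (app (h i j u))" by (intro linear_h neq)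
    have hk: "X i k t * h i j u = h i j u * X i k (u' * t)" "X j k t * h i j u = h i j u * X j k (u * t)"
       "X i l t * h i j u = h i j u * X i l (u' * t)" "X j l t * h i j u = h i j u * X j l (u * t)" for t
      using X_h_move[OF neq(1,4,2) u] X_h_move[OF neq(1,5,3) u] u'(1) by simp_all
    have 2: "weight i k (0 * u') v2" "weight i l (d * u') v2" "weight j k ((c - t * 0) * u) v2" "weight j l ((0 - t * d) * u) v2"
      unfolding v2_def
      by (rule weight_act1[OF hk(1) 1(1) hm] weight_act1[OF hk(3) 1(2) hm] weight_act1[OF hk(2) 1(3) hm] weight_act1[OF hk(4) 1(4) hm])+
    have 3: "weight i k (0 * u' - s * ((c - t * 0) * u)) v3" "weight i l (d * u' - s * ((0 - t * d) * u)) v3"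
        "weight j k ((c - t * 0) * u) v3" "weight j l ((0 - t * d) * u) v3"
      unfolding v3_def using neq
      by (intro weight_X_commute[OF 2(3)] weight_X_commute[OF 2(4)] weight_X_right[OF 2(1,3)] weight_X_right[OF 2(2,4)]; simp)+
    have 4: "weight i k (0 * u' - s * ((c - t * 0) * u)) (app y v)" "weight i l (d * u' - s * ((0 - t * d) * u)) (app y v)"
        "weight j k ((c - t * 0) * u - \<tau> * (0 * u' - s * ((c - t * 0) * u))) (app y v)"
        "weight j l ((0 - t * d) * u - \<tau> * (d * u' - s * ((0 - t * d) * u))) (app y v)"
      unfolding yv using neq
      by (intro weight_X_commute[OF 3(1)] weight_X_commute[OF 3(2)] weight_X_right[OF 3(3,1)] weight_X_right[OF 3(4,2)]; simp)+
    note pj = pj_weight[OF 4(1,3,4,2)]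
    show ?thesis
    proof (cases "pj (app y v) = 0")
      case False
      then have e: "[0 * u' - s * ((c - t * 0) * u) = 0] (mod int n)"
        "[(c - t * 0) * u - \<tau> * (0 * u' - s * ((c - t * 0) * u)) = c] (mod int n)"
        "[(0 - t * d) * u - \<tau> * (d * u' - s * ((0 - t * d) * u)) = 0] (mod int n)"
        unfolding pj by (auto split: if_splits)
      \<comment> \<open>Modulo \<open>n\<close> the first congruence gives s = 0, the second u = 1
        and the third (\<tau> + t) d = 0. So \<open>y\<close> acts on \<open>v\<close> as
        \<open>X i j (\<tau> + t)\<close>, a power of \<open>X i j D'\<close>.\<close>
      have cn: "coprime c (int n)" using unit_n[OF v(3)] .
      have un: "coprime u (int n)" using u n_dvd by (meson coprime_divisors dvd_refl)
      have "int n dvd s * (c * u)" using e(1) by (simp add: cong_iff_dvd_diff)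
      then have s: "int n dvd s" using cn un by (simp add: coprime_dvd_mult_left_iff coprime_commute)
      then obtain s1 where s1: "s = int n * s1" by auto
      have "int n dvd c * u + \<tau> * (s * (c * u)) - c" using e(2) by (simp add: cong_iff_dvd_diff)
      moreover have "int n dvd \<tau> * (s * (c * u))" using s by simp
      ultimately have "int n dvd c * u - c" by (metis add_diff_eq add.commute dvd_add_right_iff diff_add_eq)
      then have "int n dvd c * (u - 1)" by (simp add: ring_distribs)
      then have "int n dvd u - 1" using cn by (simp add: coprime_dvd_mult_right_iff coprime_commute)
      then have u1: "[u = 1] (mod int n)" by (simp add: cong_iff_dvd_diff)
      obtain z1 where z1: "u = 1 + int n * z1" using cong_sym[OF u1] unfolding cong_iff_lin by blast
      obtain q1 where q1: "q = int n * q1" using n_dvd by auto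
      obtain z3 where z3: "(0 - t * d) * u - \<tau> * (d * u' - s * ((0 - t * d) * u)) = int n * z3"
        using e(3) by (auto simp: cong_iff_dvd_diff)
      have "int n dvd (\<tau> + t) * d" using z3 u'(2) s1 z1 q1 by Groebner_Basis.algebra
      then have "D' dvd \<tau> + t" by (rule dvd_add_of_gcd[OF D'(1)])
      then have fixv: "app (X i j (\<tau> + t)) v = v" using X_mult_fix[OF neq(1) D'(2)] by (metis dvdE)
      have v1W: "v1 \<in> W" unfolding v1_def by (intro W_inv neq vW)
      have "v2 = v1" unfolding v2_def by (rule h_W_one[OF neq(1) v1W u u1])
      then have "v3 = v1" unfolding v3_def using X_W_dvd[OF neq(7) v1W s] by simp
      then have "app y v = v" using fixv unfolding yv v1_def by (simp add: X_add[OF neq(1)])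
      then show ?thesis using False pj by (auto split: if_splits)
    qed simp
  qed
  have pj_sum: "pj v' = (\<Sum>y\<in>?S. pj (app y v))"
    by (simp add: pj_def v'_def p1.sum p2.sum p3.sum p4.sum)
  have pj1: "pj (app 1 v) = scl (of_nat n ^ 4) v" using pj_weight[OF chs] by simp
  let ?T = "{y \<in> ?S. pj (app y v) \<noteq> 0}"
  have "pj v' = (\<Sum>y\<in>?T. pj (app y v))"
    unfolding pj_sum using L.finite_normal_forms by (intro sum.mono_neutral_right) auto
  also have "\<dots> = (\<Sum>y\<in>?T. scl (of_nat n ^ 4) v)"
    using main by (intro sum.cong refl) auto
  also have "\<dots> = scl (of_nat (card ?T)) (scl (of_nat n ^ 4) v)"
    by (rule sum_constant_scale)
  finally have "pj v' = scl (of_nat (card ?T)) (scl (of_nat n ^ 4) v)" .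
  moreover have "1 \<in> {y\<in>?S. pj (app y v) \<noteq> 0}" using L.one_normal_forms pj1 v(1) n_pos by simp
  then have "card {y\<in>?S. pj (app y v) \<noteq> 0} \<noteq> 0" using L.finite_normal_forms by auto
  ultimately have "pj v' \<noteq> 0" using v(1) n_pos by simp
  then have v'0: "v' \<noteq> 0" by (auto simp: pj_def p1.zero p2.zero p3.zero p4.zero)
  have "v' \<in> W" unfolding v'_def
  proof (rule subspace_sum[OF subspace_W])
    fix y assume "y \<in> ?S"
    then obtain \<tau> s u t where "y = X i j \<tau> * X j i s * h i j u * X i j t" using L.normal_formsE by metis
    then show "app y v \<in> W" using neq vW by (simp add: W_inv W_inv_h)
  qed
  moreover have "app g v' = v'" if g: "\<And>y. y \<in> ?S \<Longrightarrow> g * y \<in> ?S" and l: "Vector_Spaces.linear scl scl (app g)" for g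
  proof -
    interpret g: Vector_Spaces.linear scl scl "app g" by fact
    have inj: "inj_on ((*) g) ?S" by (rule inj_onI) (simp add: group_mult_left_cancel)
    \<comment> \<open>Left multiplication by \<open>g\<close> is injective on a finite set that it
      preserves, so it permutes the summands.\<close>
    have im: "(*) g ` ?S = ?S" using g by (intro card_subset_eq[OF L.finite_normal_forms]) (auto simp: card_image[OF inj])
    have "app g v' = (\<Sum>y\<in>?S. app (g * y) v)" by (simp add: v'_def g.sum)
    also have "\<dots> = (\<Sum>y\<in>(*) g ` ?S. app y v)" by (simp add: sum.reindex[OF inj])
    finally show ?thesis unfolding im v'_def .
  qed
  moreover have "Vector_Spaces.linear scl scl (app (X i j t))" "Vector_Spaces.linear scl scl (app (X j i t))" for t
    by (intro linear_X neq)+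
  ultimately show ?thesis
    using that[OF _ v'0] L.X_mult_normal_forms L.X_mult_normal_forms' by metis
qed

end
end

section \<open>Splitting the modulus\<close>

lemma power_mult_commuting: "x * y = y * x \<Longrightarrow> (x * y) ^ n = x ^ n * y ^ n" for x y :: "'a::monoid_mult"
proof (induction n)
  case (Suc n)
  have "x ^ n * y = y * x ^ n" using Suc.prems by (metis power_commuting_commutes)
  then have "y * (x ^ n * y ^ n) = x ^ n * (y * y ^ n)" by (metis mult.assoc)
  then show ?case using Suc.IH[OF Suc.prems] by (simp add: mult.assoc)
qed simp

context steinberg
begin

lemma w_one: assumes "i \<noteq> j" shows "w i j 1 = X i j 1 * X j i (-1) * X i j 1"
proof -
  have "[inv_mod 1 = 1] (mod q)" by (rule inv_mod_unique) auto
  then have "X j i (- inv_mod 1) = X j i (- 1)"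
    using assms by (intro X_cong) (auto simp: cong_minus_minus_iff)
  then show ?thesis by (simp add: w_def)
qed

text \<open>Except at opposite positions, the commutator is trivial or has a parameter divisible by
  \<open>x * y\<close>. At opposite positions \<open>X a b (x * s)\<close> is first written as a
  commutator through a third index, with the parameter \<open>x * s\<close> factored as
  \<open>(x * s) * x\<close>.\<close>

lemma X_commute_orthogonal:
  assumes "a \<noteq> b" "c \<noteq> d" "[x * y = 0] (mod q)" "[x * x = x] (mod q)"
  shows "X a b (x * s) * X c d (y * t) = X c d (y * t) * X a b (x * s)"
proof -
  have "[(x * y) * (r * r') = 0 * (r * r')] (mod q)" for r r' using assms(3) by (rule cong_scalar_right)
  then have 0: "X a' b' ((x * r) * (y * r')) = 1" "X a' b' ((y * r') * (x * r)) = 1" if "a' \<noteq> b'" for a' b' r r'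
    using X_cong[OF that, of "(x * r) * (y * r')" 0] X_cong[OF that, of "(y * r') * (x * r)" 0] that by (auto simp: mult_ac)
  have *: "X a b (x * s) * X c d (y * t) = X c d (y * t) * X a b (x * s)"
    if "a \<noteq> b" "c \<noteq> d" "\<not> (b = c \<and> a = d)" for a b c d s t
  proof -
    from that consider "b = c" "a \<noteq> d" | "a = d" "b \<noteq> c" | "b \<noteq> c" "a \<noteq> d" by blast
    then show ?thesis
    proof cases
      case 1 then show ?thesis using that X_comm[of a b d "x * s" "y * t"] 0(1)[of a d s t] by simp
    next
      case 2 then show ?thesis using that X_comm[of c a b "y * t" "x * s"] 0(2)[of c b t s] by simp
    next
      case 3 then show ?thesis using that by (intro X_commute)
    qed
  qed
  show ?thesis
  proof (cases "b = c \<and> a = d")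
    case True
    obtain k where k: "k \<noteq> a" "k \<noteq> b" using third_index by blast
    have "[(x * s) * (x * 1) = x * s] (mod q)" using cong_scalar_right[OF assms(4), of s] by (simp add: mult_ac)
    then have e: "X a b (x * s) = X a k (x * s) * X k b (x * 1) * X a k (x * (- s)) * X k b (x * (- 1))"
      using X_commutator[of a k b "x * s" "x * 1"] X_cong[OF assms(1)] k assms(1) by (simp add: X_uminus)
    have c: "X c d (y * t) * X a k (x * r) = X a k (x * r) * X c d (y * t)"
      "X c d (y * t) * X k b (x * r) = X k b (x * r) * X c d (y * t)" for r
      using True k assms(2) *[of a k c d r t] *[of k b c d r t] by auto
    show ?thesis unfolding e by (rule sym) (intro commute_mult c)
  qed (use * assms in auto)
qed

text \<open>Multiplication by an idempotent respects products modulo \<open>q\<close>, so the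
  commutator relation survives in the new family.\<close>

lemma steinberg_idempotent:
  assumes "[x * x = x] (mod q)" "r > 0" "q dvd x * r"
  shows "steinberg (\<lambda>a b t. X a b (x * t)) r"
proof
  show "r > 0" by fact
  show "\<exists>k. k \<noteq> i \<and> k \<noteq> j" for i j :: 'i by (rule third_index)
  fix i j :: 'i and s t assume ij: "i \<noteq> j"
  show "X i j (x * (s + t)) = X i j (x * s) * X i j (x * t)" using ij by (simp add: ring_distribs X_add)
  show "X i j (x * r) = 1" using ij assms(3) X_cong[OF ij, of "x * r" 0] by (simp add: cong_iff_dvd_diff)
  show "X i j (x * s) * X j k (x * t) = X i k (x * (s * t)) * X j k (x * t) * X i j (x * s)"
    if "j \<noteq> k" "i \<noteq> k" for k
  proof -
    have "[x * s * (x * t) = x * (s * t)] (mod q)" using cong_scalar_right[OF assms(1), of "s * t"] by (simp add: mult_ac)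
    then show ?thesis using X_comm[OF ij that, of "x * s" "x * t"] X_cong[OF that(2)] by simp
  qed
  show "X i j (x * s) * X k l (x * t) = X k l (x * t) * X i j (x * s)" if "k \<noteq> l" "j \<noteq> k" "i \<noteq> l" for k l
    using ij that by (intro X_commute)
qed

end

context steinberg_action
begin

lemma prime_power_invariant:
  fixes p :: nat
  assumes distinct: "distinct [i, j, k, l]" and p: "prime p" and q_eq: "q = int p ^ e"
    and two: "p = 2 \<Longrightarrow> w i j 1 ^ 4 = 1" and v: "v \<in> W" "v \<noteq> 0"
  obtains v' where "v' \<in> W" "v' \<noteq> 0" "\<And>t. app (X i j t) v' = v'" "\<And>t. app (X j i t) v' = v'"
proof -
  \<comment> \<open>The period on \<open>W\<close> may be a proper divisor of \<open>q\<close>. By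
    minimality of \<open>m\<close>, a positive \<open>m\<close> leaves some vector moved at
    parameter \<open>p ^ (m - 1)\<close>, and \<open>X_trivial_all\<close> brings this to position
    (j, k).\<close>
  define P where "P m \<longleftrightarrow> (\<forall>a b. a \<noteq> b \<longrightarrow> (\<forall>v\<in>W. app (X a b (int (p ^ m))) v = v))" for m
  have ij: "i \<noteq> j" "j \<noteq> i" "j \<noteq> k" using distinct by auto
  have Pe: "P e" using X_period by (simp add: P_def q_eq)
  define m where "m = (LEAST m. P m)"
  have Pm: "P m" unfolding m_def using Pe by (rule LeastI)
  have "m \<le> e" unfolding m_def using Pe by (rule Least_le)
  then have "int (p ^ m) dvd q" by (simp add: q_eq le_imp_power_dvd)
  then interpret A: steinberg_action_period X q scl W "p ^ m"
    using Pm prime_gt_0_nat[OF p] by unfold_locales (auto simp: P_def)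
  show ?thesis
  proof (cases m)
    case 0
    then show ?thesis using that[OF v] A.X_W_dvd[OF ij(1) v(1)] A.X_W_dvd[OF ij(2) v(1)] by simp
  next
    case (Suc m')
    then have "\<not> P m'" using not_less_Least[of m' P] by (simp add: m_def)
    then obtain a b v1 where "a \<noteq> b" "v1 \<in> W" "app (X a b (int (p ^ m'))) v1 \<noteq> v1" by (auto simp: P_def)
    then obtain v0 where v0: "v0 \<in> W" "app (X j k (int (p ^ m'))) v0 \<noteq> v0"
      using A.X_trivial_all[OF ij(3)] by metis
    have n: "p ^ m = p ^ Suc m'" by (simp add: Suc)
    obtain v c d D' where standard: "v \<noteq> 0" "A.standard i j k l c d v" "\<not> int p dvd c" "gcd d (int (p ^ m)) * D' = int (p ^ m)" "app (X i j D') v = v"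
      by (rule A.standard_minimal[OF distinct p n v0])
    have symbol: "symbol i j u u' = 1" if "coprime u q" "coprime u' q" for u u'
    proof (cases "p = 2")
      case True
      then show ?thesis using symbol_two_power[OF ij(1) that _ two, of e] q_eq by simp
    next
      case False
      then have "odd p" using p by (metis primes_dvd_imp_eq two_is_prime_nat)
      then show ?thesis using symbol_odd_prime_power[OF ij(1) that q_eq p] by simp
    qed
    have cop: "coprime x q" if "\<not> int p dvd x" for x
      using prime_imp_coprime[of "int p" x] p that by (simp add: q_eq coprime_commute)
    have "e > 0" using \<open>m \<le> e\<close> Suc by simp
    then have cop': "int p dvd x" if "\<not> coprime x q" for x using cop that by blast
    have cop'': "\<not> coprime x q" if "int p dvd x" for x
    proof
      assume "coprime x q"
      moreover have "int p dvd q" using \<open>e > 0\<close> by (simp add: q_eq)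
      ultimately have "is_unit (int p)" by (rule coprime_common_divisor[OF _ that])
      then show False using prime_gt_1_nat[OF p] by simp
    qed
    have nonunit_add: "\<not> coprime (x + y) q" if "\<not> coprime x q" "\<not> coprime y q" for x y
      using cop'[OF that(1)] cop'[OF that(2)] by (intro cop'' dvd_add)
    show ?thesis
      by (rule A.invariant_of_standard[OF distinct p n standard symbol nonunit_add]) (use that in auto)
  qed
qed

end

text \<open>Odd prime powers are split off one at a time by idempotents, and the induction continues
  on the vectors invariant under the part split off. The power of 2 comes last; the hypothesis on
  the fourth power is carried along for its sake.\<close>

lemma (in complex_vector_space) steinberg_invariant:
  fixes X :: "'i \<Rightarrow> 'i \<Rightarrow> int \<Rightarrow> 'v bijection"
  assumes "distinct [i, j, k, l]" "N > 0" "steinberg_action X (int N) scl W"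
    and "(X i j 1 * X j i (-1) * X i j 1) ^ 4 = 1" "v \<in> W" "v \<noteq> 0"
  shows "\<exists>v'. v' \<in> W \<and> v' \<noteq> 0 \<and> (\<forall>t. app (X i j t) v' = v' \<and> app (X j i t) v' = v')"
  using assms(2-)
proof (induction N arbitrary: X W v rule: less_induct)
  case (less N)
  interpret S: steinberg_action X "int N" scl W by fact
  have ij: "i \<noteq> j" "j \<noteq> i" using assms(1) by auto
  have w4: "S.w i j 1 ^ 4 = 1" using less.prems(3) ij by (simp add: S.w_one)
  show ?case
  proof (cases "\<exists>p. prime p \<and> odd p \<and> p dvd N")
    case False
    obtain y where y: "N = 2 ^ multiplicity 2 N * y" "\<not> 2 dvd y"
      using multiplicity_decompose'[of N 2] less.prems(1) by auto
    have "y = 1"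
    proof (rule ccontr)
      assume "y \<noteq> 1"
      then obtain p where p: "prime p" "p dvd y" using prime_factor_nat by blast
      then have "odd p" "p dvd N" using y dvd_trans by (blast, metis dvd_mult)
      then show False using False p by blast
    qed
    then have "int N = int 2 ^ multiplicity 2 N" using y(1) by (metis mult_1_right of_nat_power)
    then show ?thesis
      using S.prime_power_invariant[OF assms(1) two_is_prime_nat _ w4 less.prems(4,5)] by metis
  next
    case True
    then obtain p where p: "prime p" "odd p" "p dvd N" by blast
    define e where "e = multiplicity p N"
    obtain M where M: "N = p ^ e * M" "\<not> p dvd M"
      unfolding e_def using multiplicity_decompose'[of N p] less.prems(1) p(1) by (auto simp: prime_nat_iff)
    have "e > 0" unfolding e_def using p less.prems(1) by (simp add: prime_multiplicity_gt_zero_iff prime_elem_multiplicity_eq_zero_iff)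
    have M0: "M > 0" using M(1) less.prems(1) by (intro Nat.gr0I) auto
    have MN: "M < N" using M(1) M0 \<open>e > 0\<close> prime_gt_1_nat[OF p(1)] one_less_power[of p e] by auto
    have cop: "coprime (int (p ^ e)) (int M)"
      using prime_imp_coprime[OF p(1) M(2)] by (simp flip: of_nat_power add: coprime_power_left_iff)
    \<comment> \<open>\<open>x\<close> and \<open>1 - x\<close> are the orthogonal idempotents of
      the splitting N = p^e * M.\<close>
    obtain x where x: "[x = 1] (mod int (p ^ e))" "[x = 0] (mod int M)"
      using binary_chinese_remainder_int[OF cop, of 1 0] by blast
    define x' where "x' = 1 - x"
    have Nz: "int N = int (p ^ e) * int M" by (metis M(1) of_nat_mult)
    have dx: "int M dvd x" "int (p ^ e) dvd x'" "int (p ^ e) dvd x - 1" using x by (auto simp: cong_iff_dvd_diff x'_def dvd_diff_commute)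
    have orth: "int N dvd x * x'" unfolding Nz using mult_dvd_mono[OF dx(2,1)] by (simp add: mult.commute)
    have id: "[x * x = x] (mod int N)" "[x' * x' = x'] (mod int N)" "[x * x' = 0] (mod int N)"
      using orth by (auto simp: x'_def cong_iff_dvd_diff algebra_simps dvd_diff_commute)
    have per: "int N dvd x * int (p ^ e)" "int N dvd x' * int M"
      unfolding Nz using dx by (auto simp: mult.commute[of x] intro!: mult_dvd_mono)
    let ?X = "\<lambda>a b t. X a b (x * t)" and ?Y = "\<lambda>a b t. X a b (x' * t)"
    have pe: "int (p ^ e) > 0" using prime_gt_0_nat[OF p(1)] by simp
    interpret A: steinberg ?X "int (p ^ e)" by (rule S.steinberg_idempotent[OF id(1) pe per(1)])
    interpret B: steinberg ?Y "int M" by (rule S.steinberg_idempotent[OF id(2) _ per(2)]) (use M0 in simp)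
    interpret A: steinberg_action ?X "int (p ^ e)" scl W
      by (intro steinberg_action.intro steinberg_action_axioms.intro A.steinberg_axioms complex_vector_space_axioms
        S.subspace_W S.linear_X S.W_inv)
    have comm: "X a b (x * s) * X c d (x' * t) = X c d (x' * t) * X a b (x * s)" if "a \<noteq> b" "c \<noteq> d" for a b c d s t
      by (rule S.X_commute_orthogonal[OF that id(3,1)])
    have split: "X a b t = X a b (x * t) * X a b (x' * t)" if "a \<noteq> b" for a b t
      using S.X_add[OF that, of "x * t" "x' * t"] by (simp add: x'_def algebra_simps)
    have A4: "A.w i j 1 ^ 4 = 1"
    proof -
      have "A.symbol i j (-1) (-1) = 1"
        using ij p by (intro A.symbol_odd_prime_power[of _ _ _ _ p e]) auto
      then have "inverse (A.w i j 1 ^ 4) = 1" using A.symbol_minus_one[OF ij(1)] by simp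
      then show ?thesis by (metis group_inverse_inverse group_inverse_one)
    qed
    \<comment> \<open>The Weyl element of \<open>X\<close> is the product of the commuting Weyl
      elements of \<open>?X\<close> and \<open>?Y\<close>, and by \<open>A4\<close> the fourth power
      of the former is trivial.\<close>
    have B4: "(?Y i j 1 * ?Y j i (-1) * ?Y i j 1) ^ 4 = 1"
    proof -
      let ?a = "?X i j 1 * ?X j i (-1) * ?X i j 1" and ?b = "?Y i j 1 * ?Y j i (-1) * ?Y i j 1"
      have ab: "?a * ?b = ?b * ?a"
        by (intro commute_mult commute_mult[symmetric] comm ij)
      have "X i j 1 * X j i (-1) * X i j 1 = (?X i j 1 * ?Y i j 1) * (?X j i (-1) * ?Y j i (-1)) * (?X i j 1 * ?Y i j 1)"
        using split[OF ij(1), of 1] split[OF ij(2), of "-1"] by simp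
      also have "\<dots> = ?X i j 1 * (?Y i j 1 * ?X j i (-1)) * ?Y j i (-1) * ?X i j 1 * ?Y i j 1"
        by (simp add: mult.assoc)
      also have "?Y i j 1 * ?X j i (-1) = ?X j i (-1) * ?Y i j 1" by (intro comm[symmetric] ij)
      also have "?X i j 1 * (?X j i (-1) * ?Y i j 1) * ?Y j i (-1) * ?X i j 1 * ?Y i j 1 =
         ?X i j 1 * ?X j i (-1) * ((?Y i j 1 * ?Y j i (-1)) * ?X i j 1) * ?Y i j 1" by (simp add: mult.assoc)
      also have "(?Y i j 1 * ?Y j i (-1)) * ?X i j 1 = ?X i j 1 * (?Y i j 1 * ?Y j i (-1))"
        by (intro commute_mult[symmetric] comm ij)
      finally have "X i j 1 * X j i (-1) * X i j 1 = ?a * ?b" by (simp add: mult.assoc)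
      then have "?a ^ 4 * ?b ^ 4 = 1" using less.prems(3) power_mult_commuting[OF ab, of 4] by metis
      moreover have "?a ^ 4 = 1" using A4 unfolding A.w_one[OF ij(1)] .
      ultimately show ?thesis by (metis mult_1_left)
    qed
    obtain v1 where v1: "v1 \<in> W" "v1 \<noteq> 0" "\<And>t. app (?X i j t) v1 = v1" "\<And>t. app (?X j i t) v1 = v1"
      by (rule A.prime_power_invariant[OF assms(1) p(1) _ _ less.prems(4,5)]) (use p(2) in auto)
    \<comment> \<open>\<open>?Y\<close> commutes with \<open>?X\<close> and so acts on the
      invariants of the \<open>?X\<close>-part.\<close>
    let ?W = "{u \<in> W. \<forall>t. app (?X i j t) u = u \<and> app (?X j i t) u = u}"
    have l: "app (X a b t) (y + z) = app (X a b t) y + app (X a b t) z" "app (X a b t) (scl c y) = scl c (app (X a b t) y)"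
       "app (X a b t) 0 = 0" if "a \<noteq> b" for a b t y z c
      using S.linear_X[OF that, of t] by (auto simp: Vector_Spaces.linear_iff) (metis add_cancel_right_right)
    have sub: "subspace ?W" using S.subspace_W ij unfolding subspace_def by (auto simp: l)
    have inv: "app (?Y a b t) u \<in> ?W" if "a \<noteq> b" "u \<in> ?W" for a b t u
    proof -
      have "app (?X c d s) (app (?Y a b t) u) = app (?Y a b t) (app (?X c d s) u)" if "c \<noteq> d" for c d s
        using comm[OF that \<open>a \<noteq> b\<close>] by (metis app_mult)
      then show ?thesis using that ij S.W_inv by simp
    qed
    have "steinberg_action ?Y (int M) scl ?W"
      by (intro steinberg_action.intro steinberg_action_axioms.intro B.steinberg_axioms complex_vector_space_axioms
        sub S.linear_X inv)
    then obtain v' where v': "v' \<in> ?W" "v' \<noteq> 0" "\<And>t. app (?Y i j t) v' = v'" "\<And>t. app (?Y j i t) v' = v'"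
      using less.IH[OF MN M0 _ B4, of ?W v1] v1 by blast
    have "app (X i j t) v' = v'" "app (X j i t) v' = v'" for t
      using v' split[OF ij(1), of t] split[OF ij(2), of t] by auto
    then show ?thesis using v' by blast
  qed
qed

section \<open>Unipotents have finite order\<close>

context vector_space
begin

text \<open>Coefficients are indexed by the family because its values may repeat; a repetition gives
  the coefficients 1 and -1.\<close>

lemma dependent_family:
  fixes f :: "nat \<Rightarrow> 'b"
  assumes "finite B" "span B = UNIV"
  obtains \<alpha> where "\<exists>s\<le>card B. \<alpha> s \<noteq> 0" "(\<Sum>s\<le>card B. scale (\<alpha> s) (f s)) = 0"
proof (cases "inj_on f {..card B}")
  case True
  let ?S = "f ` {..card B}"
  have "card ?S > card B" using True by (simp add: card_image)
  then have "dependent ?S" using independent_span_bound[of B ?S] assms by force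
  then obtain u where u: "\<exists>v\<in>?S. u v \<noteq> 0" "(\<Sum>v\<in>?S. scale (u v) v) = 0"
    by (auto simp: dependent_finite)
  then show ?thesis using that[of "u \<circ> f"] True by (auto simp: sum.reindex)
next
  case False
  then obtain s t where st: "s \<le> card B" "t \<le> card B" "s \<noteq> t" "f s = f t" by (auto simp: inj_on_def)
  define \<alpha> :: "nat \<Rightarrow> 'a" where "\<alpha> r = (if r = s then 1 else if r = t then - 1 else 0)" for r
  have "(\<Sum>r\<le>card B. scale (\<alpha> r) (f r)) = (\<Sum>r\<in>{s, t}. scale (\<alpha> r) (f r))"
    using st by (intro sum.mono_neutral_right) (auto simp: \<alpha>_def)
  also have "\<dots> = 0" using st by (simp add: \<alpha>_def)
  finally have "(\<Sum>r\<le>card B. scale (\<alpha> r) (f r)) = 0" .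
  moreover have "\<exists>r\<le>card B. \<alpha> r \<noteq> 0" using st(1) by (intro exI[of _ s]) (simp add: \<alpha>_def)
  ultimately show ?thesis using that[of \<alpha>] by blast
qed

end

context complex_vector_space
begin

text \<open>For a root z of p = (T - z) r, the vector u = r(f) v satisfies f u = z u. If u is zero,
  then r, of smaller degree, annihilates v and takes the place of p.\<close>

lemma eigenvector_of_poly:
  assumes f: "Vector_Spaces.linear scl scl f" and U: "subspace U" "\<And>u. u \<in> U \<Longrightarrow> f u \<in> U"
  shows "p \<noteq> 0 \<Longrightarrow> Polynomial.degree p \<le> n \<Longrightarrow> v \<in> U \<Longrightarrow> v \<noteq> 0 \<Longrightarrow> (\<Sum>s\<le>n. scl (Polynomial.coeff p s) ((f ^^ s) v)) = 0 \<Longrightarrow>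
    \<exists>u\<in>U. u \<noteq> 0 \<and> (\<exists>z. f u = scl z u)"
proof (induction n arbitrary: p)
  case 0
  then have "Polynomial.coeff p 0 \<noteq> 0" by (metis le_zero_eq leading_coeff_0_iff)
  then show ?case using 0 by simp
next
  case (Suc n)
  interpret f: Vector_Spaces.linear scl scl f by fact
  show ?case
  proof (cases "Polynomial.degree p = 0")
    case True
    then have "Polynomial.coeff p 0 \<noteq> 0" using Suc.prems(1) by (metis leading_coeff_0_iff)
    moreover have "(\<Sum>s\<le>Suc n. scl (Polynomial.coeff p s) ((f ^^ s) v)) = scl (Polynomial.coeff p 0) v"
      using True by (subst sum.mono_neutral_right[of _ "{0}"]) (auto simp: coeff_eq_0)
    ultimately show ?thesis using Suc.prems(4,5) by simp
  next
    case False
    then have "\<not> constant (poly p)" by (simp add: constant_degree)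
    then obtain z where "poly p z = 0" using fundamental_theorem_of_algebra by blast
    then obtain r where r: "p = [:- z, 1:] * r" by (metis dvdE poly_eq_0_iff_dvd)
    have r0: "r \<noteq> 0" using r Suc.prems(1) by auto
    have "Polynomial.degree p = Suc (Polynomial.degree r)" using r0 unfolding r by (subst degree_mult_eq) auto
    then have dr: "Polynomial.degree r \<le> n" using Suc.prems(2) by simp
    define u where "u = (\<Sum>s\<le>n. scl (Polynomial.coeff r s) ((f ^^ s) v))"
    have uU: "u \<in> U" unfolding u_def by (intro subspace_sum U subspace_scale funpow_in Suc.prems)
    show ?thesis
    proof (cases "u = 0")
      case True
      then show ?thesis using Suc.IH[OF r0 dr Suc.prems(3,4)] by (simp add: u_def)
    next
      case False
      have cp: "Polynomial.coeff p s = (if s = 0 then 0 else Polynomial.coeff r (s - 1)) - z * Polynomial.coeff r s" for s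
        unfolding r by (cases s) (auto simp: coeff_pCons)
      have "(\<Sum>s\<le>Suc n. scl (Polynomial.coeff p s) ((f ^^ s) v)) =
        (\<Sum>s\<le>Suc n. scl (if s = 0 then 0 else Polynomial.coeff r (s - 1)) ((f ^^ s) v)) - (\<Sum>s\<le>Suc n. scl (z * Polynomial.coeff r s) ((f ^^ s) v))"
        unfolding cp by (simp only: scale_left_diff_distrib sum_subtractf)
      also have "(\<Sum>s\<le>Suc n. scl (if s = 0 then 0 else Polynomial.coeff r (s - 1)) ((f ^^ s) v)) = f u"
        by (subst sum.atMost_Suc_shift) (simp add: u_def f.sum f.scale)
      also have "(\<Sum>s\<le>Suc n. scl (z * Polynomial.coeff r s) ((f ^^ s) v)) = scl z u"
        using dr by (simp add: u_def scale_sum_right coeff_eq_0)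
      finally have "f u = scl z u" using Suc.prems(5) by simp
      then show ?thesis using uU False by blast
    qed
  qed
qed

lemma invariant_subspace_eigenvector:
  assumes B: "finite B" "span B = UNIV" and f: "Vector_Spaces.linear scl scl f"
    and U: "subspace U" "\<And>u. u \<in> U \<Longrightarrow> f u \<in> U" and v: "v \<in> U" "v \<noteq> 0"
  obtains u z where "u \<in> U" "u \<noteq> 0" "f u = scl z u"
proof -
  obtain \<alpha> where \<alpha>: "\<exists>s\<le>card B. \<alpha> s \<noteq> 0" "(\<Sum>s\<le>card B. scl (\<alpha> s) ((f ^^ s) v)) = 0"
    by (rule dependent_family[OF B])
  define p where "p = (\<Sum>s\<le>card B. Polynomial.monom (\<alpha> s) s)"
  have c: "Polynomial.coeff p s = (if s \<le> card B then \<alpha> s else 0)" for s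
    by (simp add: p_def coeff_sum)
  have "p \<noteq> 0" using \<alpha>(1) c by (metis coeff_0)
  moreover have "Polynomial.degree p \<le> card B" by (rule degree_le) (simp add: c)
  moreover have "(\<Sum>s\<le>card B. scl (Polynomial.coeff p s) ((f ^^ s) v)) = 0" using \<alpha>(2) by (simp add: c)
  ultimately show ?thesis using eigenvector_of_poly[OF f U _ _ v] that by blast
qed

end

section \<open>Unitary operators and Heisenberg relations\<close>

context fd_complex_hilbert_space
begin

sublocale complex_vector_space ..

definition unitary :: "('v \<Rightarrow> 'v) \<Rightarrow> bool" where
  "unitary T \<longleftrightarrow> Vector_Spaces.linear scl scl T \<and> (\<forall>x y. ip (T x) (T y) = ip x y)"

lemma ip_zero_left [simp]: "ip 0 y = 0"
  using ip_scale_left[of 0 0 y] by simp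

lemma ip_sum_left: "ip (\<Sum>x\<in>S. f x) y = (\<Sum>x\<in>S. ip (f x) y)"
  by (induction S rule: infinite_finite_induct) (simp_all add: ip_add_left)

lemma ip_scale_right: "ip x (scl c y) = cnj c * ip x y"
  by (metis complex_cnj_mult ip_commute ip_scale_left)

lemma ip_diff_left: "ip (x - y) z = ip x z - ip y z"
  using ip_add_left[of "x - y" y z] by simp

lemma ip_self_eq_0: "ip x x = 0 \<longleftrightarrow> x = 0"
  using ip_pos[of x] by (cases "x = 0") auto

lemma orthogonal_independent:
  assumes "finite S" "0 \<notin> S" "\<And>x y. x \<in> S \<Longrightarrow> y \<in> S \<Longrightarrow> x \<noteq> y \<Longrightarrow> ip x y = 0"
  shows "independent S"
proof
  assume "dependent S"
  then obtain u y where u: "y \<in> S" "u y \<noteq> 0" "(\<Sum>x\<in>S. scl (u x) x) = 0"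
    using assms(1) by (auto simp: dependent_finite)
  have "0 = ip (\<Sum>x\<in>S. scl (u x) x) y" using u(3) by simp
  also have "\<dots> = (\<Sum>x\<in>S. u x * ip x y)" by (simp add: ip_sum_left ip_scale_left)
  also have "\<dots> = (\<Sum>x\<in>{y}. u x * ip x y)"
    using assms u(1) by (intro sum.mono_neutral_right) auto
  finally have "ip y y = 0" using u(2) by simp
  then show False using u(1) assms(2) by (simp add: ip_self_eq_0)
qed

lemma unitary_eigenvalue: assumes "unitary T" "T x = scl a x" "x \<noteq> 0" shows "a * cnj a = 1"
proof -
  have "ip x x = a * cnj a * ip x x"
    using assms(1)[unfolded unitary_def] by (metis assms(2) ip_scale_left ip_scale_right mult.assoc)
  then show ?thesis using assms(3) ip_self_eq_0 by simp
qed

lemma unitary_orthogonal: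
  assumes "unitary T" "T x = scl a x" "T y = scl b y" "a \<noteq> b" "y \<noteq> 0" shows "ip x y = 0"
proof -
  have "ip x y = a * cnj b * ip x y"
    using assms(1)[unfolded unitary_def] by (metis assms(2,3) ip_scale_left ip_scale_right mult.assoc)
  then have "ip x y = 0 \<or> a * cnj b = 1" by simp
  moreover have "a * cnj b \<noteq> 1"
  proof
    assume "a * cnj b = 1"
    then have "a * cnj b = b * cnj b" using unitary_eigenvalue[OF assms(1,3,5)] by simp
    moreover have "cnj b \<noteq> 0" using \<open>a * cnj b = 1\<close> by auto
    ultimately show False using assms(4) by (metis mult_right_cancel)
  qed
  ultimately show ?thesis by blast
qed

text \<open>
  The powers of \<open>a\<close> carry an eigenvector of \<open>b\<close> in the \<open>z\<close>-eigenspace of \<open>c\<close> to eigenvectors of \<open>b\<close> whose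
  eigenvalues are divided by the powers of \<open>z\<close>; too many distinct ones would exceed the dimension.
\<close>

lemma heisenberg_eigenvalue:
  assumes B: "finite B" "span B = UNIV"
    and u: "unitary (app a)" "unitary (app b)" "unitary (app c)"
    and rel: "a * b = c * b * a" "c * a = a * c" "c * b = b * c"
    and x: "app c x = scl z x" "x \<noteq> 0"
  shows "z ^ fact (card B) = 1"
proof -
  interpret a: Vector_Spaces.linear scl scl "app a" using u by (simp add: unitary_def)
  interpret b: Vector_Spaces.linear scl scl "app b" using u by (simp add: unitary_def)
  interpret c: Vector_Spaces.linear scl scl "app c" using u by (simp add: unitary_def)
  let ?E = "{v. app c v = scl z v}"
  have E: "subspace ?E" by (auto simp: subspace_def c.add c.scale c.zero scale_right_distrib mult.commute)
  have aE: "app a v \<in> ?E" if "v \<in> ?E" for v using that rel(2) by (simp add: a.scale flip: app_mult) (simp add: a.scale)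
  have bE: "app b v \<in> ?E" if "v \<in> ?E" for v using that rel(3) by (simp add: b.scale flip: app_mult) (simp add: b.scale)
  obtain v \<mu> where v: "v \<in> ?E" "v \<noteq> 0" "app b v = scl \<mu> v"
    by (rule invariant_subspace_eigenvector[OF B b.linear_axioms E bE, of x]) (use x in auto)
  have z: "z \<noteq> 0" using unitary_eigenvalue[OF u(3) x] by auto
  have \<mu>: "\<mu> \<noteq> 0" using unitary_eigenvalue[OF u(2) v(3,2)] by auto
  define f where "f t = (app a ^^ t) v" for t
  have fE: "f t \<in> ?E" for t unfolding f_def by (rule funpow_in[OF v(1) aE])
  have f0: "f t \<noteq> 0" for t unfolding f_def
    using v(2) by (induction t) (auto, metis a.zero app_inj)
  have fb: "app b (f t) = scl (\<mu> / z ^ t) (f t)" for t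
  proof (induction t)
    case 0 then show ?case using v by (simp add: f_def)
  next
    case (Suc t)
    have "scl (\<mu> / z ^ t) (f (Suc t)) = app a (app b (f t))" by (simp add: Suc a.scale) (simp add: f_def)
    also have "\<dots> = app c (app b (f (Suc t)))" using rel(1) by (simp flip: app_mult add: f_def) (simp add: mult.assoc)
    also have "\<dots> = scl z (app b (f (Suc t)))" using bE[OF fE] by simp
    finally have "scl (1 / z) (scl (\<mu> / z ^ t) (f (Suc t))) = scl (1 / z) (scl z (app b (f (Suc t))))" by simp
    then show ?case using z by (simp add: field_simps)
  qed
  have "\<not> inj_on (\<lambda>t. \<mu> / z ^ t) {..card B}"
  proof
    assume inj: "inj_on (\<lambda>t. \<mu> / z ^ t) {..card B}"
    have ne: "\<mu> / z ^ s \<noteq> \<mu> / z ^ t" if "s \<le> card B" "t \<le> card B" "s \<noteq> t" for s t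
      using inj that by (auto simp: inj_on_def)
    have orth: "ip (f s) (f t) = 0" if "s \<le> card B" "t \<le> card B" "s \<noteq> t" for s t
      by (rule unitary_orthogonal[OF u(2) fb fb ne[OF that] f0])
    have "inj_on f {..card B}"
    proof (rule inj_onI)
      fix s t assume "s \<in> {..card B}" "t \<in> {..card B}" "f s = f t"
      then show "s = t" using orth[of s t] f0[of t] ip_self_eq_0[of "f t"] by auto
    qed
    then have "card (f ` {..card B}) = Suc (card B)" by (simp add: card_image)
    moreover have "independent (f ` {..card B})"
    proof (rule orthogonal_independent)
      show "ip x y = 0" if xy: "x \<in> f ` {..card B}" "y \<in> f ` {..card B}" "x \<noteq> y" for x y
      proof -
        obtain s t where "x = f s" "y = f t" "s \<le> card B" "t \<le> card B" using xy by auto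
        then show ?thesis using orth[of s t] xy(3) by auto
      qed
    qed (use f0 f0[symmetric] in auto)
    ultimately show False using independent_span_bound[OF B(1), of "f ` {..card B}"] B(2) by simp
  qed
  then obtain s t where st: "s < t" "t \<le> card B" "\<mu> / z ^ s = \<mu> / z ^ t"
    unfolding inj_on_def by (metis atMost_iff linorder_neqE_nat)
  have "z ^ s = z ^ t" using st(3) \<mu> z by (simp add: field_simps)
  moreover have "z ^ t = z ^ s * z ^ (t - s)" using st(1) by (simp flip: power_add)
  ultimately have "z ^ s * z ^ (t - s) = z ^ s * 1" by simp
  then have one: "z ^ (t - s) = 1" using z by simp
  \<comment> \<open>The factorial provides one exponent for all eigenvalues
    \<open>z\<close>.\<close>
  have "t - s dvd fact (card B)" using st by (intro dvd_fact) auto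
  then show ?thesis using one by (metis dvdE power_mult power_one)
qed

text \<open>If \<open>M = c ^ N\<close> were not the identity, then the range of \<open>M - 1\<close>, which is orthogonal to the fixed
  vectors of \<open>M\<close>, would contain an eigenvector of \<open>c\<close>, hence a fixed vector of \<open>M\<close>.\<close>

lemma heisenberg_finite_order:
  assumes B: "finite B" "span B = UNIV"
    and u: "unitary (app a)" "unitary (app b)" "unitary (app c)"
    and rel: "a * b = c * b * a" "c * a = a * c" "c * b = b * c"
  shows "c ^ fact (card B) = 1"
proof -
  interpret c: Vector_Spaces.linear scl scl "app c" using u by (simp add: unitary_def)
  let ?N = "fact (card B)"
  let ?M = "app (c ^ ?N)"
  have M: "unitary ?M"
  proof -
    have "ip ((app c ^^ t) x) ((app c ^^ t) y) = ip x y" for t x y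
      using u(3) by (induction t) (simp_all add: unitary_def)
    moreover have "?M = app c ^^ ?N" by (rule ext) (rule app_power)
    ultimately show ?thesis using linear_funpow[OF c.linear_axioms, of ?N] by (simp add: unitary_def)
  qed
  interpret M: Vector_Spaces.linear scl scl ?M using M by (simp add: unitary_def)
  let ?R = "range (\<lambda>x. ?M x - x)"
  have cM: "app c (?M x) = ?M (app c x)" for x by (metis app_mult power_commutes)
  have R: "subspace ?R"
  proof -
    have "Vector_Spaces.linear scl scl (\<lambda>x. ?M x - x)"
      using vector_space_axioms
      by (simp add: Vector_Spaces.linear_iff M.add M.scale algebra_simps scale_right_diff_distrib)
    then interpret D: Vector_Spaces.linear scl scl "\<lambda>x. ?M x - x" .
    show ?thesis by (rule D.subspace_image) simp
  qed
  have cR: "app c y \<in> ?R" if "y \<in> ?R" for y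
    using that cM by (auto simp: c.diff)
  have "?M x = x" for x
  proof (rule ccontr)
    assume "?M x \<noteq> x"
    then have "?M x - x \<noteq> 0" by simp
    then obtain y z where y: "y \<in> ?R" "y \<noteq> 0" "app c y = scl z y"
      using invariant_subspace_eigenvector[OF B c.linear_axioms R cR, of "?M x - x"] by blast
    have "(app c ^^ t) y = scl (z ^ t) y" for t
      by (induction t) (simp_all add: y(3) c.scale mult.commute)
    then have My: "?M y = y" using heisenberg_eigenvalue[OF B u rel y(3,2)] by (simp add: app_power)
    obtain x' where x': "y = ?M x' - x'" using y(1) by blast
    \<comment> \<open>As \<open>?M\<close> is unitary and fixes \<open>y\<close>, the vectors
      \<open>?M x'\<close> and \<open>x'\<close> have the same inner product with \<open>y\<close>,
      so \<open>y\<close> is orthogonal to itself.\<close>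
    have "ip y y = ip (?M x') (?M y) - ip x' y" unfolding My by (subst (1) x') (simp add: ip_diff_left)
    then have "ip y y = 0" using M by (simp add: unitary_def)
    then show False using y(2) ip_self_eq_0 by simp
  qed
  then show ?thesis by (metis app_inject app_one ext)
qed

end

section \<open>Elementary matrices\<close>

definition elem_mat :: "'n \<Rightarrow> 'n \<Rightarrow> int \<Rightarrow> int ^ 'n ^ 'n::finite" where
  "elem_mat i j t = (\<chi> a b. (if a = b then 1 else 0) + (if a = i \<and> b = j then t else 0))"

lemma elem_mat_mult: "(elem_mat i j t ** A) $ a $ b = A $ a $ b + (if a = i then t * A $ j $ b else 0)"
proof -
  have "(elem_mat i j t ** A) $ a $ b =
    (\<Sum>c\<in>UNIV. (if a = c then A $ c $ b else 0) + (if c = j then (if a = i then t * A $ c $ b else 0) else 0))"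
    by (auto simp: matrix_matrix_mult_def elem_mat_def ring_distribs intro!: sum.cong)
  then show ?thesis by (simp add: sum.distrib)
qed

lemma elem_mat_nth: "elem_mat i j t $ a $ b = (if a = b then 1 else 0) + (if a = i \<and> b = j then t else 0)"
  by (simp add: elem_mat_def)

lemma det_elem_mat: "i \<noteq> j \<Longrightarrow> det (elem_mat i j t) = 1"
proof -
  assume ij: "i \<noteq> j"
  have "elem_mat i j t = (\<chi> k. if k = i then row i (mat 1) + t *s row j (mat 1) else row k (mat 1))"
    by (auto simp: vec_eq_iff elem_mat_nth row_def mat_def)
  then show ?thesis using det_row_operation[OF ij, of "mat 1" t] by simp
qed

lemma elem_mat_in_SL: "i \<noteq> j \<Longrightarrow> elem_mat i j t \<in> carrier SL_int"
  by (simp add: SL_int_def det_elem_mat)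

lemma elem_mat_add: "i \<noteq> j \<Longrightarrow> elem_mat i j (s + t) = elem_mat i j s ** elem_mat i j t"
  by (auto simp: vec_eq_iff elem_mat_mult elem_mat_nth)

lemma elem_mat_comm:
  "\<lbrakk>i \<noteq> j; j \<noteq> k; i \<noteq> k\<rbrakk> \<Longrightarrow>
    elem_mat i j s ** elem_mat j k t = elem_mat i k (s * t) ** (elem_mat j k t ** elem_mat i j s)"
  by (auto simp: vec_eq_iff elem_mat_mult elem_mat_nth)

lemma elem_mat_commute:
  "\<lbrakk>i \<noteq> j; k \<noteq> l; j \<noteq> k; i \<noteq> l\<rbrakk> \<Longrightarrow> elem_mat i j s ** elem_mat k l t = elem_mat k l t ** elem_mat i j s"
  by (auto simp: vec_eq_iff elem_mat_mult elem_mat_nth)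

definition weyl :: "'n \<Rightarrow> 'n \<Rightarrow> int ^ 'n ^ 'n::finite" where
  "weyl i j = elem_mat i j 1 ** (elem_mat j i (-1) ** elem_mat i j 1)"

lemma weyl_mult:
  "i \<noteq> j \<Longrightarrow> (weyl i j ** A) $ a $ b = (if a = i then A $ j $ b else if a = j then - (A $ i $ b) else A $ a $ b)"
  by (simp add: weyl_def elem_mat_mult flip: matrix_mul_assoc)

lemma weyl_power_4:
  assumes "i \<noteq> j" shows "weyl i j ** (weyl i j ** (weyl i j ** weyl i j)) = mat 1"
proof -
  have "weyl i j ** (weyl i j ** (weyl i j ** (weyl i j ** A))) = A" for A
    using assms by (auto simp: vec_eq_iff weyl_mult)
  from this[of "mat 1"] show ?thesis by simp
qed

lemma mult_in_SL: "A \<in> carrier SL_int \<Longrightarrow> B \<in> carrier SL_int \<Longrightarrow> A ** B \<in> carrier SL_int"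
  by (simp add: SL_int_def det_mul)

lemma weyl_in_SL: "i \<noteq> j \<Longrightarrow> weyl i j \<in> carrier SL_int"
  unfolding weyl_def by (intro mult_in_SL elem_mat_in_SL) auto

text \<open>Generation of SL_2(Z) by elementary matrices, as an induction rule: \<open>g\<close> is
  reduced to the identity by the Euclidean algorithm on its first column, and each step passes from
  the reduced matrix back to \<open>g\<close>.\<close>

lemma SL2Z_induct:
  assumes g: "g \<in> SL2Z_in_SL4Z"
    and one: "P (mat 1)"
    and step12: "\<And>t g. g \<in> carrier SL4Z \<Longrightarrow> P (elem_mat 1 2 t ** g) \<Longrightarrow> P g"
    and step21: "\<And>t g. g \<in> carrier SL4Z \<Longrightarrow> P (elem_mat 2 1 t ** g) \<Longrightarrow> P g"
  shows "P g"
proof -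
  have n: "(1::4) \<noteq> 2" "(2::4) \<noteq> 1" by simp_all
  have weyl: "P g" if "g \<in> carrier SL4Z" "P (weyl 1 2 ** g)" for g
  proof -
    have 1: "P (elem_mat 1 2 1 ** (elem_mat 2 1 (-1) ** (elem_mat 1 2 1 ** g)))"
      using that(2) by (simp add: weyl_def flip: matrix_mul_assoc)
    have 2: "P (elem_mat 2 1 (-1) ** (elem_mat 1 2 1 ** g))"
      by (rule step12[OF _ 1]) (intro mult_in_SL elem_mat_in_SL n that(1))
    have "P (elem_mat 1 2 1 ** g)"
      by (rule step21[OF _ 2]) (intro mult_in_SL elem_mat_in_SL n that(1))
    then show ?thesis by (rule step12[OF that(1)])
  qed
  have blk: "g \<in> SL2Z_in_SL4Z \<longleftrightarrow> g \<in> carrier SL4Z \<and>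
     (\<forall>i j. (i \<noteq> 1 \<and> i \<noteq> 2 \<or> j \<noteq> 1 \<and> j \<noteq> 2) \<longrightarrow> g $ i $ j = (if i = j then 1 else 0))" for g
    unfolding SL2Z_in_SL4Z_def by auto
  have carr: "g \<in> carrier SL4Z" if "g \<in> SL2Z_in_SL4Z" for g using that by (simp add: SL2Z_in_SL4Z_def)
  have weyl_in: "weyl 1 2 ** g \<in> SL2Z_in_SL4Z" if "g \<in> SL2Z_in_SL4Z" for g
  proof -
    have "weyl 1 2 ** g \<in> carrier SL4Z" using carr[OF that] by (intro mult_in_SL weyl_in_SL n)
    then show ?thesis using that unfolding blk by (auto simp: weyl_mult)
  qed
  have elem_in: "elem_mat 1 2 t ** g \<in> SL2Z_in_SL4Z" if "g \<in> SL2Z_in_SL4Z" for g t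
  proof -
    have "elem_mat 1 2 t ** g \<in> carrier SL4Z" using carr[OF that] by (intro mult_in_SL elem_mat_in_SL n)
    then show ?thesis using that unfolding blk by (auto simp: elem_mat_mult)
  qed
  have unip: "P g" if "g \<in> SL2Z_in_SL4Z" "g $ 2 $ 1 = 0" "g $ 1 $ 1 = 1" "g $ 2 $ 2 = 1" for g
  proof -
    let ?A = "elem_mat 1 2 (- (g $ 1 $ 2)) ** g"
    have "?A $ a $ b = mat 1 $ a $ b" for a b
      using that(1) exhaust_4[of a] exhaust_4[of b] unfolding blk
      by (auto simp: elem_mat_mult that mat_def)
    then have "?A = mat 1" by (simp add: vec_eq_iff)
    then show ?thesis using step12[OF carr[OF that(1)], of "- (g $ 1 $ 2)"] one by simp
  qed
  show ?thesis using g
  proof (induction "nat \<bar>g $ 2 $ 1\<bar>" arbitrary: g rule: less_induct)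
    case less
    note g = less.prems
    show ?case
    proof (cases "g $ 2 $ 1 = 0")
      case True
      have "g $ a $ b = 0" if "b < a" for a b
      proof (cases "a = 2 \<and> b = 1")
        case False
        txt \<open>The order on the index type is \<open>4 < 1 < 2 < 3\<close>, since the numeral \<open>4\<close> denotes \<open>0\<close> there.\<close>
        moreover have "\<not> (2::4) < 1" by (simp add: less_bit0_def bit0.Rep_1 bit0.Rep_numeral)
        ultimately show ?thesis using g that unfolding blk by (metis less_irrefl)
      qed (use True in auto)
      then have "det g = prod (\<lambda>i. g $ i $ i) UNIV" by (rule det_upperdiagonal)
      also have "\<dots> = g $ 1 $ 1 * g $ 2 $ 2 * (g $ 3 $ 3 * g $ 4 $ 4)"
        unfolding UNIV_4 by simp
      also have "g $ 3 $ 3 * g $ 4 $ 4 = 1" using g by (simp add: SL2Z_in_SL4Z_def)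
      finally have "g $ 1 $ 1 * g $ 2 $ 2 = 1" using g by (simp add: SL2Z_in_SL4Z_def SL_int_def)
      then consider "g $ 1 $ 1 = 1" "g $ 2 $ 2 = 1" | "g $ 1 $ 1 = -1" "g $ 2 $ 2 = -1"
        by (auto simp: zmult_eq_1_iff)
      then show ?thesis
      proof cases
        case 1 then show ?thesis by (intro unip g True)
      next
        case 2
        \<comment> \<open>The square of the Weyl matrix is -1 on the upper left block.\<close>
        have "P (weyl 1 2 ** (weyl 1 2 ** g))"
          by (intro unip weyl_in g) (simp_all add: 2 True weyl_mult)
        then have "P (weyl 1 2 ** g)" by (rule weyl[OF carr[OF weyl_in[OF g]]])
        then show ?thesis by (rule weyl[OF carr[OF g]])
      qed
    next
      case False
      \<comment> \<open>The (1, 1) entry is divided with remainder by the (2, 1) entry; the Weyl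
        matrix then brings the negated remainder to (2, 1).\<close>
      let ?t = "- (g $ 1 $ 1 div g $ 2 $ 1)"
      let ?g = "weyl 1 2 ** (elem_mat 1 2 ?t ** g)"
      have "?g $ 2 $ 1 = - (g $ 1 $ 1 mod g $ 2 $ 1)"
        by (simp add: weyl_mult elem_mat_mult minus_div_mult_eq_mod[symmetric])
      then have "nat \<bar>?g $ 2 $ 1\<bar> < nat \<bar>g $ 2 $ 1\<bar>"
        using False abs_mod_less[of "g $ 2 $ 1" "g $ 1 $ 1"] by simp
      then have "P ?g" by (rule less.hyps) (intro weyl_in elem_in g)
      then have "P (elem_mat 1 2 ?t ** g)" by (rule weyl[OF carr[OF elem_in[OF g]]])
      then show ?thesis by (rule step12[OF carr[OF g]])
    qed
  qed
qed

section \<open>Unitary representations of SL_4(Z) as Steinberg families\<close>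

theorem theorem1p1:
  fixes scl :: "complex \<Rightarrow> 'v::ab_group_add \<Rightarrow> 'v"
    and ip :: "'v \<Rightarrow> 'v \<Rightarrow> complex"
    and \<rho> :: "int ^ 4 ^ 4 \<Rightarrow> 'v \<Rightarrow> 'v"
  assumes "fd_complex_hilbert_space scl ip"
    and "\<exists>v::'v. v \<noteq> 0"
    and "\<rho> \<in> hom SL4Z (unitary_group scl ip)"
  shows "\<exists>v. v \<noteq> 0 \<and> (\<forall>g \<in> SL2Z_in_SL4Z. \<rho> g v = v)"
proof -
  interpret H: fd_complex_hilbert_space scl ip by fact
  have mult: "\<rho> (A ** B) = \<rho> A \<circ> \<rho> B" if "A \<in> carrier SL4Z" "B \<in> carrier SL4Z" for A B
    using hom_mult[OF assms(3) that] by (simp add: SL_int_def unitary_group_def)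
  have carr: "Vector_Spaces.linear scl scl (\<rho> A)" "bij (\<rho> A)" "H.unitary (\<rho> A)" if "A \<in> carrier SL4Z" for A
  proof -
    have "\<rho> A \<in> carrier (unitary_group scl ip)" using assms(3) that unfolding hom_def by blast
    then show "Vector_Spaces.linear scl scl (\<rho> A)" "bij (\<rho> A)" "H.unitary (\<rho> A)"
      unfolding unitary_group_def H.unitary_def by simp_all
  qed
  \<comment> \<open>Membership in \<open>hom\<close> gives multiplicativity;
    \<open>\<rho> (mat 1)\<close> is then an injective idempotent, hence the identity.\<close>
  have one: "\<rho> (mat 1) = id"
  proof -
    have m: "mat 1 \<in> carrier SL4Z" by (simp add: SL_int_def)
    have "\<rho> (mat 1) (\<rho> (mat 1) x) = \<rho> (mat 1) x" for x
      using mult[OF m m] by (simp add: fun_eq_iff)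
    then show ?thesis using carr(2)[OF m] by (auto simp: bij_def inj_def)
  qed
  define R where "R A = Bijection (\<rho> A)" for A
  have R_app: "app (R A) = \<rho> A" if "A \<in> carrier SL4Z" for A
    using carr(2)[OF that] by (simp add: R_def Bijection_inverse)
  have R_mult: "R (A ** B) = R A * R B" if "A \<in> carrier SL4Z" "B \<in> carrier SL4Z" for A B
  proof -
    have "app (R (A ** B)) = app (R A * R B)"
      using that by (simp add: R_app mult_in_SL mult fun_eq_iff)
    then show ?thesis by (simp only: app_inject)
  qed
  have R_one: "R (mat 1) = 1" by (simp add: R_def one one_bijection_def)
  note E = elem_mat_in_SL
  define X where "X i j t = R (elem_mat i j t)" for i j :: 4 and t
  have X_app: "app (X i j t) = \<rho> (elem_mat i j t)" if "i \<noteq> j" for i j t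
    by (simp add: X_def R_app E that)
  have X_add: "X i j (s + t) = X i j s * X i j t" if "i \<noteq> j" for i j s t
    using that by (simp add: X_def elem_mat_add R_mult E)
  have X_comm: "X i j s * X j k t = X i k (s * t) * X j k t * X i j s" if "i \<noteq> j" "j \<noteq> k" "i \<noteq> k" for i j k s t
  proof -
    have "X i j s * X j k t = R (elem_mat i j s ** elem_mat j k t)" using that by (simp add: X_def R_mult E)
    also have "\<dots> = X i k (s * t) * (X j k t * X i j s)"
      using that by (simp add: X_def R_mult E mult_in_SL elem_mat_comm[OF that])
    finally show ?thesis by (simp add: mult.assoc)
  qed
  have X_commute: "X i j s * X k l t = X k l t * X i j s" if "i \<noteq> j" "k \<noteq> l" "j \<noteq> k" "i \<noteq> l" for i j k l s t
  proof -
    have "X i j s * X k l t = R (elem_mat i j s ** elem_mat k l t)" using that by (simp add: X_def R_mult E)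
    also have "\<dots> = X k l t * X i j s" using that by (subst elem_mat_commute) (simp_all add: X_def R_mult E)
    finally show ?thesis .
  qed
  have third: "\<exists>k. k \<noteq> i \<and> k \<noteq> j" for i j :: 4
  proof -
    have "card {i, j} < card (UNIV :: 4 set)" by (cases "i = j") simp_all
    then have "{i, j} \<noteq> UNIV" by (metis less_irrefl)
    then show ?thesis by auto
  qed
  obtain B where B: "finite B" "H.span B = UNIV" using H.finite_dim by blast
  \<comment> \<open>The exponent from \<open>heisenberg_finite_order\<close>, applied to
    \<open>X i j 1\<close> as the commutator of \<open>X i k 1\<close> and
    \<open>X k j 1\<close>.\<close>
  define N :: nat where "N = fact (card B)"
  have X_nat: "X i j (int t) = X i j 1 ^ t" if "i \<noteq> j" for i j t
  proof (induction t)
    case 0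
    have "X i j 0 * X i j 0 = X i j 0 * 1" using X_add[OF that, of 0 0] by simp
    then show ?case by (simp only: group_mult_left_cancel of_nat_0 power_0)
  next
    case (Suc t) then show ?case by (simp add: X_add[OF that])
  qed
  have period: "X i j (int N) = 1" if "i \<noteq> j" for i j
  proof -
    obtain k where k: "k \<noteq> i" "k \<noteq> j" using third by blast
    have u: "H.unitary (app (X a b 1))" if "a \<noteq> b" for a b using that by (simp add: X_app carr E)
    have "X i j 1 ^ N = 1" unfolding N_def
    proof (rule H.heisenberg_finite_order[OF B])
      show "H.unitary (app (X i k 1))" "H.unitary (app (X k j 1))" "H.unitary (app (X i j 1))"
        using that k by (auto intro!: u)
      show "X i k 1 * X k j 1 = X i j 1 * X k j 1 * X i k 1" using X_comm[of i k j 1 1] that k by simp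
      show "X i j 1 * X i k 1 = X i k 1 * X i j 1" "X i j 1 * X k j 1 = X k j 1 * X i j 1"
        using that k by (auto intro!: X_commute)
    qed
    then show ?thesis using X_nat[OF that] by simp
  qed
  have "steinberg X (int N)"
    by (rule steinberg.intro) (use third X_add X_comm X_commute period in \<open>simp_all add: N_def\<close>)
  then have "steinberg_action X (int N) scl UNIV"
    by (intro steinberg_action.intro steinberg_action_axioms.intro H.complex_vector_space_axioms)
       (simp_all add: X_app carr E)
  \<comment> \<open>The relation comes from integer matrices, before any reduction modulo
    \<open>N\<close>; the prime 2 depends on it.\<close>
  moreover have "(X 1 2 1 * X 2 1 (-1) * X 1 2 1) ^ 4 = 1"
  proof -
    have n: "(1::4) \<noteq> 2" "(2::4) \<noteq> 1" by simp_all
    let ?w = "weyl (1::4) 2"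
    have w: "?w \<in> carrier SL4Z" by (rule weyl_in_SL[OF n(1)])
    have "R ?w = X 1 2 1 * X 2 1 (-1) * X 1 2 1"
      by (simp add: weyl_def X_def R_mult E mult_in_SL mult.assoc)
    moreover have "R ?w * (R ?w * (R ?w * R ?w)) = R (?w ** (?w ** (?w ** ?w)))"
      using w by (simp only: R_mult mult_in_SL)
    then have "R ?w * (R ?w * (R ?w * R ?w)) = 1" by (simp only: weyl_power_4[OF n(1)] R_one)
    ultimately show ?thesis by (simp add: eval_nat_numeral)
  qed
  moreover obtain v0 :: 'v where "v0 \<noteq> 0" using assms(2) by blast
  moreover have "distinct [1, 2, 3, 4 :: 4]" by simp
  moreover have "N > 0" by (simp add: N_def)
  ultimately obtain v where v: "v \<noteq> 0" "\<And>t. app (X 1 2 t) v = v" "\<And>t. app (X 2 1 t) v = v"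
    using H.steinberg_invariant[of 1 2 3 4 N X UNIV v0] by blast
  have step: "\<rho> g v = v" if "\<rho> (A ** g) v = v" "\<rho> A v = v" "A \<in> carrier SL4Z" "g \<in> carrier SL4Z" for A g
  proof -
    have "\<rho> A (\<rho> g v) = \<rho> A v" using that mult by simp
    then show ?thesis using carr(2)[OF that(3)] by (simp add: bij_def inj_eq)
  qed
  have "\<rho> g v = v" if "g \<in> SL2Z_in_SL4Z" for g
    using that
  proof (rule SL2Z_induct)
    show "\<rho> (mat 1) v = v" by (simp add: one)
    show "\<rho> g v = v" if "g \<in> carrier SL4Z" "\<rho> (elem_mat 1 2 t ** g) v = v" for t g
      using v(2)[of t] by (intro step[OF that(2) _ _ that(1)]) (simp_all add: X_app E)
    show "\<rho> g v = v" if "g \<in> carrier SL4Z" "\<rho> (elem_mat 2 1 t ** g) v = v" for t g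
      using v(3)[of t] by (intro step[OF that(2) _ _ that(1)]) (simp_all add: X_app E)
  qed
  then show ?thesis using v(1) by blast
qed

end
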